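(* Let $K$ be an algebraically closed field of characteristic $0$ in which one can effectively perform calculations (given arithmetic expressions for two elements of $K$, one can decide whether or not they are equal). Then there is an algorithm which, given a birational morphism $\phi: x\to u,\ y\to v$ (with $u,v\in K[x,y]$) of the affine plane $A^2$ over $K$, decides whether or not $\phi$ is a product of simple affine contractions.
   Context: $K[x,y]$ is the polynomial algebra in two variables over $K$ and $A^2$ is the affine plane over $K$. A birational morphism of $A^2$ over $K$ is a mapping $A^2\to A^2$ given by a polynomial mapping (a $K$-algebra endomorphism) $\varphi$ of $K[x,y]$ such that $K(\varphi(x),\varphi(y))=K(x,y)$ (equality of fields of rational functions); it is written $x\to\varphi(x),\ y\to\varphi(y)$. A simple affine contraction is either a polynomial automorphism of $K[x,y]$ (i.e. a $K$-algebra automorphism) or the mapping $\tau_x: x\to x,\ y\to xy$. "Product" means a composition of finitely many such mappings. *)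

theory Defs
  imports
    Complex_Main
    "HOL-Library.Nat_Bijection"
    "HOL-Computational_Algebra.Polynomial_Factorial"
begin

section \<open>Algorithms\<close>

text \<open>An algorithm is a program for a partial recursive function of finitely many natural numbers.\<close>

datatype prog =
    Zero
  | Succ
  | Proj nat
  | Comp prog "prog list"
  | PrimRec prog prog
  | Mu prog

text \<open>\<open>computes P xs y\<close>: the run of \<open>P\<close> on the arguments \<open>xs\<close> terminates with result \<open>y\<close>.\<close>

inductive computes :: "prog \<Rightarrow> nat list \<Rightarrow> nat \<Rightarrow> bool" where
  Zero: "computes Zero xs 0"
| Succ: "computes Succ [n] (Suc n)"
| Proj: "i < length xs \<Longrightarrow> computes (Proj i) xs (xs ! i)"
| Comp: "\<lbrakk>length ys = length gs; \<forall>i<length gs. computes (gs ! i) xs (ys ! i); computes f ys z\<rbrakk>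
    \<Longrightarrow> computes (Comp f gs) xs z"
| PrimRec_0: "computes f xs y \<Longrightarrow> computes (PrimRec f g) (0 # xs) y"
| PrimRec_Suc: "\<lbrakk>computes (PrimRec f g) (n # xs) y; computes g (n # y # xs) z\<rbrakk>
    \<Longrightarrow> computes (PrimRec f g) (Suc n # xs) z"
| Mu: "\<lbrakk>computes f (n # xs) 0; \<forall>m<n. \<exists>y>0. computes f (m # xs) y\<rbrakk>
    \<Longrightarrow> computes (Mu f) xs n"

inductive_cases computes_CompE: "computes (Comp f gs) xs z"
inductive_cases computes_PrimRec_SucE: "computes (PrimRec f g) (Suc n # xs) z"
inductive_cases computes_PrimRec_0E: "computes (PrimRec f g) (0 # xs) z"
inductive_cases computes_MuE: "computes (Mu f) xs z"
inductive_cases computes_ZeroE: "computes Zero xs z"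
inductive_cases computes_SuccE: "computes Succ xs z"
inductive_cases computes_ProjE: "computes (Proj i) xs z"

lemma computes_deterministic:
  "computes P xs y \<Longrightarrow> computes P xs z \<Longrightarrow> y = z"
proof (induction arbitrary: z rule: computes.induct)
  case (Comp ys gs xs f w)
  from Comp.prems obtain ys' where ys': "length ys' = length gs"
    "\<forall>i<length gs. computes (gs ! i) xs (ys' ! i)" "computes f ys' z"
    by (rule computes_CompE)
  have "ys = ys'"
  proof (rule nth_equalityI)
    show "length ys = length ys'" using Comp.hyps ys' by simp
    show "ys ! i = ys' ! i" if "i < length ys" for i
      using that Comp.hyps Comp.IH ys'(2) by simp
  qed
  with ys' Comp.IH(2) show ?case by blast
next
  case (PrimRec_Suc f g n xs y w)
  from PrimRec_Suc.prems obtain y' where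
    y': "computes (PrimRec f g) (n # xs) y'" "computes g (n # y' # xs) z"
    by (rule computes_PrimRec_SucE)
  from PrimRec_Suc.IH(1)[OF y'(1)] PrimRec_Suc.IH(2) y'(2) show ?case by simp
next
  case (Mu f n xs)
  from Mu.prems have z0: "computes f (z # xs) 0" and z: "\<forall>m<z. \<exists>y>0. computes f (m # xs) y"
    by (blast elim: computes_MuE)+
  show ?case
  proof (rule linorder_cases)
    assume "n < z"
    with z obtain y where "y > 0" "computes f (n # xs) y" by blast
    with Mu.IH(1) show ?thesis by blast
  next
    assume "z < n"
    with Mu.IH(2) obtain y where "y > 0" "\<forall>w. computes f (z # xs) w \<longrightarrow> y = w" by blast
    with z0 show ?thesis by blast
  qed
next
  case (Zero xs)
  then show ?case by (rule computes_ZeroE) simp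
next
  case (Succ n)
  then show ?case by (rule computes_SuccE) simp
next
  case (Proj i xs)
  from Proj.prems show ?case by (rule computes_ProjE) simp
next
  case (PrimRec_0 f xs y g)
  from PrimRec_0.prems show ?case by (rule computes_PrimRec_0E) (rule PrimRec_0.IH)
qed


section \<open>Fields in which one can calculate effectively\<close>

text \<open>
  Elements of \<open>K\<close> are given by arithmetic expressions over a sequence \<open>c\<close> of constants of \<open>K\<close>.
  Expressions are finite objects, so every algorithm receives them through a code in \<open>nat\<close>.
  As everywhere in HOL, an expression with a zero denominator denotes \<open>x / 0 = 0\<close>; given the
  decidability of equality, such denominators can be recognised.
\<close>

datatype aexp =
    Const nat
  | Plus aexp aexp
  | Minus aexp aexp
  | Times aexp aexp
  | Div aexp aexp

primrec aval :: "(nat \<Rightarrow> 'k::field) \<Rightarrow> aexp \<Rightarrow> 'k" where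
  "aval c (Const n) = c n"
| "aval c (Plus a b) = aval c a + aval c b"
| "aval c (Minus a b) = aval c a - aval c b"
| "aval c (Times a b) = aval c a * aval c b"
| "aval c (Div a b) = aval c a / aval c b"

primrec aexp_code :: "aexp \<Rightarrow> nat" where
  "aexp_code (Const n) = prod_encode (0, n)"
| "aexp_code (Plus a b) = prod_encode (1, prod_encode (aexp_code a, aexp_code b))"
| "aexp_code (Minus a b) = prod_encode (2, prod_encode (aexp_code a, aexp_code b))"
| "aexp_code (Times a b) = prod_encode (3, prod_encode (aexp_code a, aexp_code b))"
| "aexp_code (Div a b) = prod_encode (4, prod_encode (aexp_code a, aexp_code b))"

definition effective_field :: "(nat \<Rightarrow> 'k::field) \<Rightarrow> bool" where
  "effective_field c \<longleftrightarrow>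
     (\<forall>a. \<exists>e. aval c e = a) \<and>
     (\<exists>P. \<forall>e e'. computes P [aexp_code e, aexp_code e'] (if aval c e = aval c e' then 1 else 0))"


section \<open>The affine plane\<close>

text \<open>\<open>K[x,y]\<close> is \<open>(K[x])[y]\<close>: the inner variable of \<open>'k poly poly\<close> is \<open>x\<close>, the outer one \<open>y\<close>.\<close>

abbreviation const2 :: "'k::field \<Rightarrow> 'k poly poly" where "const2 a \<equiv> [:[:a:]:]"
abbreviation X :: "'k::field poly poly" where "X \<equiv> [:[:0, 1:]:]"
abbreviation Y :: "'k::field poly poly" where "Y \<equiv> [:0, 1:]"

definition alg_endo :: "('k::field poly poly \<Rightarrow> 'k poly poly) \<Rightarrow> bool" where
  "alg_endo \<phi> \<longleftrightarrow> (\<forall>p q. \<phi> (p + q) = \<phi> p + \<phi> q) \<and> (\<forall>p q. \<phi> (p * q) = \<phi> p * \<phi> q) \<and>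
     (\<forall>a. \<phi> (const2 a) = const2 a)"

text \<open>The endomorphism \<open>x \<rightarrow> u, y \<rightarrow> v\<close>.\<close>

definition endo :: "'k::field poly poly \<Rightarrow> 'k poly poly \<Rightarrow> 'k poly poly \<Rightarrow> 'k poly poly" where
  "endo u v p = poly (map_poly (\<lambda>q. poly (map_poly const2 q) u) p) v"

lemma poly_map_poly_hom:
  fixes f :: "'a::comm_ring_1 \<Rightarrow> 'b::comm_ring_1"
  assumes f0: "f 0 = 0" and fa: "\<And>a b. f (a + b) = f a + f b" and fm: "\<And>a b. f (a * b) = f a * f b"
  shows "poly (map_poly f (p + q)) z = poly (map_poly f p) z + poly (map_poly f q) z"
    and "poly (map_poly f (p * q)) z = poly (map_poly f p) z * poly (map_poly f q) z"
proof -
  have pC: "poly (map_poly f (pCons a p)) z = f a + z * poly (map_poly f p) z" for a p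
    by (simp add: map_poly_pCons f0)
  show add: "poly (map_poly f (p + q)) z = poly (map_poly f p) z + poly (map_poly f q) z" for p q
    by (induction p q rule: poly_induct2) (simp_all add: pC fa algebra_simps)
  have sm: "poly (map_poly f (smult a q)) z = f a * poly (map_poly f q) z" for a q
    by (induction q) (simp_all add: pC fm algebra_simps)
  show "poly (map_poly f (p * q)) z = poly (map_poly f p) z * poly (map_poly f q) z"
    by (induction p) (simp_all add: add sm pC f0 algebra_simps)
qed

lemma endo_X: "endo u v X = u" and endo_Y: "endo u v Y = v"
  by (simp_all add: endo_def map_poly_pCons pCons_one map_poly_1')

lemma alg_endo_endo: "alg_endo (endo u v)"
proof -
  define h where "h q = poly (map_poly const2 q) u" for q
  have h: "h 0 = 0" "h (p + q) = h p + h q" "h (p * q) = h p * h q" for p q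
    unfolding h_def
    by (simp, (rule poly_map_poly_hom; simp)+)
  have "endo u v p = poly (map_poly h p) v" for p
    by (simp add: endo_def h_def[abs_def])
  moreover have "h [:a:] = const2 a" for a
    by (simp add: h_def map_poly_pCons)
  ultimately show ?thesis
    unfolding alg_endo_def
    using poly_map_poly_hom[of h, OF h] by (simp add: map_poly_pCons h(1))
qed

lemma endo_unique:
  assumes "alg_endo \<phi>"
  shows "\<phi> = endo (\<phi> X) (\<phi> Y)"
proof
  fix p
  define \<psi> where "\<psi> = endo (\<phi> X) (\<phi> Y)"
  have \<phi>: "\<phi> (p + q) = \<phi> p + \<phi> q" "\<phi> (p * q) = \<phi> p * \<phi> q" "\<phi> (const2 a) = const2 a" for p q a
    using assms unfolding alg_endo_def by blast+
  have \<psi>: "\<psi> (p + q) = \<psi> p + \<psi> q" "\<psi> (p * q) = \<psi> p * \<psi> q" "\<psi> (const2 a) = const2 a" for p q a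
    using alg_endo_endo[of "\<phi> X" "\<phi> Y"] unfolding alg_endo_def \<psi>_def by blast+
  have XY: "\<psi> X = \<phi> X" "\<psi> Y = \<phi> Y"
    by (simp_all only: \<psi>_def endo_X endo_Y)
  have zero: "\<psi> 0 = \<phi> 0"
    using \<phi>(3)[of 0] \<psi>(3)[of 0] by simp
  have inner: "\<psi> [:q:] = \<phi> [:q:]" for q
  proof (induction q)
    case 0 show ?case by (simp add: zero)
  next
    case (pCons a q)
    have eq: "[:pCons a q:] = const2 a + X * [:q:]" by simp
    show ?case by (simp only: eq \<phi> \<psi> XY pCons.IH)
  qed
  have "\<psi> p = \<phi> p"
  proof (induction p)
    case 0 show ?case by (rule zero)
  next
    case (pCons q p)
    have eq: "pCons q p = [:q:] + Y * p" by simp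
    show ?case by (simp only: eq \<phi>(1,2) \<psi>(1,2) XY inner pCons.IH)
  qed
  then show "\<phi> p = endo (\<phi> X) (\<phi> Y) p" by (simp only: \<psi>_def)
qed

definition subfield :: "'f::field set \<Rightarrow> bool" where
  "subfield S \<longleftrightarrow> 0 \<in> S \<and> 1 \<in> S \<and>
     (\<forall>a\<in>S. \<forall>b\<in>S. a + b \<in> S \<and> a - b \<in> S \<and> a * b \<in> S \<and> a / b \<in> S)"

text \<open>
  \<open>K(x,y)\<close> is the whole type \<open>'k poly poly fract\<close>, and \<open>K(\<phi>(x),\<phi>(y))\<close> is the least subfield
  containing \<open>K\<close>, \<open>\<phi>(x)\<close> and \<open>\<phi>(y)\<close>.
\<close>

definition birational :: "('k::field poly poly \<Rightarrow> 'k poly poly) \<Rightarrow> bool" where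
  "birational \<phi> \<longleftrightarrow> alg_endo \<phi> \<and>
     subfield hull (range (\<lambda>a. to_fract (const2 a)) \<union> {to_fract (\<phi> X), to_fract (\<phi> Y)}) = UNIV"

definition simple_contraction :: "('k::field poly poly \<Rightarrow> 'k poly poly) \<Rightarrow> bool" where
  "simple_contraction \<phi> \<longleftrightarrow> (alg_endo \<phi> \<and> bij \<phi>) \<or> \<phi> = endo X (X * Y)"

text \<open>
  Passing from a mapping of the plane to its endomorphism reverses the order of compositions;
  this does not affect which maps are products.
\<close>

definition product_of_simple_contractions :: "('k::field poly poly \<Rightarrow> 'k poly poly) \<Rightarrow> bool" where
  "product_of_simple_contractions \<phi> \<longleftrightarrow>
     (\<exists>fs. (\<forall>f\<in>set fs. simple_contraction f) \<and> \<phi> = foldr (\<circ>) fs id)"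


section \<open>Polynomials as inputs of algorithms\<close>

text \<open>
  A polynomial is given by expressions for its coefficients: entry \<open>i\<close> of entry \<open>j\<close> of the list
  is the coefficient of \<open>x\<^sup>i y\<^sup>j\<close>.  Trailing zero coefficients are allowed.
\<close>

definition poly_of :: "(nat \<Rightarrow> 'k::field) \<Rightarrow> aexp list list \<Rightarrow> 'k poly poly" where
  "poly_of c ess = Poly (map (\<lambda>es. Poly (map (aval c) es)) ess)"

definition poly_code :: "aexp list list \<Rightarrow> nat" where
  "poly_code ess = list_encode (map (\<lambda>es. list_encode (map aexp_code es)) ess)"

end

theory Submission
  imports Defs
begin

text \<open>
  Let \<open>\<Phi>\<close> be the endomorphism of a birational mapping \<open>(u, v)\<close>.  If \<open>\<Phi>\<close> is a product of simple
  contractions but not an automorphism, then the contraction next to the target has the form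
  \<open>x \<rightarrow> x, y \<rightarrow> x y\<close> in some coordinates \<open>(p, q)\<close>: with \<open>w = p(u, v)\<close> there is \<open>h\<close> with \<open>q(u, v) = w h\<close>,
  and \<open>(w, h)\<close> is a product with one contraction less.  A decision procedure therefore has to find
  the finitely many possibilities for splitting off a contraction, up to automorphisms, and to
  repeat this.  The process ends, since the Jacobian of \<open>(u, v)\<close> is a constant times \<open>w\<close> times the
  Jacobian of \<open>(w, h)\<close>, where \<open>w\<close> is not constant (\<open>split_off_contraction\<close>).

  The line \<open>p = 0\<close>.  Write the inverse of \<open>(u, v)\<close> as \<open>(A / B, C / B)\<close>.  The preimage of the line is
  contracted to a point, so the inverse is not defined on the line, and \<open>p\<close> divides \<open>B\<close>
  (\<open>splits_dvd_denominator\<close>).  The substitution \<open>x = t\<^sup>N, y = t\<close> turns \<open>B\<close> into a polynomial in one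
  variable; over an algebraically closed field the subproducts of its linear factors yield all
  divisors of \<open>B\<close> up to constants (\<open>divisor_candidate\<close>).

  The partner \<open>q\<close>.  For a coordinate \<open>p\<close> all polynomials \<open>q\<close> with \<open>jac p q = 1\<close> are partners; they differ
  by polynomials in \<open>p\<close> only (\<open>slice_unique\<close>), and one of them has a degree bounded in terms of \<open>p\<close> (\<open>bounded_slice_exists\<close>).  The proof uses that the inverse of an automorphism
  has no larger degrees than the automorphism itself, which follows by counting the points of
  generic fibres (\<open>inverse_pair_degrees\<close>).  Once \<open>p\<close> and \<open>q\<close> are chosen, the origin on the line is fixed
  by the constant \<open>e\<close> with \<open>q(u, v) = w h + e\<close>, and the mapping \<open>(w, h)\<close> depends on the choices only up
  to an automorphism (\<open>splits_cofactor\<close>).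

  All questions left, namely whether \<open>p\<close> has a partner, whether \<open>(p, q)\<close> or \<open>(u, v)\<close> is an automorphism,
  and whether \<open>q(u, v)\<close> is of the form \<open>w h + e\<close>, ask for solutions of linear equations with unknown
  polynomials of bounded degree.  Solvability has a solution as a witness, and unsolvability has a
  linear functional (\<open>functional_certificate_complete\<close>).  Hence both answers to the decision problem have
  finite certificates: a list of contractions whose composition is \<open>(u, v)\<close>, or a list of mappings, each
  with the data showing that every way to split off a contraction leads to another mapping of the list
  (\<open>neg_ok_sound\<close>, \<open>neg_ok_complete\<close>).  The algorithm enumerates all certificates and checks them by exact
  arithmetic with polynomials.

  To see that the check is performed by a program, functions between types whose elements are
  represented by codes are shown to be computable along their syntactic structure.  The
  representations are arbitrary relations, so that the functions can be ordinary operations on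
  polynomials instead of operations on expressions for coefficients.
\<close>


section \<open>Total programs on natural numbers\<close>

text \<open>Coding of pairs and lists requires only a few total functions; their arguments form a list whose
  entries are referred to by position.\<close>

definition recn :: "nat \<Rightarrow> (nat list \<Rightarrow> nat) \<Rightarrow> bool" where
  "recn k F \<longleftrightarrow> (\<exists>P. \<forall>xs. length xs = k \<longrightarrow> computes P xs (F xs))"

lemma computes_Comp1: "computes g xs a \<Longrightarrow> computes f [a] z \<Longrightarrow> computes (Comp f [g]) xs z"
  by (rule computes.Comp[of "[a]"]) auto

lemma computes_Comp2:
  "computes g xs a \<Longrightarrow> computes g' xs b \<Longrightarrow> computes f [a, b] z \<Longrightarrow> computes (Comp f [g, g']) xs z"
  by (rule computes.Comp[of "[a, b]"]) (auto simp: less_Suc_eq nth_Cons')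

lemma computes_Comp3:
  "computes g xs a \<Longrightarrow> computes g' xs b \<Longrightarrow> computes g'' xs d \<Longrightarrow> computes f [a, b, d] z
    \<Longrightarrow> computes (Comp f [g, g', g'']) xs z"
  by (rule computes.Comp[of "[a, b, d]"]) (auto simp: less_Suc_eq nth_Cons')

lemma computes_Proj: "i < length xs \<Longrightarrow> y = xs ! i \<Longrightarrow> computes (Proj i) xs y"
  by (simp add: computes.Proj)

lemma recn_nth: "i < k \<Longrightarrow> recn k (\<lambda>xs. xs ! i)"
  unfolding recn_def by (rule exI[of _ "Proj i"]) (auto intro: computes.Proj)

lemma recn_zero: "recn k (\<lambda>xs. 0)"
  unfolding recn_def by (rule exI[of _ Zero]) (auto intro: computes.Zero)

lemma recn_comp1: "recn 1 (\<lambda>xs. g (xs ! 0)) \<Longrightarrow> recn k F \<Longrightarrow> recn k (\<lambda>xs. g (F xs))"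
  unfolding recn_def
proof (elim exE)
  fix P Q assume P: "\<forall>xs. length xs = 1 \<longrightarrow> computes P xs (g (xs ! 0))"
    and Q: "\<forall>xs. length xs = k \<longrightarrow> computes Q xs (F xs)"
  have "computes P [n] (g n)" for n using P[rule_format, of "[n]"] by simp
  then show "\<exists>P. \<forall>xs. length xs = k \<longrightarrow> computes P xs (g (F xs))"
    using Q by (intro exI[of _ "Comp P [Q]"]) (auto intro: computes_Comp1)
qed

lemma recn_comp2:
  "recn 2 (\<lambda>xs. g (xs ! 0) (xs ! 1)) \<Longrightarrow> recn k F \<Longrightarrow> recn k G \<Longrightarrow> recn k (\<lambda>xs. g (F xs) (G xs))"
  unfolding recn_def
proof (elim exE)
  fix P Q Q' assume P: "\<forall>xs. length xs = 2 \<longrightarrow> computes P xs (g (xs ! 0) (xs ! 1))"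
    and Q: "\<forall>xs. length xs = k \<longrightarrow> computes Q xs (F xs)"
    and Q': "\<forall>xs. length xs = k \<longrightarrow> computes Q' xs (G xs)"
  have "computes P [m, n] (g m n)" for m n using P[rule_format, of "[m, n]"] by simp
  then show "\<exists>P. \<forall>xs. length xs = k \<longrightarrow> computes P xs (g (F xs) (G xs))"
    using Q Q' by (intro exI[of _ "Comp P [Q, Q']"]) (auto intro: computes_Comp2)
qed

lemma recn_Suc: "recn k F \<Longrightarrow> recn k (\<lambda>xs. Suc (F xs))"
proof (rule recn_comp1[of Suc])
  show "recn 1 (\<lambda>xs. Suc (xs ! 0))"
    unfolding recn_def
  proof (rule exI[of _ Succ], intro allI impI)
    fix xs :: "nat list" assume "length xs = 1"
    then obtain n where "xs = [n]" by (auto simp: length_Suc_conv)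
    then show "computes Succ xs (Suc (xs ! 0))" by (simp add: computes.Succ)
  qed
qed

lemma recn_rec:
  assumes "recn 3 (\<lambda>xs. g (xs ! 0) (xs ! 1) (xs ! 2))"
  shows "recn 2 (\<lambda>xs. rec_nat (xs ! 1) (\<lambda>n y. g n y (xs ! 1)) (xs ! 0))"
proof -
  from assms obtain P where "\<forall>xs. length xs = 3 \<longrightarrow> computes P xs (g (xs ! 0) (xs ! 1) (xs ! 2))"
    unfolding recn_def by blast
  from this[rule_format, of "[_, _, _]"] have P: "computes P [l, m, n] (g l m n)" for l m n
    by (simp add: numeral_2_eq_2)
  have "computes (PrimRec (Proj 0) P) [n, a] (rec_nat a (\<lambda>n y. g n y a) n)" for n a
  proof (induction n)
    case 0
    show ?case by (rule computes.PrimRec_0) (simp add: computes_Proj)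
  next
    case (Suc n)
    from computes.PrimRec_Suc[OF Suc P] show ?case by simp
  qed
  then show ?thesis
    unfolding recn_def
    by (intro exI[of _ "PrimRec (Proj 0) P"]) (auto simp: length_Suc_conv numeral_2_eq_2)
qed

lemma recn_add: "recn k F \<Longrightarrow> recn k G \<Longrightarrow> recn k (\<lambda>xs. F xs + G xs)"
proof (rule recn_comp2[of "(+)"])
  have "rec_nat b (\<lambda>_. Suc) a = a + b" for a b :: nat by (induction a) auto
  moreover have "recn 3 (\<lambda>xs. Suc (xs ! 1))" by (intro recn_Suc recn_nth) simp
  from recn_rec[of "\<lambda>_ y _. Suc y", OF this]
  have "recn 2 (\<lambda>xs. rec_nat (xs ! 1) (\<lambda>_. Suc) (xs ! 0))" by simp
  ultimately show "recn 2 (\<lambda>xs. xs ! 0 + xs ! 1)" by simp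
qed

lemma recn_pred: "recn k F \<Longrightarrow> recn k (\<lambda>xs. F xs - 1)"
proof -
  assume "recn k F"
  moreover have "recn 3 (\<lambda>xs. xs ! 0)" by (intro recn_nth) simp
  ultimately have "recn k (\<lambda>xs. rec_nat 0 (\<lambda>n _. n) (F xs))"
    using recn_comp2[OF recn_rec[of "\<lambda>n _ _. n"] _ recn_zero] by simp
  moreover have "rec_nat 0 (\<lambda>n _. n) a = a - 1" for a :: nat by (cases a) auto
  ultimately show ?thesis by simp
qed

lemma recn_diff: "recn k F \<Longrightarrow> recn k G \<Longrightarrow> recn k (\<lambda>xs. F xs - G xs)"
proof -
  assume F: "recn k F" and G: "recn k G"
  have "rec_nat b (\<lambda>_ y. y - 1) a = b - a" for a b :: nat by (induction a) auto
  moreover have "recn 3 (\<lambda>xs. xs ! 1 - 1)" by (intro recn_pred recn_nth) simp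
  from recn_rec[of "\<lambda>_ y _. y - 1", OF this]
  have "recn 2 (\<lambda>xs. rec_nat (xs ! 1) (\<lambda>_ y. y - 1) (xs ! 0))" by simp
  ultimately have "recn 2 (\<lambda>xs. xs ! 1 - xs ! 0)" by simp
  from recn_comp2[of "\<lambda>a b. b - a", OF this G F] show ?thesis .
qed

lemma recn_triangle: "recn k F \<Longrightarrow> recn k (\<lambda>xs. triangle (F xs))"
proof -
  assume "recn k F"
  moreover have "recn 3 (\<lambda>xs. xs ! 1 + Suc (xs ! 0))" by (intro recn_add recn_Suc recn_nth) simp_all
  ultimately have "recn k (\<lambda>xs. rec_nat 0 (\<lambda>n y. y + Suc n) (F xs))"
    using recn_comp2[OF recn_rec[of "\<lambda>n y _. y + Suc n"] _ recn_zero] by simp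
  moreover have "rec_nat 0 (\<lambda>n y. y + Suc n) a = triangle a" for a by (induction a) auto
  ultimately show ?thesis by simp
qed

lemma recn_prod_encode: "recn k F \<Longrightarrow> recn k G \<Longrightarrow> recn k (\<lambda>xs. prod_encode (F xs, G xs))"
  unfolding prod_encode_def prod.case by (intro recn_add recn_triangle)

text \<open>Unbounded search is total if every argument has a zero.\<close>

lemma recn_least:
  assumes "recn 2 (\<lambda>xs. g (xs ! 0) (xs ! 1))" and ex: "\<And>a. \<exists>n. g n a = 0"
  shows "recn 1 (\<lambda>xs. LEAST n. g n (xs ! 0) = 0)"
proof -
  from assms(1) obtain P where "\<forall>xs. length xs = 2 \<longrightarrow> computes P xs (g (xs ! 0) (xs ! 1))"
    unfolding recn_def by blast
  from this[rule_format, of "[_, _]"] have P: "computes P [m, n] (g m n)" for m n by simp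
  have "computes (Mu P) [a] (LEAST n. g n a = 0)" for a
  proof (rule computes.Mu)
    have "g (LEAST n. g n a = 0) a = 0" using ex by (rule LeastI_ex)
    with P show "computes P [LEAST n. g n a = 0, a] 0" by metis
    show "\<forall>m<LEAST n. g n a = 0. \<exists>y>0. computes P [m, a] y"
      using P not_less_Least by blast
  qed
  then show ?thesis
    unfolding recn_def by (intro exI[of _ "Mu P"]) (auto simp: length_Suc_conv)
qed

text \<open>The pair coded by \<open>n\<close> lies on the diagonal whose number is the least \<open>s\<close> with
  \<open>n < triangle (Suc s)\<close>; subtraction from \<open>triangle s\<close> recovers the components.\<close>

lemma prod_decode_diagonal:
  defines "s \<equiv> \<lambda>n. LEAST s. Suc n - triangle (Suc s) = 0"
  shows "prod_decode n = (n - triangle (s n), s n - (n - triangle (s n)))"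
proof -
  obtain a b where ab: "prod_decode n = (a, b)" by (cases "prod_decode n")
  have "n = prod_encode (prod_decode n)" by simp
  also have "\<dots> = triangle (a + b) + a" by (simp only: ab prod_encode_def prod.case)
  finally have n: "n = triangle (a + b) + a" .
  have mono: "triangle i \<le> triangle j" if "i \<le> j" for i j
    using that by (induction rule: dec_induct) auto
  have "s n = a + b"
    unfolding s_def
  proof (rule Least_equality)
    show "Suc n - triangle (Suc (a + b)) = 0" by (simp add: n)
    show "a + b \<le> t" if "Suc n - triangle (Suc t) = 0" for t
    proof (rule ccontr)
      assume "\<not> a + b \<le> t"
      then have "triangle (Suc t) \<le> triangle (a + b)" by (intro mono) simp
      with that n show False by simp
    qed
  qed
  moreover have "n - triangle (a + b) = a" by (simp add: n)
  ultimately show ?thesis by (simp only: ab) simp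
qed

lemma recn_diagonal: "recn k F \<Longrightarrow> recn k (\<lambda>xs. LEAST s. Suc (F xs) - triangle (Suc s) = 0)"
proof (rule recn_comp1[of "\<lambda>n. LEAST s. Suc n - triangle (Suc s) = 0"])
  show "recn 1 (\<lambda>xs. LEAST s. Suc (xs ! 0) - triangle (Suc s) = 0)"
  proof (rule recn_least[of "\<lambda>s n. Suc n - triangle (Suc s)"])
    show "recn 2 (\<lambda>xs. Suc (xs ! 1) - triangle (Suc (xs ! 0)))"
      by (intro recn_diff recn_Suc recn_triangle recn_nth) simp_all
    show "\<exists>s. Suc n - triangle (Suc s) = 0" for n by (rule exI[of _ n]) simp
  qed
qed

lemma recn_fst_decode: "recn k F \<Longrightarrow> recn k (\<lambda>xs. fst (prod_decode (F xs)))"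
  and recn_snd_decode: "recn k F \<Longrightarrow> recn k (\<lambda>xs. snd (prod_decode (F xs)))"
  unfolding prod_decode_diagonal fst_conv snd_conv
  by (intro recn_diff recn_triangle recn_diagonal; assumption)+

lemma ex_pair_program: "\<exists>P. \<forall>a b. computes P [a, b] (prod_encode (a, b))"
proof -
  have "recn 2 (\<lambda>xs. prod_encode (xs ! 0, xs ! 1))"
    by (intro recn_prod_encode recn_nth) simp_all
  then obtain P where "\<forall>xs. length xs = 2 \<longrightarrow> computes P xs (prod_encode (xs ! 0, xs ! 1))"
    unfolding recn_def by blast
  from this[rule_format, of "[_, _]"] show ?thesis by auto
qed

lemma ex_program1: "recn 1 (\<lambda>xs. f (xs ! 0)) \<Longrightarrow> \<exists>P. \<forall>a. computes P [a] (f a)"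
proof -
  assume "recn 1 (\<lambda>xs. f (xs ! 0))"
  then obtain P where "\<forall>xs. length xs = 1 \<longrightarrow> computes P xs (f (xs ! 0))"
    unfolding recn_def by blast
  from this[rule_format, of "[_]"] show ?thesis by auto
qed


section \<open>Computable functions between represented types\<close>

text \<open>
  A representation relates codes to the objects that they denote; an object may have many codes
  and a number need not be a code.  A function is computable if some program sends each code of
  an argument to a code of the value.  The program may diverge on numbers that are not codes.
\<close>

type_synonym 'a repr = "nat \<Rightarrow> 'a \<Rightarrow> bool"

definition computable :: "'a repr \<Rightarrow> 'b repr \<Rightarrow> ('a \<Rightarrow> 'b) \<Rightarrow> bool" where
  "computable R S f \<longleftrightarrow> (\<exists>P. \<forall>n x. R n x \<longrightarrow> (\<exists>m. computes P [n] m \<and> S m (f x)))"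

abbreviation (input) natR :: "nat repr" where "natR \<equiv> (=)"

definition boolR :: "bool repr" where "boolR n b \<longleftrightarrow> n = of_bool b"

definition prodR :: "'a repr \<Rightarrow> 'b repr \<Rightarrow> ('a \<times> 'b) repr" where
  "prodR R S n z \<longleftrightarrow> R (fst (prod_decode n)) (fst z) \<and> S (snd (prod_decode n)) (snd z)"

definition listR :: "'a repr \<Rightarrow> 'a list repr" where
  "listR R n xs \<longleftrightarrow> list_all2 R (list_decode n) xs"

lemma prodR_encode [simp]: "prodR R S (prod_encode (m, n)) z \<longleftrightarrow> R m (fst z) \<and> S n (snd z)"
  by (simp add: prodR_def)

lemma computableE:
  assumes "computable R S f"
  obtains P where "\<And>n x. R n x \<Longrightarrow> \<exists>m. computes P [n] m \<and> S m (f x)"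
  using assms unfolding computable_def by blast

lemma computable_id: "computable R R (\<lambda>x. x)"
  unfolding computable_def by (rule exI[of _ "Proj 0"]) (auto intro: computes_Proj)

lemma computable_comp:
  assumes "computable S T g" "computable R S f"
  shows "computable R T (\<lambda>x. g (f x))"
proof -
  from assms(1) obtain P where P: "\<And>n x. S n x \<Longrightarrow> \<exists>m. computes P [n] m \<and> T m (g x)"
    by (rule computableE) blast
  from assms(2) obtain Q where Q: "\<And>n x. R n x \<Longrightarrow> \<exists>m. computes Q [n] m \<and> S m (f x)"
    by (rule computableE) blast
  from P Q show ?thesis
    unfolding computable_def by (intro exI[of _ "Comp P [Q]"]) (meson computes_Comp1)
qed

lemma computable_Pair:
  assumes "computable R S f" "computable R T g"
  shows "computable R (prodR S T) (\<lambda>x. (f x, g x))"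
proof -
  from assms(1) obtain P where P: "\<And>n x. R n x \<Longrightarrow> \<exists>m. computes P [n] m \<and> S m (f x)"
    by (rule computableE) blast
  from assms(2) obtain Q where Q: "\<And>n x. R n x \<Longrightarrow> \<exists>m. computes Q [n] m \<and> T m (g x)"
    by (rule computableE) blast
  obtain E where E: "\<And>a b. computes E [a, b] (prod_encode (a, b))" using ex_pair_program by blast
  have "\<exists>m. computes (Comp E [P, Q]) [n] m \<and> prodR S T m (f x, g x)" if nx: "R n x" for n x
  proof -
    obtain a b where "computes P [n] a" "S a (f x)" "computes Q [n] b" "T b (g x)"
      using P[OF nx] Q[OF nx] by blast
    then show ?thesis
      by (intro exI[of _ "prod_encode (a, b)"] conjI computes_Comp2[OF _ _ E]) simp_all
  qed
  then show ?thesis unfolding computable_def by blast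
qed

lemma computable_recn:
  assumes "recn 1 (\<lambda>xs. g (xs ! 0))" "\<And>n x. R n x \<Longrightarrow> S (g n) (f x)"
  shows "computable R S f"
  using ex_program1[OF assms(1)] assms(2) unfolding computable_def by blast

lemma computable_fst:
  assumes "computable R (prodR S T) f" shows "computable R S (\<lambda>x. fst (f x))"
  by (rule computable_comp[OF _ assms], rule computable_recn, rule recn_fst_decode, rule recn_nth)
    (simp_all add: prodR_def)

lemma computable_snd:
  assumes "computable R (prodR S T) f" shows "computable R T (\<lambda>x. snd (f x))"
  by (rule computable_comp[OF _ assms], rule computable_recn, rule recn_snd_decode, rule recn_nth)
    (simp_all add: prodR_def)

text \<open>Programs have one argument, so a function of several arguments is known through its uncurried form,
  and application to computed arguments becomes composition.\<close>

lemma computable_comp2: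
  assumes "computable (prodR S T) U (\<lambda>z. h (fst z) (snd z))" "computable R S f" "computable R T g"
  shows "computable R U (\<lambda>x. h (f x) (g x))"
  using computable_comp[OF assms(1) computable_Pair[OF assms(2,3)]] by simp

lemma computable_comp3:
  assumes "computable (prodR S (prodR T U)) V (\<lambda>z. h (fst z) (fst (snd z)) (snd (snd z)))"
    "computable R S f" "computable R T g" "computable R U k"
  shows "computable R V (\<lambda>x. h (f x) (g x) (k x))"
  using computable_comp[OF assms(1) computable_Pair[OF assms(2) computable_Pair[OF assms(3,4)]]] by simp

lemma computable_const:
  assumes "S k a" shows "computable R S (\<lambda>x. a)"
proof -
  have "recn 1 (\<lambda>xs. k)" by (induction k) (rule recn_zero recn_Suc | assumption)+
  then show ?thesis by (rule computable_recn) (rule assms)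
qed

lemma computable_nat: "computable R natR (\<lambda>x. k)"
  by (rule computable_const) simp

lemma computable_Suc:
  assumes "computable R natR f" shows "computable R natR (\<lambda>x. Suc (f x))"
  by (rule computable_comp[OF _ assms], rule computable_recn, rule recn_Suc, rule recn_nth) simp_all

lemma computable_add_nat:
  assumes "computable R natR f" "computable R natR g"
  shows "computable R natR (\<lambda>x. f x + g x)"
  by (rule computable_comp2[OF _ assms], rule computable_recn,
      rule recn_add, rule recn_fst_decode, rule recn_nth, simp,
      rule recn_snd_decode, rule recn_nth) (simp_all add: prodR_def)

lemma computable_diff_nat:
  assumes "computable R natR f" "computable R natR g"
  shows "computable R natR (\<lambda>x. f x - g x)"
  by (rule computable_comp2[OF _ assms], rule computable_recn,
      rule recn_diff, rule recn_fst_decode, rule recn_nth, simp,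
      rule recn_snd_decode, rule recn_nth) (simp_all add: prodR_def)

text \<open>Conditionals have to be lazy, because a branch may diverge where it is not selected.
  Primitive recursion on the condition, a number at most one, runs the second program only on demand;
  the first one runs always, hence the constant there.\<close>

lemma lazy_if:
  assumes P: "\<And>n x. R n x \<Longrightarrow> b x \<Longrightarrow> \<exists>m. computes P [n] m \<and> S m (f x)"
    and c: "computable R boolR b"
    and Q: "\<And>n x. R n x \<Longrightarrow> \<not> b x \<Longrightarrow> \<exists>m. computes Q [n] m \<and> S m (g x)"
  shows "computable R S (\<lambda>x. if b x then f x else g x)"
proof -
  from c obtain C where C: "\<And>n x. R n x \<Longrightarrow> computes C [n] (of_bool (b x))"
    unfolding boolR_def by (elim computableE) blast
  \<comment> \<open>\<open>W\<close> runs \<open>P\<close> if its first argument is 1; \<open>V\<close> passes on that result or, if its first argument is 1,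
    runs \<open>Q\<close>.\<close>
  define W where "W = PrimRec Zero (Comp P [Proj 2])"
  define C' where "C' = Comp (PrimRec (Comp Succ [Zero]) Zero) [C]"
  define V where "V = PrimRec (Proj 0) (Comp Q [Proj 3])"
  have C': "computes C' [n] (of_bool (\<not> b x))" if "R n x" for n x
  proof (cases "b x")
    case True
    have "computes (PrimRec (Comp Succ [Zero]) Zero) [Suc 0] 0"
      by (rule computes.PrimRec_Suc computes.PrimRec_0 computes_Comp1 computes.Zero computes.Succ)+
    with True C[OF that] show ?thesis unfolding C'_def by (auto intro: computes_Comp1)
  next
    case False
    have "computes (PrimRec (Comp Succ [Zero]) Zero) [0] (Suc 0)"
      by (rule computes.PrimRec_0 computes_Comp1 computes.Zero computes.Succ)+
    with False C[OF that] show ?thesis unfolding C'_def by (auto intro: computes_Comp1)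
  qed
  have W0: "computes W [0, n] 0" for n
    unfolding W_def by (rule computes.PrimRec_0 computes.Zero)+
  have W1: "computes W [Suc 0, n] m" if "computes P [n] m" for n m
    unfolding W_def using that
    by (intro computes.PrimRec_Suc[of _ _ _ _ 0] computes.PrimRec_0 computes.Zero)
      (auto intro!: computes_Comp1 computes_Proj)
  have V0: "computes V [0, m, n] m" for m n
    unfolding V_def by (rule computes.PrimRec_0) (simp add: computes_Proj)
  have V1: "computes V [Suc 0, m, n] r" if "computes Q [n] r" for m n r
    unfolding V_def
  proof (rule computes.PrimRec_Suc)
    show "computes (PrimRec (Proj 0) (Comp Q [Proj 3])) (0 # [m, n]) m"
      by (rule computes.PrimRec_0) (simp add: computes_Proj)
    show "computes (Comp Q [Proj 3]) (0 # m # [m, n]) r" using that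
      by (rule computes_Comp1[rotated]) (simp add: computes_Proj)
  qed
  let ?T = "Comp V [C', Comp W [C, Proj 0], Proj 0]"
  have "\<exists>m. computes ?T [n] m \<and> S m (if b x then f x else g x)" if nx: "R n x" for n x
  proof (cases "b x")
    case True
    then obtain m where m: "computes P [n] m" "S m (f x)" using P[OF nx] by blast
    have "computes ?T [n] m"
      using C[OF nx] C'[OF nx] True m(1)
      by (intro computes_Comp3[of _ _ 0 _ m _ n] computes_Comp2[of _ _ 1 _ n] V0)
        (auto intro: W1 computes_Proj)
    with True m show ?thesis by auto
  next
    case False
    then obtain m where m: "computes Q [n] m" "S m (g x)" using Q[OF nx] by blast
    have "computes ?T [n] m"
      using C[OF nx] C'[OF nx] False m(1)
      by (intro computes_Comp3[of _ _ 1 _ 0 _ n] computes_Comp2[of _ _ 0 _ n])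
        (auto intro: W0 V1 computes_Proj)
    with False m show ?thesis by auto
  qed
  then show ?thesis unfolding computable_def by blast
qed

lemma computable_if:
  assumes "computable R boolR b" "computable R S f" "computable R S g"
  shows "computable R S (\<lambda>x. if b x then f x else g x)"
proof -
  from assms(2) obtain P where P: "\<And>n x. R n x \<Longrightarrow> \<exists>m. computes P [n] m \<and> S m (f x)"
    by (rule computableE) blast
  from assms(3) obtain Q where Q: "\<And>n x. R n x \<Longrightarrow> \<exists>m. computes Q [n] m \<and> S m (g x)"
    by (rule computableE) blast
  from P assms(1) Q show ?thesis by (intro lazy_if[where P = P and Q = Q]) blast+
qed

lemma computable_True: "computable R boolR (\<lambda>x. True)"
  and computable_False: "computable R boolR (\<lambda>x. False)"
  by (rule computable_const, simp add: boolR_def)+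

lemma computable_conj:
  assumes "computable R boolR f" "computable R boolR g"
  shows "computable R boolR (\<lambda>x. f x \<and> g x)"
proof -
  have "(\<lambda>x. f x \<and> g x) = (\<lambda>x. if f x then g x else False)" by auto
  with computable_if[OF assms computable_False] show ?thesis by simp
qed

lemma computable_disj:
  assumes "computable R boolR f" "computable R boolR g"
  shows "computable R boolR (\<lambda>x. f x \<or> g x)"
proof -
  have "(\<lambda>x. f x \<or> g x) = (\<lambda>x. if f x then True else g x)" by auto
  with computable_if[OF assms(1) computable_True assms(2)] show ?thesis by simp
qed

lemma computable_not:
  assumes "computable R boolR f"
  shows "computable R boolR (\<lambda>x. \<not> f x)"
proof -
  have "(\<lambda>x. \<not> f x) = (\<lambda>x. if f x then False else True)" by auto
  with computable_if[OF assms computable_False computable_True] show ?thesis by simp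
qed

lemma computable_eq0:
  assumes "computable R natR f" shows "computable R boolR (\<lambda>x. f x = 0)"
proof -
  have "recn 1 (\<lambda>xs. 1 - xs ! 0)"
    by (simp add: recn_diff recn_nth recn_Suc recn_zero)
  then have "computable natR boolR (\<lambda>n. n = 0)"
    by (rule computable_recn) (auto simp: boolR_def)
  from computable_comp[OF this assms] show ?thesis .
qed

lemma computable_le:
  assumes "computable R natR f" "computable R natR g"
  shows "computable R boolR (\<lambda>x. f x \<le> g x)"
  using computable_eq0[OF computable_diff_nat[OF assms]] by simp

lemma computable_less:
  assumes "computable R natR f" "computable R natR g"
  shows "computable R boolR (\<lambda>x. f x < g x)"
  using computable_le[OF computable_Suc[OF assms(1)] assms(2)] by (simp add: Suc_le_eq)

lemma computable_eq_nat:
  assumes "computable R natR f" "computable R natR g"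
  shows "computable R boolR (\<lambda>x. f x = g x)"
  using computable_conj[OF computable_le[OF assms] computable_le[OF assms(2,1)]] by (simp add: eq_iff)

text \<open>The number of iterations may depend on the code of the argument, as long as the result does not.\<close>

lemma computable_funpow_code:
  assumes g: "computable (prodR R S) S (\<lambda>z. g (fst z) (snd z))" and a: "computable R S a"
    and K: "\<And>n x. R n x \<Longrightarrow> \<exists>k. computes K [n] k \<and> (g x ^^ k) (a x) = r x"
  shows "computable R S r"
proof -
  from g obtain G where G0: "\<And>n z. prodR R S n z \<Longrightarrow> \<exists>m. computes G [n] m \<and> S m (g (fst z) (snd z))"
    by (rule computableE) blast
  from a obtain A where A: "\<And>n x. R n x \<Longrightarrow> \<exists>m. computes A [n] m \<and> S m (a x)"
    by (rule computableE) blast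
  have G: "\<exists>m. computes G [prod_encode (n, s)] m \<and> S m (g x y)" if "R n x" "S s y" for n s x y
    using G0[of "prod_encode (n, s)" "(x, y)"] that by simp
  obtain E where E: "\<And>a b. computes E [a, b] (prod_encode (a, b))" using ex_pair_program by blast
  define T where "T = PrimRec A (Comp G [Comp E [Proj 2, Proj 1]])"
  have T: "\<exists>m. computes T [i, n] m \<and> S m ((g x ^^ i) (a x))" if nx: "R n x" for i n x
  proof (induction i)
    case 0
    then show ?case using A[OF nx] unfolding T_def by (auto intro: computes.PrimRec_0)
  next
    case (Suc i)
    then obtain s where s: "computes T [i, n] s" "S s ((g x ^^ i) (a x))" by blast
    obtain m where m: "computes G [prod_encode (n, s)] m" "S m (g x ((g x ^^ i) (a x)))"
      using G[OF nx s(2)] by blast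
    have "computes T [Suc i, n] m"
      unfolding T_def
    proof (rule computes.PrimRec_Suc)
      show "computes (PrimRec A (Comp G [Comp E [Proj 2, Proj 1]])) (i # [n]) s"
        using s(1) by (simp add: T_def)
      show "computes (Comp G [Comp E [Proj 2, Proj 1]]) (i # s # [n]) m"
        by (rule computes_Comp1[OF _ m(1)], rule computes_Comp2[OF _ _ E])
          (simp_all add: computes_Proj)
    qed
    with m show ?case by auto
  qed
  have "\<exists>m. computes (Comp T [K, Proj 0]) [n] m \<and> S m (r x)" if nx: "R n x" for n x
  proof -
    obtain k where k: "computes K [n] k" "(g x ^^ k) (a x) = r x" using K[OF nx] by blast
    obtain m where m: "computes T [k, n] m" "S m (r x)" using T[OF nx, of k] k(2) by auto
    have "computes (Comp T [K, Proj 0]) [n] m"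
      by (rule computes_Comp2[OF k(1) _ m(1)]) (simp add: computes_Proj)
    with m show ?thesis by blast
  qed
  then show ?thesis unfolding computable_def by blast
qed

lemma computable_funpow:
  assumes g: "computable (prodR R S) S (\<lambda>z. g (fst z) (snd z))"
    and k: "computable R natR k" and a: "computable R S a"
  shows "computable R S (\<lambda>x. (g x ^^ k x) (a x))"
proof -
  from k obtain K where K: "\<And>n x. R n x \<Longrightarrow> computes K [n] (k x)"
    by (rule computableE) blast
  show ?thesis by (rule computable_funpow_code[OF g a, of K]) (use K in blast)
qed

lemma computable_mult_nat:
  assumes "computable R natR f" "computable R natR g"
  shows "computable R natR (\<lambda>x. f x * g x)"
proof (rule computable_comp2[OF _ assms])
  have "((+) n ^^ m) 0 = m * n" for m n :: nat by (induction m) auto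
  moreover have "computable (prodR natR natR) natR (\<lambda>z. ((+) (snd z) ^^ fst z) 0)"
    by (rule computable_funpow)
      (rule computable_add_nat computable_snd computable_fst computable_id computable_nat)+
  ultimately show "computable (prodR natR natR) natR (\<lambda>z. fst z * snd z)" by simp
qed


subsection \<open>Lists\<close>

lemma listR_0 [simp]: "listR R 0 xs \<longleftrightarrow> xs = []"
  by (simp add: listR_def)

lemma listR_Suc: "listR R (Suc n) xs \<longleftrightarrow> (\<exists>y ys. xs = y # ys \<and> prodR R (listR R) n (y, ys))"
  by (auto simp: listR_def prodR_def list_all2_Cons1 split: prod.split)

lemma computable_Nil: "computable R (listR S) (\<lambda>x. [])"
  by (rule computable_const[of _ 0]) simp

lemma computable_Cons:
  assumes "computable R S f" "computable R (listR S) g"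
  shows "computable R (listR S) (\<lambda>x. f x # g x)"
proof (rule computable_comp2[OF _ assms])
  show "computable (prodR S (listR S)) (listR S) (\<lambda>z. fst z # snd z)"
    by (rule computable_recn, rule recn_Suc, rule recn_nth) (simp_all add: listR_Suc)
qed

lemma computable_null:
  assumes "computable R (listR S) l" shows "computable R boolR (\<lambda>x. l x = [])"
proof (rule computable_comp[OF _ assms])
  have "recn 1 (\<lambda>xs. 1 - xs ! 0)"
    by (simp add: recn_diff recn_nth recn_Suc recn_zero)
  then show "computable (listR S) boolR (\<lambda>l. l = [])"
  proof (rule computable_recn)
    show "boolR (1 - n) (xs = [])" if "listR S n xs" for n xs
      using that by (cases n) (auto simp: boolR_def listR_Suc)
  qed
qed

text \<open>The second branch refers to head and tail, which the code of the empty list does not provide; hence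
  the use of the lazy conditional.\<close>

lemma computable_case_list:
  assumes l: "computable R (listR S) l" and f: "computable R T f"
    and g: "computable (prodR R (prodR S (listR S))) T (\<lambda>z. g (fst z) (fst (snd z)) (snd (snd z)))"
  shows "computable R T (\<lambda>x. case l x of [] \<Rightarrow> f x | a # r \<Rightarrow> g x a r)"
proof -
  from f obtain P where P: "\<And>n x. R n x \<Longrightarrow> \<exists>m. computes P [n] m \<and> T m (f x)"
    by (rule computableE) blast
  from l obtain L where L: "\<And>n x. R n x \<Longrightarrow> \<exists>m. computes L [n] m \<and> listR S m (l x)"
    by (rule computableE) blast
  from g obtain G where G0: "\<And>n z. prodR R (prodR S (listR S)) n z \<Longrightarrow>
      \<exists>m. computes G [n] m \<and> T m (g (fst z) (fst (snd z)) (snd (snd z)))"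
    by (rule computableE) blast
  have G: "\<exists>r. computes G [prod_encode (n, m)] r \<and> T r (g x a as)"
    if "R n x" "prodR S (listR S) m (a, as)" for n m x a as
    using G0[of "prod_encode (n, m)" "(x, a, as)"] that by simp
  obtain E where E: "\<And>a b. computes E [a, b] (prod_encode (a, b))" using ex_pair_program by blast
  obtain D where D: "\<And>n. computes D [n] (n - 1)"
    using ex_program1[OF recn_pred[OF recn_nth]] by force
  let ?Q = "Comp G [Comp E [Proj 0, Comp D [L]]]"
  have Q: "\<exists>m. computes ?Q [n] m \<and> T m (g x (hd (l x)) (tl (l x)))"
    if nx: "R n x" and ne: "l x \<noteq> []" for n x
  proof -
    obtain k where k: "computes L [n] k" "listR S k (l x)" using L[OF nx] by blast
    with ne obtain k' where k': "k = Suc k'" by (cases k) auto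
    with k ne have "prodR S (listR S) k' (hd (l x), tl (l x))" by (auto simp: listR_Suc)
    from G[OF nx this] obtain m where
      m: "computes G [prod_encode (n, k')] m" "T m (g x (hd (l x)) (tl (l x)))" by blast
    have "computes D [k] k'" using D[of k] k' by simp
    then have "computes ?Q [n] m"
      by (intro computes_Comp1[OF _ m(1)] computes_Comp2[OF _ _ E] computes_Comp1[OF k(1)])
        (simp_all add: computes_Proj)
    with m show ?thesis by blast
  qed
  have "computable R T (\<lambda>x. if l x = [] then f x else g x (hd (l x)) (tl (l x)))"
    using P Q by (intro lazy_if[where P = P and Q = ?Q] computable_null[OF l]) blast+
  also have "(\<lambda>x. if l x = [] then f x else g x (hd (l x)) (tl (l x))) =
      (\<lambda>x. case l x of [] \<Rightarrow> f x | a # r \<Rightarrow> g x a r)"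
    by (auto split: list.split)
  finally show ?thesis .
qed

text \<open>Folding consumes one entry per step; a code bounds the length of the list, so that many steps
  suffice.\<close>

lemma listR_length: "listR R n xs \<Longrightarrow> length xs \<le> n"
proof (induction xs arbitrary: n)
  case (Cons a xs)
  then obtain k where k: "n = Suc k" "prodR R (listR R) k (a, xs)" by (cases n) (auto simp: listR_Suc)
  then have "length xs \<le> snd (prod_decode k)" using Cons.IH by (simp add: prodR_def)
  also have "snd (prod_decode k) \<le> k"
    by (metis le_prod_encode_2 prod.collapse prod_decode_inverse)
  finally show ?case using k by simp
qed simp

lemma computable_foldl:
  assumes g: "computable (prodR R (prodR T S)) T (\<lambda>z. g (fst z) (fst (snd z)) (snd (snd z)))"
    and a: "computable R T a" and l: "computable R (listR S) l"
  shows "computable R T (\<lambda>x. foldl (g x) (a x) (l x))"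
proof -
  define step where "step x s = (case fst s of [] \<Rightarrow> s | b # r \<Rightarrow> (r, g x (snd s) b))" for x s
  have iter: "(step x ^^ k) (ys, t) = ([], foldl (g x) t ys)" if "length ys \<le> k" for x k ys t
    using that
  proof (induction k arbitrary: ys t)
    case (Suc k)
    have nil: "(step x ^^ k) ([], t) = ([], t)" for k t
      by (induction k) (auto simp: step_def)
    show ?case
    proof (cases ys)
      case Nil then show ?thesis using nil[of "Suc k"] by simp
    next
      case (Cons b r)
      then have "(step x ^^ Suc k) (ys, t) = (step x ^^ k) (r, g x t b)"
        by (simp add: funpow_swap1 step_def del: funpow.simps) (simp add: funpow_Suc_right step_def del: funpow.simps)
      then show ?thesis using Suc Cons by simp
    qed
  qed simp
  have step: "computable (prodR R (prodR (listR S) T)) (prodR (listR S) T) (\<lambda>z. step (fst z) (snd z))"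
    unfolding step_def
  proof (rule computable_case_list)
    show "computable (prodR R (prodR (listR S) T)) (listR S) (\<lambda>x. fst (snd x))"
      by (rule computable_fst computable_snd computable_id)+
    show "computable (prodR R (prodR (listR S) T)) (prodR (listR S) T) snd"
      by (rule computable_snd computable_id)+
    let ?R = "prodR (prodR R (prodR (listR S) T)) (prodR S (listR S))"
    have "computable ?R T (\<lambda>z. g (fst (fst z)) (snd (snd (fst z))) (fst (snd z)))"
      by (rule computable_comp3[OF g]) (rule computable_fst computable_snd computable_id)+
    then show "computable ?R (prodR (listR S) T)
        (\<lambda>z. (snd (snd z), g (fst (fst z)) (snd (snd (fst z))) (fst (snd z))))"
      by (intro computable_Pair) (rule computable_snd computable_id)+
  qed
  from l obtain L where L: "\<And>n x. R n x \<Longrightarrow> \<exists>m. computes L [n] m \<and> listR S m (l x)"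
    by (rule computableE) blast
  have "computable R (prodR (listR S) T) (\<lambda>x. ([], foldl (g x) (a x) (l x)))"
  proof (rule computable_funpow_code[OF step computable_Pair[OF l a]])
    show "\<exists>k. computes L [n] k \<and> (step x ^^ k) (l x, a x) = ([], foldl (g x) (a x) (l x))"
      if "R n x" for n x
      using L[OF that] iter listR_length by metis
  qed
  from computable_snd[OF this] show ?thesis by simp
qed

lemma computable_rev:
  assumes "computable R (listR S) l" shows "computable R (listR S) (\<lambda>x. rev (l x))"
proof -
  have "computable R (listR S) (\<lambda>x. foldl (\<lambda>r a. a # r) [] (l x))"
    by (rule computable_foldl[OF _ computable_Nil assms])
      (rule computable_Cons computable_fst computable_snd computable_id)+
  moreover have "foldl (\<lambda>r a. a # r) ys xs = rev xs @ ys" for xs ys :: "'b list"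
    by (induction xs arbitrary: ys) auto
  ultimately show ?thesis by simp
qed

lemma computable_foldr:
  assumes g: "computable (prodR R (prodR S T)) T (\<lambda>z. g (fst z) (fst (snd z)) (snd (snd z)))"
    and a: "computable R T a" and l: "computable R (listR S) l"
  shows "computable R T (\<lambda>x. foldr (g x) (l x) (a x))"
  unfolding foldr_conv_foldl
proof (rule computable_foldl[OF _ a computable_rev[OF l]])
  show "computable (prodR R (prodR T S)) T (\<lambda>z. g (fst z) (snd (snd z)) (fst (snd z)))"
    by (rule computable_comp3[OF g]) (rule computable_fst computable_snd computable_id)+
qed

lemma computable_length:
  assumes "computable R (listR S) l" shows "computable R natR (\<lambda>x. length (l x))"
proof -
  have "computable R natR (\<lambda>x. foldl (\<lambda>r a. Suc r) 0 (l x))"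
    by (rule computable_foldl[OF _ computable_nat assms])
      (rule computable_Suc computable_fst computable_snd computable_id)+
  moreover have "foldl (\<lambda>r a. Suc r) k xs = length xs + k" for xs :: "'b list" and k
    by (induction xs arbitrary: k) auto
  ultimately show ?thesis by simp
qed

lemma computable_map:
  assumes g: "computable (prodR R S) T (\<lambda>z. g (fst z) (snd z))" and l: "computable R (listR S) l"
  shows "computable R (listR T) (\<lambda>x. map (g x) (l x))"
proof -
  have "computable R (listR T) (\<lambda>x. foldr (\<lambda>a r. g x a # r) (l x) [])"
  proof (rule computable_foldr[OF _ computable_Nil l])
    show "computable (prodR R (prodR S (listR T))) (listR T) (\<lambda>z. g (fst z) (fst (snd z)) # snd (snd z))"
      by (rule computable_Cons computable_comp2[OF g] computable_fst computable_snd computable_id)+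
  qed
  moreover have "foldr (\<lambda>a r. h a # r) xs [] = map h xs" for h :: "'b \<Rightarrow> 'c" and xs
    by (induction xs) auto
  ultimately show ?thesis by simp
qed

lemma computable_append:
  assumes "computable R (listR S) l" "computable R (listR S) l'"
  shows "computable R (listR S) (\<lambda>x. l x @ l' x)"
proof -
  have "computable R (listR S) (\<lambda>x. foldr (#) (l x) (l' x))"
    by (rule computable_foldr[OF _ assms(2,1)])
      (rule computable_Cons computable_fst computable_snd computable_id)+
  moreover have "foldr (#) xs ys = xs @ ys" for xs ys :: "'b list" by (induction xs) auto
  ultimately show ?thesis by simp
qed

lemma computable_list_all:
  assumes g: "computable (prodR R S) boolR (\<lambda>z. g (fst z) (snd z))" and l: "computable R (listR S) l"
  shows "computable R boolR (\<lambda>x. \<forall>a\<in>set (l x). g x a)"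
proof -
  have "computable R boolR (\<lambda>x. foldr (\<lambda>a r. g x a \<and> r) (l x) True)"
  proof (rule computable_foldr[OF _ computable_True l])
    show "computable (prodR R (prodR S boolR)) boolR (\<lambda>z. g (fst z) (fst (snd z)) \<and> snd (snd z))"
      by (rule computable_conj computable_comp2[OF g] computable_fst computable_snd computable_id)+
  qed
  moreover have "foldr (\<lambda>a r. h a \<and> r) xs True = (\<forall>a\<in>set xs. h a)" for h :: "'b \<Rightarrow> bool" and xs
    by (induction xs) auto
  ultimately show ?thesis by simp
qed

lemma computable_list_ex:
  assumes g: "computable (prodR R S) boolR (\<lambda>z. g (fst z) (snd z))" and l: "computable R (listR S) l"
  shows "computable R boolR (\<lambda>x. \<exists>a\<in>set (l x). g x a)"
  using computable_not[OF computable_list_all[OF computable_not[OF g] l]] by simp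

lemma computable_upt:
  assumes "computable R natR f" shows "computable R (listR natR) (\<lambda>x. [0..<f x])"
proof -
  have "computable R (prodR natR (listR natR)) (\<lambda>x. ((\<lambda>s. (Suc (fst s), fst s # snd s)) ^^ f x) (0, []))"
    by (rule computable_funpow[OF _ assms])
      (rule computable_Cons computable_Suc computable_fst computable_snd computable_id computable_nat
        computable_Nil computable_Pair)+
  moreover have "((\<lambda>s. (Suc (fst s), fst s # snd s)) ^^ k) (0, []) = (k, rev [0..<k])" for k
    by (induction k) auto
  ultimately have "computable R (prodR natR (listR natR)) (\<lambda>x. (f x, rev [0..<f x]))" by simp
  from computable_rev[OF computable_snd[OF this]] show ?thesis by simp
qed

lemma computable_all_less:
  assumes "computable (prodR R natR) boolR (\<lambda>z. g (fst z) (snd z))" "computable R natR f"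
  shows "computable R boolR (\<lambda>x. \<forall>i<f x. g x i)"
  using computable_list_all[OF assms(1) computable_upt[OF assms(2)]] by (simp add: Ball_def)

lemma computable_nth_default:
  assumes l: "computable R (listR S) l" and k: "computable R natR k" and d: "computable R S d"
  shows "computable R S (\<lambda>x. nth_default (d x) (l x) (k x))"
proof -
  have "computable R (listR S) (\<lambda>x. (tl ^^ k x) (l x))"
  proof (rule computable_funpow[OF _ k l])
    show "computable (prodR R (listR S)) (listR S) (\<lambda>z. tl (snd z))"
      unfolding tl_def
      by (rule computable_case_list) (rule computable_snd computable_id computable_Nil)+
  qed
  then have "computable R S (\<lambda>x. case (tl ^^ k x) (l x) of [] \<Rightarrow> d x | a # r \<Rightarrow> a)"
    by (rule computable_case_list[OF _ d]) (rule computable_fst computable_snd computable_id)+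
  moreover have "(case (tl ^^ k) xs of [] \<Rightarrow> d | a # r \<Rightarrow> a) = nth_default d xs k" for k d and xs :: "'b list"
  proof (induction k arbitrary: xs)
    case 0 show ?case by (cases xs) auto
  next
    case (Suc k)
    have "(case (tl ^^ k) [] of [] \<Rightarrow> d | a # r \<Rightarrow> a) = nth_default d [] k" by (rule Suc)
    with Suc show ?case by (cases xs) (simp_all add: funpow_Suc_right del: funpow.simps)
  qed
  ultimately show ?thesis by simp
qed

lemma computable_subseqs:
  assumes "computable R (listR S) l" shows "computable R (listR (listR S)) (\<lambda>x. subseqs (l x))"
proof -
  have "computable R (listR (listR S)) (\<lambda>x. foldr (\<lambda>a xss. map (Cons a) xss @ xss) (l x) [[]])"
    by (rule computable_foldr[OF _ _ assms])
      (rule computable_append computable_map computable_Cons computable_fst computable_snd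
        computable_id computable_Nil)+
  moreover have "foldr (\<lambda>a xss. map (Cons a) xss @ xss) xs [[]] = subseqs xs" for xs :: "'b list"
    by (induction xs) (auto simp: Let_def)
  ultimately show ?thesis by simp
qed


section \<open>Polynomials over computable rings\<close>

text \<open>Equality has to be decidable, since otherwise not even the degree of a polynomial is computable.\<close>

definition computable_ring :: "'a::comm_ring_1 repr \<Rightarrow> bool" where
  "computable_ring R \<longleftrightarrow> (\<exists>k. R k 0) \<and> (\<exists>k. R k 1) \<and>
     computable (prodR R R) R (\<lambda>z. fst z + snd z) \<and>
     computable (prodR R R) R (\<lambda>z. fst z - snd z) \<and>
     computable (prodR R R) R (\<lambda>z. fst z * snd z) \<and>
     computable (prodR R R) boolR (\<lambda>z. fst z = snd z)"

lemma computable_0: "computable_ring S \<Longrightarrow> computable R S (\<lambda>x. 0)"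
  and computable_1: "computable_ring S \<Longrightarrow> computable R S (\<lambda>x. 1)"
  unfolding computable_ring_def by (auto intro: computable_const)

lemma computable_plus:
  "computable_ring S \<Longrightarrow> computable R S f \<Longrightarrow> computable R S g \<Longrightarrow> computable R S (\<lambda>x. f x + g x)"
  and computable_minus:
  "computable_ring S \<Longrightarrow> computable R S f \<Longrightarrow> computable R S g \<Longrightarrow> computable R S (\<lambda>x. f x - g x)"
  and computable_times:
  "computable_ring S \<Longrightarrow> computable R S f \<Longrightarrow> computable R S g \<Longrightarrow> computable R S (\<lambda>x. f x * g x)"
  and computable_eq:
  "computable_ring S \<Longrightarrow> computable R S f \<Longrightarrow> computable R S g \<Longrightarrow> computable R boolR (\<lambda>x. f x = g x)"
  unfolding computable_ring_def
  by (rule computable_comp2[of S S S "(+)"], simp_all)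
    (rule computable_comp2[of S S S "(-)"], simp_all,
     rule computable_comp2[of S S S "(*)"], simp_all,
     rule computable_comp2[of S S boolR "(=)"], simp_all)

lemma computable_power:
  assumes "computable_ring S" "computable R S f" "computable R natR k"
  shows "computable R S (\<lambda>x. f x ^ k x)"
proof -
  have "computable R S (\<lambda>x. (((*) (f x)) ^^ k x) 1)"
    by (rule computable_funpow assms computable_times computable_comp[OF assms(2)] computable_fst
        computable_snd computable_id computable_1)+
  moreover have "((*) a ^^ n) 1 = a ^ n" for a :: 'a and n by (induction n) auto
  ultimately show ?thesis by simp
qed

lemma computable_of_nat:
  assumes "computable_ring S" "computable R natR k"
  shows "computable R S (\<lambda>x. of_nat (k x))"
proof -
  have "computable R S (\<lambda>x. ((+) 1 ^^ k x) 0)"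
    by (rule computable_funpow assms computable_plus computable_snd computable_id computable_1
        computable_0)+
  moreover have "((+) (1::'a) ^^ n) 0 = of_nat n" for n by (induction n) auto
  ultimately show ?thesis by simp
qed

lemma computable_sum_less:
  assumes S: "computable_ring S"
    and f: "computable (prodR R natR) S (\<lambda>z. f (fst z) (snd z))" and k: "computable R natR k"
  shows "computable R S (\<lambda>x. \<Sum>i<k x. f x i)"
proof -
  have "computable R S (\<lambda>x. foldr (\<lambda>i s. f x i + s) [0..<k x] 0)"
    by (rule computable_foldr computable_upt k computable_plus S computable_comp2[OF f] computable_fst
        computable_snd computable_id computable_0)+
  moreover have "foldr (\<lambda>i s. g i + s) [0..<n] 0 = (\<Sum>i<n. g i)" for g :: "nat \<Rightarrow> 'a" and n
  proof -
    have "foldr (\<lambda>i s. g i + s) xs 0 = sum_list (map g xs)" for xs by (induction xs) auto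
    then show ?thesis by (simp add: sum_list_distinct_conv_sum_set lessThan_atLeast0)
  qed
  ultimately show ?thesis by simp
qed

text \<open>Trailing zeros are allowed, so a polynomial has many codes already if each coefficient has only one.\<close>

definition polyR :: "'a::comm_ring_1 repr \<Rightarrow> 'a poly repr" where
  "polyR R n p \<longleftrightarrow> (\<exists>xs. listR R n xs \<and> Poly xs = p)"

lemma computable_Poly:
  assumes "computable R (listR S) l" shows "computable R (polyR S) (\<lambda>x. Poly (l x))"
  using assms unfolding computable_def polyR_def by blast

text \<open>Decidable equality permits removing trailing zeros, so that the list of coefficients is a
  function of the polynomial.\<close>

lemma computable_coeffs:
  assumes S: "computable_ring S" and f: "computable R (polyR S) f"
  shows "computable R (listR S) (\<lambda>x. coeffs (f x))"
proof (rule computable_comp[OF _ f])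
  have "computable (listR S) (listR S) (\<lambda>xs. foldr (\<lambda>a r. if r = [] \<and> a = 0 then [] else a # r) xs [])"
    by (rule computable_foldr computable_if computable_conj computable_eq[OF S] computable_null computable_Cons
        computable_Nil computable_0[OF S] computable_snd computable_fst computable_id)+
  moreover have "foldr (\<lambda>a r. if r = [] \<and> a = 0 then [] else a # r) xs [] = coeffs (Poly xs)" for xs :: "'a list"
    by (induction xs) (auto simp: cCons_def)
  ultimately have "computable (listR S) (listR S) (\<lambda>xs. coeffs (Poly xs))" by simp
  then show "computable (polyR S) (listR S) coeffs"
    unfolding computable_def polyR_def by blast
qed

lemma computable_poly_length:
  assumes "computable_ring S" "computable R (polyR S) f"
  shows "computable R natR (\<lambda>x. length (coeffs (f x)))"
  by (rule computable_length computable_coeffs assms)+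

lemma computable_degree:
  assumes "computable_ring S" "computable R (polyR S) f"
  shows "computable R natR (\<lambda>x. degree (f x))"
  unfolding degree_eq_length_coeffs
  by (rule computable_diff_nat computable_poly_length assms computable_nat)+

lemma computable_coeff:
  assumes S: "computable_ring S" and "computable R (polyR S) f" "computable R natR k"
  shows "computable R S (\<lambda>x. coeff (f x) (k x))"
  unfolding nth_default_coeffs_eq[symmetric]
  by (rule computable_nth_default computable_coeffs assms computable_0)+

lemma coeff_ge_length: "length (coeffs p) \<le> i \<Longrightarrow> coeff p i = 0"
  by (metis nth_default_beyond nth_default_coeffs_eq)

lemma computable_poly_by_coeff:
  assumes "computable (prodR R natR) S (\<lambda>z. coeff (F (fst z)) (snd z))" "computable R natR k"
    and zero: "\<And>x i. k x \<le> i \<Longrightarrow> coeff (F x) i = 0"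
  shows "computable R (polyR S) F"
proof -
  have "computable R (polyR S) (\<lambda>x. Poly (map (coeff (F x)) [0..<k x]))"
    by (rule computable_Poly computable_map computable_upt assms)+
  moreover have "Poly (map (coeff (F x)) [0..<k x]) = F x" for x
    by (rule poly_eqI) (auto simp: nth_default_def zero)
  ultimately show ?thesis by simp
qed

lemma computable_map_poly:
  assumes S: "computable_ring S" and g: "computable (prodR R S) T (\<lambda>z. g (fst z) (snd z))"
    and f: "computable R (polyR S) f"
  shows "computable R (polyR T) (\<lambda>x. map_poly (g x) (f x))"
  unfolding map_poly_def by (rule computable_Poly computable_map g computable_coeffs S f)+

lemma computable_pCons:
  assumes S: "computable_ring S" and "computable R S f" "computable R (polyR S) g"
  shows "computable R (polyR S) (\<lambda>x. pCons (f x) (g x))"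
proof -
  have "computable R (polyR S) (\<lambda>x. Poly (f x # coeffs (g x)))"
    by (rule computable_Poly computable_Cons computable_coeffs assms)+
  then show ?thesis by simp
qed

lemma foldr_coeffs:
  assumes "F 0 = z" "\<And>a p. F (pCons a p) = G a (F p)"
  shows "foldr G (coeffs p) z = F p"
proof (induction p)
  case (pCons a p)
  then show ?case using assms(2)[of a p] assms(1) by (auto simp: cCons_def)
qed (simp add: assms(1))

text \<open>Horner's rule; the map on the coefficients has to preserve 0, as the result must not depend on trailing
  zeros.\<close>

lemma computable_horner:
  assumes S: "computable_ring S" and T: "computable_ring T"
    and g: "computable (prodR R S) T (\<lambda>z. g (fst z) (snd z))" and g0: "\<And>x. g x 0 = 0"
    and f: "computable R (polyR S) f" and a: "computable R T a"
  shows "computable R T (\<lambda>x. poly (map_poly (g x) (f x)) (a x))"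
proof -
  have "computable R T (\<lambda>x. foldr (\<lambda>b s. g x b + a x * s) (coeffs (f x)) 0)"
    by (rule computable_foldr computable_coeffs computable_plus computable_times S T
        computable_comp2[OF g] computable_comp[OF a] computable_fst computable_snd computable_id f computable_0)+
  moreover have "foldr (\<lambda>b s. g x b + a x * s) (coeffs p) 0 = poly (map_poly (g x) p) (a x)" for x p
    by (rule foldr_coeffs) (simp_all add: map_poly_pCons g0)
  ultimately show ?thesis by simp
qed

lemma computable_ring_polyR:
  assumes R: "computable_ring R" shows "computable_ring (polyR R)"
proof -
  let ?PR = "polyR R"
  note cs = computable_fst computable_snd computable_id
  have len: "computable (prodR ?PR ?PR) natR (\<lambda>z. length (coeffs (fst z)) + length (coeffs (snd z)))"
    by (rule computable_add_nat computable_poly_length R cs)+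
  have plus: "computable (prodR ?PR ?PR) ?PR (\<lambda>z. fst z + snd z)"
  proof (rule computable_poly_by_coeff[OF _ len])
    show "computable (prodR (prodR ?PR ?PR) natR) R (\<lambda>z. coeff (fst (fst z) + snd (fst z)) (snd z))"
      unfolding coeff_add by (rule computable_plus computable_coeff R cs)+
  qed (simp add: coeff_ge_length)
  have minus: "computable (prodR ?PR ?PR) ?PR (\<lambda>z. fst z - snd z)"
  proof (rule computable_poly_by_coeff[OF _ len])
    show "computable (prodR (prodR ?PR ?PR) natR) R (\<lambda>z. coeff (fst (fst z) - snd (fst z)) (snd z))"
      unfolding coeff_diff by (rule computable_minus computable_coeff R cs)+
  qed (simp add: coeff_ge_length)
  have "computable (prodR ?PR ?PR) boolR
      (\<lambda>z. \<forall>i<length (coeffs (fst z)) + length (coeffs (snd z)). coeff (fst z) i = coeff (snd z) i)"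
    by (rule computable_all_less computable_eq[OF R] computable_coeff R cs len)+
  moreover have "(\<forall>i<length (coeffs p) + length (coeffs q). coeff p i = coeff q i) \<longleftrightarrow> p = q" for p q :: "'a poly"
  proof
    assume *: "\<forall>i<length (coeffs p) + length (coeffs q). coeff p i = coeff q i"
    show "p = q"
    proof (rule poly_eqI)
      fix i show "coeff p i = coeff q i"
        using * by (cases "i < length (coeffs p) + length (coeffs q)") (auto simp: coeff_ge_length)
    qed
  qed simp
  ultimately have eq: "computable (prodR ?PR ?PR) boolR (\<lambda>z. fst z = snd z)" by simp
  have smult: "computable (prodR R ?PR) ?PR (\<lambda>z. smult (fst z) (snd z))"
    unfolding smult_conv_map_poly
    by (rule computable_map_poly computable_times R cs)+
  have zero: "computable A ?PR (\<lambda>x. 0)" for A :: "'c repr"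
    by (rule computable_const[of _ 0]) (auto simp: polyR_def)
  have "computable (prodR ?PR ?PR) ?PR
      (\<lambda>z. foldr (\<lambda>a s. smult a (snd z) + pCons 0 s) (coeffs (fst z)) 0)"
    by (rule zero computable_foldr computable_coeffs R computable_comp2[OF plus]
        computable_comp2[OF smult] computable_pCons computable_0 cs)+
  moreover have "foldr (\<lambda>a s. smult a q + pCons 0 s) (coeffs p) 0 = p * q" for p q :: "'a poly"
    by (rule foldr_coeffs) simp_all
  ultimately have times: "computable (prodR ?PR ?PR) ?PR (\<lambda>z. fst z * snd z)" by simp
  have "polyR R 0 0" by (auto simp: polyR_def)
  moreover have "\<exists>k. polyR R k 1"
  proof -
    from R obtain k where "R k 1" unfolding computable_ring_def by blast
    then have "listR R (Suc (prod_encode (k, 0))) [1]" by (simp add: listR_Suc)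
    then show ?thesis unfolding polyR_def by (metis Poly.simps one_pCons)
  qed
  ultimately show ?thesis
    using plus minus times eq unfolding computable_ring_def by blast
qed

lemma computable_pderiv:
  assumes S: "computable_ring (S :: 'a::idom repr)" and f: "computable R (polyR S) f"
  shows "computable R (polyR S) (\<lambda>x. pderiv (f x))"
proof (rule computable_poly_by_coeff)
  show "computable (prodR R natR) S (\<lambda>z. coeff (pderiv (f (fst z))) (snd z))"
    unfolding coeff_pderiv
    by (rule computable_times computable_of_nat computable_Suc computable_coeff S computable_comp[OF f]
        computable_fst computable_snd computable_id)+
  show "computable R natR (\<lambda>x. length (coeffs (f x)))"
    by (rule computable_poly_length S f)+
qed (simp add: coeff_pderiv coeff_ge_length)


section \<open>Searching for certificates\<close>

text \<open>A search must not meet numbers that are not codes, because programs may diverge on them.  The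
  enumeration \<open>e\<close> supplies correct codes of all objects instead.\<close>

definition enumerable :: "'a repr \<Rightarrow> bool" where
  "enumerable S \<longleftrightarrow> (\<exists>e. surj e \<and> computable natR S e)"

lemma computable_decode:
  assumes "computable R natR f"
  shows "computable R (prodR natR natR) (\<lambda>x. prod_decode (f x))"
  by (rule computable_comp[OF _ assms], rule computable_recn[of "\<lambda>n. n"], rule recn_nth)
    (simp_all add: prodR_def)

lemma computable_list_decode:
  assumes "computable R natR f"
  shows "computable R (listR natR) (\<lambda>x. list_decode (f x))"
  by (rule computable_comp[OF _ assms], rule computable_recn[of "\<lambda>n. n"], rule recn_nth)
    (simp_all add: listR_def list.rel_refl)

lemma enumerable_boolR: "enumerable boolR"
  unfolding enumerable_def
proof (rule exI[of _ "\<lambda>n. n = 0"], rule conjI)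
  show "surj (\<lambda>n::nat. n = 0)" by (rule surjI[of _ "\<lambda>b. if b then 0 else 1"]) auto
  show "computable natR boolR (\<lambda>n. n = 0)" by (rule computable_eq0 computable_id)+
qed

lemma enumerable_prodR:
  assumes "enumerable S" "enumerable T" shows "enumerable (prodR S T)"
proof -
  from assms obtain e f where e: "surj e" "computable natR S e" and f: "surj f" "computable natR T f"
    unfolding enumerable_def by blast
  let ?g = "\<lambda>n. (e (fst (prod_decode n)), f (snd (prod_decode n)))"
  have "computable natR (prodR S T) ?g"
    by (rule computable_Pair computable_comp[OF e(2)] computable_comp[OF f(2)] computable_fst computable_snd
        computable_decode computable_id)+
  moreover have "surj ?g"
  proof (rule surjI)
    show "?g (prod_encode (inv e (fst z), inv f (snd z))) = z" for z
      using e(1) f(1) by (simp add: surj_f_inv_f)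
  qed
  ultimately show ?thesis unfolding enumerable_def by blast
qed

lemma enumerable_listR:
  assumes "enumerable S" shows "enumerable (listR S)"
proof -
  from assms obtain e where e: "surj e" "computable natR S e"
    unfolding enumerable_def by blast
  have "computable natR (listR S) (\<lambda>n. map e (list_decode n))"
    by (rule computable_map computable_comp[OF e(2)] computable_list_decode computable_id computable_snd)+
  moreover have "surj (\<lambda>n. map e (list_decode n))"
  proof (rule surjI)
    show "map e (list_decode (list_encode (map (inv e) xs))) = xs" for xs
      using e(1) by (simp add: surj_iff)
  qed
  ultimately show ?thesis unfolding enumerable_def by blast
qed

lemma enumerable_polyR:
  assumes "enumerable S" shows "enumerable (polyR S)"
proof -
  from enumerable_listR[OF assms] obtain e where e: "surj e" "computable natR (listR S) e"
    unfolding enumerable_def by blast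
  have "computable natR (polyR S) (\<lambda>n. Poly (e n))"
    by (rule computable_Poly e)+
  moreover have "surj (\<lambda>n. Poly (e n))"
    by (rule surjI[of _ "\<lambda>p. inv e (coeffs p)"]) (simp add: surj_f_inv_f[OF e(1)])
  ultimately show ?thesis unfolding enumerable_def by blast
qed

text \<open>A program that tries all certificates in turn and then reads off the answer terminates on every
  input that has a certificate.\<close>

lemma decision_by_search:
  assumes check: "computable (prodR R C) boolR (\<lambda>z. check (fst z) (snd z))"
    and C: "enumerable C" and ans: "computable C boolR ans"
  shows "\<exists>A. \<forall>n x. R n x \<longrightarrow> (\<exists>w. check x w) \<longrightarrow> (\<exists>w. check x w \<and> computes A [n] (of_bool (ans w)))"
proof -
  from C obtain e where e: "surj e" "computable natR C e"
    unfolding enumerable_def by blast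
  have "computable (prodR R natR) boolR (\<lambda>z. \<not> check (fst z) (e (snd z)))"
    by (rule computable_not computable_comp2[OF check] computable_comp[OF e(2)] computable_fst
        computable_snd computable_id)+
  then obtain P where P: "\<And>n x k. R n x \<Longrightarrow> computes P [prod_encode (n, k)] (of_bool (\<not> check x (e k)))"
    unfolding computable_def boolR_def by (metis fst_conv snd_conv prodR_encode)
  from computable_comp[OF ans e(2)] obtain Q where Q: "\<And>k. computes Q [k] (of_bool (ans (e k)))"
    unfolding computable_def boolR_def by blast
  obtain E where E: "\<And>a b. computes E [a, b] (prod_encode (a, b))" using ex_pair_program by blast
  let ?F = "Comp P [Comp E [Proj 1, Proj 0]]"
  have F: "computes ?F [k, n] (of_bool (\<not> check x (e k)))" if "R n x" for n k x
    by (rule computes_Comp1[OF _ P[OF that]], rule computes_Comp2[OF _ _ E]) (simp_all add: computes_Proj)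
  show ?thesis
  proof (intro exI[of _ "Comp Q [Mu ?F]"] allI impI)
    fix n x assume nx: "R n x" and "\<exists>w. check x w"
    then have ex: "\<exists>k. check x (e k)" using e(1) by (metis surjD)
    define k where "k = (LEAST k. check x (e k))"
    have k: "check x (e k)" unfolding k_def using ex by (rule LeastI_ex)
    have "computes (Mu ?F) [n] k"
    proof (rule computes.Mu)
      show "computes ?F [k, n] 0" using F[OF nx, of k] k by simp
      show "\<forall>m<k. \<exists>y>0. computes ?F [m, n] y"
      proof (intro allI impI)
        fix m assume "m < k"
        then have "\<not> check x (e m)" unfolding k_def by (rule not_less_Least)
        with F[OF nx, of m] show "\<exists>y>0. computes ?F [m, n] y" by (intro exI[of _ 1]) simp
      qed
    qed
    then have "computes (Comp Q [Mu ?F]) [n] (of_bool (ans (e k)))" using Q by (rule computes_Comp1)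
    with k show "\<exists>w. check x w \<and> computes (Comp Q [Mu ?F]) [n] (of_bool (ans w))" by blast
  qed
qed


section \<open>The field of constants\<close>

definition fieldR :: "(nat \<Rightarrow> 'k::field) \<Rightarrow> 'k repr" where
  "fieldR c n a \<longleftrightarrow> (\<exists>e. n = aexp_code e \<and> aval c e = a)"

text \<open>Operations on expressions only put a tag in front of the codes of the operands.\<close>

lemma computable_tag:
  assumes "\<And>m a b. R m a \<Longrightarrow> S (prod_encode (t, m)) (f a)"
  shows "computable R S f"
proof (rule computable_recn[of "\<lambda>n. prod_encode (t, n)"])
  have "recn 1 (\<lambda>xs. t)" by (induction t) (rule recn_zero recn_Suc | assumption)+
  then show "recn 1 (\<lambda>xs. prod_encode (t, xs ! 0))" by (intro recn_prod_encode recn_nth) simp_all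
qed (rule assms)

lemma fieldR_operation:
  assumes "\<And>e e'. aexp_code (op e e') = prod_encode (t, prod_encode (aexp_code e, aexp_code e'))"
    and "\<And>e e'. aval c (op e e') = h (aval c e) (aval c e')"
  shows "computable (prodR (fieldR c) (fieldR c)) (fieldR c) (\<lambda>z. h (fst z) (snd z))"
proof (rule computable_tag[of _ _ t])
  fix m and z :: "'a \<times> 'a"
  assume "prodR (fieldR c) (fieldR c) m z"
  then obtain e e' where *: "fst (prod_decode m) = aexp_code e" "aval c e = fst z"
      "snd (prod_decode m) = aexp_code e'" "aval c e' = snd z"
    unfolding prodR_def fieldR_def by blast
  then have "prod_decode m = (aexp_code e, aexp_code e')" by (simp add: prod_eq_iff)
  then have "m = prod_encode (aexp_code e, aexp_code e')" by (metis prod_decode_inverse)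
  with * show "fieldR c (prod_encode (t, m)) (h (fst z) (snd z))"
    unfolding fieldR_def by (intro exI[of _ "op e e'"]) (simp add: assms)
qed

context
  fixes c :: "nat \<Rightarrow> 'k::field"
  assumes effective: "effective_field c"
begin

lemma computable_Const: "computable natR (fieldR c) c"
  by (rule computable_tag[of _ _ 0]) (auto simp: fieldR_def intro!: exI[of _ "Const _"])

lemma computable_ring_fieldR: "computable_ring (fieldR c)"
proof -
  from effective obtain P where
    P: "\<And>e e'. computes P [aexp_code e, aexp_code e'] (if aval c e = aval c e' then 1 else 0)"
    unfolding effective_field_def by blast
  obtain F where F: "\<And>n. computes F [n] (fst (prod_decode n))"
    using ex_program1[OF recn_fst_decode[OF recn_nth]] by force
  obtain G where G: "\<And>n. computes G [n] (snd (prod_decode n))"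
    using ex_program1[OF recn_snd_decode[OF recn_nth]] by force
  have "computable (prodR (fieldR c) (fieldR c)) boolR (\<lambda>z. fst z = snd z)"
    unfolding computable_def
  proof (intro exI[of _ "Comp P [F, G]"] allI impI)
    fix n and z :: "'k \<times> 'k"
    assume "prodR (fieldR c) (fieldR c) n z"
    then obtain e e' where *: "fst (prod_decode n) = aexp_code e" "aval c e = fst z"
        "snd (prod_decode n) = aexp_code e'" "aval c e' = snd z"
      unfolding prodR_def fieldR_def by blast
    have "computes (Comp P [F, G]) [n] (if aval c e = aval c e' then 1 else 0)"
      by (rule computes_Comp2[OF F G]) (simp only: *(1,3), rule P)
    then show "\<exists>m. computes (Comp P [F, G]) [n] m \<and> boolR m (fst z = snd z)"
      using * by (auto simp: boolR_def split: if_splits)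
  qed
  moreover have "\<exists>k. fieldR c k a" for a
    using effective unfolding effective_field_def fieldR_def by blast
  ultimately show ?thesis
    unfolding computable_ring_def
    using fieldR_operation[of Plus 1 c "(+)"] fieldR_operation[of Minus 2 c "(-)"]
      fieldR_operation[of Times 3 c "(*)"] by simp
qed

text \<open>Not every number is the code of an expression, and the equality test may diverge on other
  numbers.  A stack machine for the arithmetic operations enumerates all values through codes that
  are correct by construction.\<close>

definition arith :: "nat \<Rightarrow> 'k \<Rightarrow> 'k \<Rightarrow> 'k" where
  "arith t b a = (if t = 1 then b + a else if t = 2 then b - a else if t = 3 then b * a else b / a)"

definition instr :: "'k list \<Rightarrow> nat \<times> nat \<Rightarrow> 'k list" where
  "instr st i = (if fst i = 0 then c (snd i) # st else
     (case st of [] \<Rightarrow> st | a # r \<Rightarrow> (case r of [] \<Rightarrow> st | b # r' \<Rightarrow> arith (fst i) b a # r')))"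

lemma instr_simps:
  "instr st (0, n) = c n # st" "t \<noteq> 0 \<Longrightarrow> instr (a # b # r) (t, n) = arith t b a # r"
  by (simp_all add: instr_def)

lemma stack_machine_complete: "\<exists>ks. \<forall>st. foldl instr st ks = aval c e # st"
proof -
  have op: "\<exists>ks. \<forall>st. foldl instr st ks = arith t a b # st"
    if "t \<noteq> 0" "\<exists>ks. \<forall>st. foldl instr st ks = a # st" "\<exists>ks. \<forall>st. foldl instr st ks = b # st" for t a b
  proof -
    from that obtain ks js where "\<forall>st. foldl instr st ks = a # st" "\<forall>st. foldl instr st js = b # st" by blast
    with that(1) show ?thesis by (intro exI[of _ "ks @ js @ [(t, 0)]"]) (simp add: instr_simps)
  qed
  show ?thesis
  proof (induction e)
    case (Const n)
    show ?case by (rule exI[of _ "[(0, n)]"]) (simp add: instr_simps)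
  next
    case (Plus e e')
    then show ?case using op[of 1] by (simp add: arith_def)
  next
    case (Minus e e')
    then show ?case using op[of 2] by (simp add: arith_def)
  next
    case (Times e e')
    then show ?case using op[of 3] by (simp add: arith_def)
  next
    case (Div e e')
    then show ?case using op[of 4] by (simp add: arith_def)
  qed
qed

lemma enumerable_fieldR: "enumerable (fieldR c)"
proof -
  let ?K = "fieldR c"
  note K = computable_ring_fieldR
  have ops: "computable (prodR ?K ?K) ?K (\<lambda>z. fst z + snd z)"
    "computable (prodR ?K ?K) ?K (\<lambda>z. fst z - snd z)"
    "computable (prodR ?K ?K) ?K (\<lambda>z. fst z * snd z)"
    "computable (prodR ?K ?K) ?K (\<lambda>z. fst z / snd z)"
    using fieldR_operation[of Plus 1 c "(+)"] fieldR_operation[of Minus 2 c "(-)"]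
      fieldR_operation[of Times 3 c "(*)"] fieldR_operation[of Div 4 c "(/)"] by simp_all
  note cs = computable_fst computable_snd computable_id
  have arith: "computable (prodR natR (prodR ?K ?K)) ?K (\<lambda>z. arith (fst z) (fst (snd z)) (snd (snd z)))"
    unfolding arith_def
    by (rule computable_if computable_eq_nat computable_nat cs ops[THEN computable_comp2])+
  have instr: "computable (prodR (listR ?K) (prodR natR natR)) (listR ?K) (\<lambda>z. instr (fst z) (snd z))"
    unfolding instr_def
    by (rule computable_if computable_eq_nat computable_nat computable_case_list computable_Cons
        computable_comp[OF computable_Const] computable_comp3[OF arith] cs)+
  have enum: "computable natR ?K
     (\<lambda>n. nth_default 0 (foldl instr [] (map prod_decode (list_decode n))) 0)"
    by (rule computable_nth_default computable_foldl computable_map computable_list_decode computable_nat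
        computable_decode computable_comp2[OF instr] computable_0[OF K] computable_Nil cs)+
  have "surj (\<lambda>n. nth_default 0 (foldl instr [] (map prod_decode (list_decode n))) 0)"
    unfolding surj_def
  proof
    fix a
    obtain e where e: "aval c e = a" using effective unfolding effective_field_def by blast
    obtain ks where "\<forall>st. foldl instr st ks = aval c e # st" using stack_machine_complete by blast
    then have "a = nth_default 0 (foldl instr [] (map prod_decode (list_decode (list_encode (map prod_encode ks))))) 0"
      by (simp add: e comp_def)
    then show "\<exists>n. a = nth_default 0 (foldl instr [] (map prod_decode (list_decode n))) 0" by blast
  qed
  with enum show ?thesis unfolding enumerable_def by blast
qed

end


section \<open>Endomorphisms, degrees and derivations of K[x,y]\<close>

subsection \<open>Substitution\<close>

lemma alg_endoD:
  assumes "alg_endo \<phi>"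
  shows "\<phi> (p + q) = \<phi> p + \<phi> q" "\<phi> (p * q) = \<phi> p * \<phi> q" "\<phi> (const2 a) = const2 a"
  using assms unfolding alg_endo_def by blast+

lemma alg_endo_simps:
  assumes "alg_endo \<phi>"
  shows "\<phi> 0 = 0" "\<phi> 1 = 1" "\<phi> (- p) = - \<phi> p" "\<phi> (p - q) = \<phi> p - \<phi> q" "\<phi> (p ^ n) = \<phi> p ^ n"
proof -
  show 0: "\<phi> 0 = 0" using alg_endoD(3)[OF assms, of 0] by simp
  show 1: "\<phi> 1 = 1" using alg_endoD(3)[OF assms, of 1] by (simp add: one_pCons)
  show m: "\<phi> (- p) = - \<phi> p" for p
    using alg_endoD(1)[OF assms, of p "- p"] 0 by (simp add: eq_neg_iff_add_eq_0 add.commute)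
  show "\<phi> (p - q) = \<phi> p - \<phi> q" using alg_endoD(1)[OF assms, of p "- q"] m by simp
  show "\<phi> (p ^ n) = \<phi> p ^ n" by (induction n) (simp_all add: 1 alg_endoD(2)[OF assms])
qed

lemmas endo_hom = alg_endoD[OF alg_endo_endo] alg_endo_simps[OF alg_endo_endo]

lemma poly2_induct [case_names const X Y add mult]:
  assumes "\<And>a. P (const2 a)" "P X" "P Y" "\<And>p q. P p \<Longrightarrow> P q \<Longrightarrow> P (p + q)"
    "\<And>p q. P p \<Longrightarrow> P q \<Longrightarrow> P (p * q)"
  shows "P p"
proof (induction p)
  case 0
  show ?case using assms(1)[of 0] by simp
next
  case (pCons q p)
  have "P [:q:]" for q
  proof (induction q)
    case 0
    show ?case using assms(1)[of 0] by simp
  next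
    case (pCons a q)
    have "[:pCons a q:] = const2 a + X * [:q:]" by simp
    with pCons assms show ?case by metis
  qed
  moreover have "pCons q p = [:q:] + Y * p" by simp
  ultimately show ?case using pCons assms by metis
qed

lemma alg_endo_eqI:
  "alg_endo \<phi> \<Longrightarrow> alg_endo \<psi> \<Longrightarrow> \<phi> X = \<psi> X \<Longrightarrow> \<phi> Y = \<psi> Y \<Longrightarrow> \<phi> = \<psi>"
  by (metis endo_unique)

lemma alg_endo_comp: "alg_endo \<phi> \<Longrightarrow> alg_endo \<psi> \<Longrightarrow> alg_endo (\<phi> \<circ> \<psi>)"
  by (simp add: alg_endo_def)

lemma alg_endo_id: "alg_endo id"
  by (simp add: alg_endo_def)

lemma endo_comp: "endo u v \<circ> endo a b = endo (endo u v a) (endo u v b)"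
  by (rule alg_endo_eqI) (simp_all add: alg_endo_comp alg_endo_endo endo_X endo_Y del: pCons_eq_0_iff)

lemma endo_endo: "endo u v (endo a b p) = endo (endo u v a) (endo u v b) p"
  using endo_comp[of u v a b] by (metis comp_apply)

lemma endo_X_Y: "endo X Y = id"
  by (rule alg_endo_eqI) (simp_all only: alg_endo_endo alg_endo_id endo_X endo_Y id_apply)

lemma endo_X_Y_apply [simp]: "endo X Y p = p"
  by (simp only: endo_X_Y id_apply)


subsection \<open>The degree in x\<close>

abbreviation swap :: "'k::field poly poly \<Rightarrow> 'k poly poly" where "swap \<equiv> endo Y X"

lemma swap_swap [simp]: "swap (swap p) = p"
  by (simp only: endo_endo endo_X endo_Y endo_X_Y_apply)

lemma swap_eq_iff [simp]: "swap p = swap q \<longleftrightarrow> p = q"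
  by (metis swap_swap)

lemma swap_eq_0_iff [simp]: "swap p = 0 \<longleftrightarrow> p = 0"
  by (metis swap_eq_iff endo_hom(4))

lemma endo_pCons: "endo u v (pCons q p) = endo u v [:q:] + v * endo u v p"
proof -
  have "pCons q p = [:q:] + Y * p" by simp
  then show ?thesis by (simp only: endo_hom endo_Y)
qed

lemma endo_const_pCons: "endo u v [:pCons a q:] = const2 a + u * endo u v [:q:]"
proof -
  have "[:pCons a q:] = const2 a + X * [:q:]" by simp
  then show ?thesis by (simp only: endo_hom endo_X)
qed

lemma coeff_swap_const: "coeff (swap [:q:]) i = [:coeff q i:]"
proof (induction q arbitrary: i)
  case 0
  then show ?case by (simp add: endo_hom)
next
  case (pCons a q)
  show ?case
    unfolding endo_const_pCons[of _ _ a q] by (cases i) (simp_all add: pCons.IH)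
qed

lemma coeff_swap: "coeff (coeff (swap p) i) j = coeff (coeff p j) i"
proof (induction p arbitrary: j)
  case 0
  then show ?case by (simp add: endo_hom)
next
  case (pCons q p)
  show ?case
    unfolding endo_pCons[of _ _ q p] by (cases j) (simp_all add: pCons.IH coeff_swap_const)
qed

text \<open>Exchanging the variables turns the degree in \<open>x\<close> into the degree of a polynomial in the outer
  variable, so that the facts about \<open>degree\<close> carry over.\<close>

definition degx :: "'k::field poly poly \<Rightarrow> nat" where "degx p = degree (swap p)"

lemma degx_le_iff: "degx p \<le> n \<longleftrightarrow> (\<forall>j. degree (coeff p j) \<le> n)"
proof
  assume "degx p \<le> n"
  then have "coeff (swap p) i = 0" if "i > n" for i
    using that unfolding degx_def by (simp add: coeff_eq_0)
  then have "coeff (coeff p j) i = 0" if "i > n" for i j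
    using that coeff_swap[of p i j] by simp
  then show "\<forall>j. degree (coeff p j) \<le> n" by (auto intro: degree_le)
next
  assume *: "\<forall>j. degree (coeff p j) \<le> n"
  have "coeff (swap p) i = 0" if "i > n" for i
  proof (rule poly_eqI)
    fix j
    have "degree (coeff p j) < i" using *[rule_format, of j] that by simp
    then show "coeff (coeff (swap p) i) j = coeff 0 j" by (simp add: coeff_swap coeff_eq_0)
  qed
  then show "degx p \<le> n" unfolding degx_def by (auto intro: degree_le)
qed

lemma degree_coeff_le_degx: "degree (coeff p j) \<le> degx p"
  using degx_le_iff by blast

lemma degx_0 [simp]: "degx 0 = 0" and degx_1 [simp]: "degx 1 = 0"
  and degx_const [simp]: "degx (const2 a) = 0"
  by (simp_all add: degx_def endo_hom)

lemma degx_swap [simp]: "degx (swap p) = degree p" and degree_swap [simp]: "degree (swap p) = degx p"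
  by (simp_all add: degx_def)

lemma degx_X [simp]: "degx X = 1" and degx_Y [simp]: "degx Y = 0"
  unfolding degx_def endo_X endo_Y by simp_all

lemma degx_mult: "p \<noteq> 0 \<Longrightarrow> q \<noteq> 0 \<Longrightarrow> degx (p * q) = degx p + degx q"
  unfolding degx_def by (simp add: endo_hom degree_mult_eq)

lemma degx_mult_le: "degx (p * q) \<le> degx p + degx q"
  unfolding degx_def endo_hom by (rule degree_mult_le)

lemma degx_diff_le: "degx p \<le> n \<Longrightarrow> degx q \<le> n \<Longrightarrow> degx (p - q) \<le> n"
  unfolding degx_def by (simp add: endo_hom degree_diff_le)

lemma const2_iff_degrees: "(\<exists>a. p = const2 a) \<longleftrightarrow> degree p = 0 \<and> degx p = 0"
proof
  assume *: "degree p = 0 \<and> degx p = 0"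
  then obtain q where q: "p = [:q:]" by (auto elim: degree_eq_zeroE)
  then have "degree q = 0" using * degree_coeff_le_degx[of p 0] by simp
  then show "\<exists>a. p = const2 a" using q by (auto elim: degree_eq_zeroE)
qed auto

lemma dvd_one_const2:
  assumes "p * q = (1 :: 'k::field poly poly)" obtains a where "a \<noteq> 0" "p = const2 a"
proof -
  have nz: "p \<noteq> 0" "q \<noteq> 0" using assms by auto
  have "degree p + degree q = 0" "degx p + degx q = 0"
    using degree_mult_eq[OF nz] degx_mult[OF nz] assms by simp_all
  then obtain a where "p = const2 a" using const2_iff_degrees by force
  with nz that show ?thesis by auto
qed

lemma X_power: "X ^ i = [:monom 1 i:]" and Y_power: "Y ^ j = monom 1 j"
  by (induction i) (simp_all add: monom_Suc one_pCons monom_0, induction j, simp_all add: monom_Suc one_pCons monom_0 smult_monom)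

lemma coeff_XY: "coeff (coeff (const2 a * (X ^ i * Y ^ j)) n) m = (if n = j \<and> m = i then a else 0)"
  unfolding X_power Y_power by (auto simp: coeff_monom)

text \<open>Polynomials of bounded degrees form the span of finitely many monomials; linear equations for them are
  therefore finite systems.\<close>

lemma poly2_as_sum:
  assumes "degree p < M" "degx p < N"
  shows "p = (\<Sum>j<M. \<Sum>i<N. const2 (coeff (coeff p j) i) * (X ^ i * Y ^ j))"
proof (rule poly_eqI, rule poly_eqI)
  fix n m
  have "coeff (coeff (\<Sum>j<M. \<Sum>i<N. const2 (coeff (coeff p j) i) * (X ^ i * Y ^ j)) n) m =
      (\<Sum>j<M. \<Sum>i<N. if n = j \<and> m = i then coeff (coeff p j) i else 0)"
    by (simp only: coeff_sum coeff_XY)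
  also have "\<dots> = (\<Sum>j<M. if n = j then (if m < N then coeff (coeff p j) m else 0) else 0)"
    by (rule sum.cong) auto
  also have "\<dots> = (if n < M \<and> m < N then coeff (coeff p n) m else 0)" by simp
  also have "\<dots> = coeff (coeff p n) m"
  proof (cases "n < M")
    case True
    have "degree (coeff p n) < N" using degree_coeff_le_degx[of p n] assms(2) by simp
    then have "m \<ge> N \<Longrightarrow> coeff (coeff p n) m = 0" by (intro coeff_eq_0) simp
    with True show ?thesis by auto
  next
    case False
    then have "coeff p n = 0" using assms(1) by (intro coeff_eq_0) simp
    then show ?thesis by simp
  qed
  finally show "coeff (coeff p n) m =
      coeff (coeff (\<Sum>j<M. \<Sum>i<N. const2 (coeff (coeff p j) i) * (X ^ i * Y ^ j)) n) m" ..
qed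


subsection \<open>Derivations\<close>

definition derivation :: "('k::field poly poly \<Rightarrow> 'k poly poly) \<Rightarrow> bool" where
  "derivation D \<longleftrightarrow> (\<forall>p q. D (p + q) = D p + D q) \<and> (\<forall>p q. D (p * q) = D p * q + p * D q) \<and>
     (\<forall>a. D (const2 a) = 0)"

definition dx :: "'k::field poly poly \<Rightarrow> 'k poly poly" where "dx p = swap (pderiv (swap p))"

definition jac :: "'k::field poly poly \<Rightarrow> 'k poly poly \<Rightarrow> 'k poly poly" where
  "jac p q = dx p * pderiv q - pderiv p * dx q"

lemma derivation_pderiv: "derivation pderiv"
  by (simp add: derivation_def pderiv_add pderiv_mult pderiv_pCons algebra_simps)

lemma derivation_dx: "derivation dx"
  by (simp add: derivation_def dx_def endo_hom pderiv_add pderiv_mult pderiv_pCons algebra_simps)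

lemma derivationD:
  assumes "derivation D"
  shows "D (p + q) = D p + D q" "D (p * q) = D p * q + p * D q" "D (const2 a) = 0" "D 0 = 0"
    "D (p - q) = D p - D q" "D (const2 a * p) = const2 a * D p"
proof -
  show *: "D (p + q) = D p + D q" "D (p * q) = D p * q + p * D q" "D (const2 a) = 0" for p q a
    using assms unfolding derivation_def by blast+
  show "D (const2 a * p) = const2 a * D p" by (simp only: * mult_zero_left add_0_left)
  show "D 0 = 0" using *(3)[of 0] by simp
  show "D (p - q) = D p - D q" using *(1)[of "p - q" q] by (simp add: algebra_simps)
qed

lemma derivation_jac: "derivation (jac p)"
  by (simp add: derivation_def jac_def derivationD[OF derivation_dx] derivationD[OF derivation_pderiv]
      algebra_simps)

lemma dx_X [simp]: "dx X = 1" and dx_Y [simp]: "dx Y = 0"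
  and pderiv_X [simp]: "pderiv X = 0" and pderiv_Y [simp]: "pderiv Y = 1"
  unfolding dx_def endo_X endo_Y
  by (simp_all add: pderiv_pCons endo_hom one_pCons del: pCons_one)

text \<open>The chain rule.  Sums and products of polynomials that satisfy it satisfy it again, so it is enough to
  check constants and variables.\<close>

lemma derivation_endo:
  assumes "derivation D"
  shows "D (endo u v p) = endo u v (dx p) * D u + endo u v (pderiv p) * D v"
proof (induction p rule: poly2_induct)
  case (const a)
  show ?case
    by (simp only: endo_hom derivationD[OF assms] derivationD[OF derivation_dx]
        derivationD[OF derivation_pderiv] mult_zero_left add_0_left)
next
  case X
  show ?case by (simp only: endo_X dx_X pderiv_X endo_hom mult_zero_left mult_1_left add_0_right)
next
  case Y
  show ?case by (simp only: endo_Y dx_Y pderiv_Y endo_hom mult_zero_left mult_1_left add_0_left)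
next
  case (add p q)
  then show ?case
    by (simp add: endo_hom derivationD[OF assms] derivationD[OF derivation_dx]
        derivationD[OF derivation_pderiv] algebra_simps)
next
  case (mult p q)
  then show ?case
    by (simp add: endo_hom derivationD[OF assms] derivationD[OF derivation_dx]
        derivationD[OF derivation_pderiv] algebra_simps)
qed

lemma jac_self [simp]: "jac p p = 0"
  by (simp add: jac_def)

lemma jac_anti: "jac q p = - jac p q"
  by (simp add: jac_def algebra_simps)

lemma jac_endo_right: "jac p (endo p q F) = endo p q (pderiv F) * jac p q"
  by (simp add: derivation_endo[OF derivation_jac])

lemma jac_endo: "jac (endo u v p) (endo u v q) = endo u v (jac p q) * jac u v"
proof -
  have eq: "jac (endo u v p) r = endo u v (dx p) * jac u r + endo u v (pderiv p) * jac v r" for r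
    using derivation_endo[OF derivation_jac, of r u v p] by (simp add: jac_anti[of r] algebra_simps)
  show ?thesis
    unfolding eq derivation_endo[OF derivation_jac]
    by (simp add: jac_anti[of v u] jac_def[of p q] endo_hom algebra_simps)
qed

lemma jac_X_Y: "jac X Y = 1"
  by (simp add: jac_def del: pCons_one)

lemma degx_pderiv_le: "degx (pderiv p) \<le> degx p"
  unfolding degx_le_iff[of "pderiv p"]
proof
  fix j
  have "coeff (pderiv p) j = of_nat (Suc j) * coeff p (Suc j)" by (rule coeff_pderiv)
  also have "of_nat (Suc j) * coeff p (Suc j) = smult (of_nat (Suc j)) (coeff p (Suc j))"
    by (simp add: of_nat_poly)
  finally show "degree (coeff (pderiv p) j) \<le> degx p"
    using degree_smult_le degree_coeff_le_degx le_trans by metis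
qed

lemma degree_dx_le: "degree (dx p) \<le> degree p"
  using degx_pderiv_le[of "swap p"] by (simp add: dx_def)

lemma degree_pderiv_le: "degree (pderiv p) \<le> degree p"
  by (rule degree_le) (simp add: coeff_pderiv coeff_eq_0)

lemma degx_dx: "degx (dx p) \<le> degx p"
  unfolding degx_def dx_def swap_swap by (rule degree_pderiv_le)

lemma degree_jac_le: "degree (jac p q) \<le> degree p + degree q"
  and degx_jac_le: "degx (jac p q) \<le> degx p + degx q"
proof -
  have "degree (dx p * pderiv q) \<le> degree p + degree q" "degree (pderiv p * dx q) \<le> degree p + degree q"
    by (meson add_mono degree_mult_le degree_dx_le degree_pderiv_le le_trans)+
  then show "degree (jac p q) \<le> degree p + degree q" unfolding jac_def by (rule degree_diff_le)
  have "degx (dx p * pderiv q) \<le> degx p + degx q" "degx (pderiv p * dx q) \<le> degx p + degx q"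
    by (meson add_mono degx_mult_le degx_dx degx_pderiv_le le_trans)+
  then show "degx (jac p q) \<le> degx p + degx q" unfolding jac_def by (rule degx_diff_le)
qed

text \<open>Polynomials with nonzero Jacobian are algebraically independent: an algebraic relation of least
  degree would yield smaller relations by differentiation.\<close>

lemma jac_nonzero_injective:
  fixes u v :: "'k::field_char_0 poly poly"
  assumes "jac u v \<noteq> 0" "endo u v F = 0" shows "F = 0"
  using assms(2)
proof (induction "degree F + degx F" arbitrary: F rule: less_induct)
  case less
  have D: "endo u v (dx F) * D u + endo u v (pderiv F) * D v = 0" if "derivation D" for D
    using derivation_endo[OF that, of u v F] less.prems derivationD(4)[OF that] by simp
  let ?a = "endo u v (dx F)" and ?b = "endo u v (pderiv F)"
  have "?a * dx u + ?b * dx v = 0" "?a * pderiv u + ?b * pderiv v = 0"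
    using D derivation_dx derivation_pderiv by blast+
  then have "?a * jac u v = 0" "?b * jac u v = 0" unfolding jac_def by algebra+
  with assms(1) have ab: "?a = 0" "?b = 0" by simp_all
  have y: "degree F = 0"
  proof (rule ccontr)
    assume "degree F \<noteq> 0"
    then have "degree (pderiv F) + degx (pderiv F) < degree F + degx F"
      using degree_pderiv[of F] degx_pderiv_le[of F] by linarith
    then have "pderiv F = 0" using less.hyps ab by blast
    with \<open>degree F \<noteq> 0\<close> show False by (simp add: pderiv_eq_0_iff)
  qed
  have x: "degx F = 0"
  proof (rule ccontr)
    assume "degx F \<noteq> 0"
    then have "degree (dx F) + degx (dx F) < degree F + degx F"
      using degree_dx_le[of F] degree_pderiv[of "swap F"] by (simp add: dx_def)
    then have "dx F = 0" using less.hyps ab by blast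
    with \<open>degx F \<noteq> 0\<close> show False by (simp add: dx_def pderiv_eq_0_iff)
  qed
  from x y obtain a where F: "F = const2 a" using const2_iff_degrees by blast
  then show ?case using less.prems by (simp add: endo_hom)
qed


section \<open>Birational morphisms and automorphisms\<close>

definition birational_with :: "'k::field poly poly \<Rightarrow> 'k poly poly \<Rightarrow> 'k poly poly \<Rightarrow> 'k poly poly \<Rightarrow>
    'k poly poly \<Rightarrow> bool" where
  "birational_with u v A B C \<longleftrightarrow>
     endo u v B \<noteq> 0 \<and> endo u v B * X = endo u v A \<and> endo u v B * Y = endo u v C"

text \<open>The quotients of polynomials in \<open>u\<close> and \<open>v\<close> form a subfield, which must contain \<open>x\<close> and \<open>y\<close>; a common
  denominator gives \<open>B\<close>.\<close>

lemma birational_imp_birational_with: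
  fixes u v :: "'k::field poly poly"
  assumes "birational (endo u v)" shows "\<exists>A B C. birational_with u v A B C"
proof -
  let ?E = "endo u v"
  define S where "S = {to_fract (?E a) / to_fract (?E b) | a b. ?E b \<noteq> 0}"
  have in_S: "to_fract (?E a) / to_fract (?E b) \<in> S" if "?E b \<noteq> 0" for a b
    using that unfolding S_def by blast
  have "subfield S"
    unfolding subfield_def
  proof (intro conjI ballI)
    show "0 \<in> S" using in_S[of 1 0] by (simp add: endo_hom)
    show "1 \<in> S" using in_S[of 1 1] by (simp add: endo_hom)
    fix r s assume "r \<in> S" "s \<in> S"
    then obtain a b a' b' where r: "r = to_fract (?E a) / to_fract (?E b)" "?E b \<noteq> 0"
      and s: "s = to_fract (?E a') / to_fract (?E b')" "?E b' \<noteq> 0"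
      unfolding S_def by blast
    have b: "?E (b * b') \<noteq> 0" using r s by (simp add: endo_hom)
    have "r + s = to_fract (?E (a * b' + a' * b)) / to_fract (?E (b * b'))"
      unfolding r(1) s(1) using r(2) s(2) by (simp add: endo_hom add_frac_eq)
    then show "r + s \<in> S" using in_S[OF b] by simp
    have "r - s = to_fract (?E (a * b' - a' * b)) / to_fract (?E (b * b'))"
      unfolding r(1) s(1) using r(2) s(2) by (simp add: endo_hom diff_frac_eq)
    then show "r - s \<in> S" using in_S[OF b] by simp
    have "r * s = to_fract (?E (a * a')) / to_fract (?E (b * b'))"
      using r s by (simp add: endo_hom)
    then show "r * s \<in> S" using in_S[OF b] by simp
    show "r / s \<in> S"
    proof (cases "?E a' = 0")
      case True
      then show ?thesis using in_S[of 1 0] by (simp add: endo_hom s)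
    next
      case False
      then have "?E (b * a') \<noteq> 0" using r by (simp add: endo_hom)
      moreover have "r / s = to_fract (?E (a * b')) / to_fract (?E (b * a'))"
        using r s by (simp add: endo_hom)
      ultimately show ?thesis using in_S by simp
    qed
  qed
  moreover have "range (\<lambda>a. to_fract (const2 a)) \<union> {to_fract (?E X), to_fract (?E Y)} \<subseteq> S"
  proof -
    have "to_fract (?E a) \<in> S" for a using in_S[of 1 a] by (simp add: endo_hom)
    then show ?thesis using endo_hom(3)[of u v] by (metis (no_types, lifting) Un_insert_right image_subsetI insert_subset sup_bot.right_neutral)
  qed
  ultimately have "subfield hull (range (\<lambda>a. to_fract (const2 a)) \<union> {to_fract (?E X), to_fract (?E Y)}) \<subseteq> S"
    by (metis hull_minimal)
  with assms have UNIV: "S = UNIV" unfolding birational_def by blast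
  then obtain A B A' B' where A: "to_fract X = to_fract (?E A) / to_fract (?E B)" "?E B \<noteq> 0"
    and A': "to_fract Y = to_fract (?E A') / to_fract (?E B')" "?E B' \<noteq> 0"
    unfolding S_def by blast
  have clear: "b * z = a" if "to_fract z = to_fract a / to_fract b" "b \<noteq> 0" for a b z :: "'k poly poly"
  proof -
    have "to_fract (b * z) = to_fract a" using that by simp
    then show ?thesis by (simp only: to_fract_eq_iff)
  qed
  have 1: "?E B * X = ?E A" by (rule clear[OF A])
  have 2: "?E B' * Y = ?E A'" by (rule clear[OF A'])
  have "?E B * ?E B' * X = (?E B * X) * ?E B'" "?E B * ?E B' * Y = (?E B' * Y) * ?E B"
    by (simp_all only: mult_ac)
  then have "birational_with u v (A * B') (B * B') (A' * B)"
    unfolding birational_with_def endo_hom 1 2 using A(2) A'(2) by simp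
  then show ?thesis by blast
qed

text \<open>Differentiating the relations for \<open>x\<close> and \<open>y\<close> with respect to both variables exhibits \<open>B(u, v)\<close> times the
  identity matrix as a product in which one factor is the Jacobian matrix of \<open>(u, v)\<close>.\<close>

lemma birational_with_jac:
  assumes "birational_with u v A B C" shows "jac u v \<noteq> 0"
proof
  assume J: "jac u v = 0"
  let ?E = "endo u v"
  have B: "?E B \<noteq> 0" and x: "?E B * X = ?E A" and y: "?E B * Y = ?E C"
    using assms unfolding birational_with_def by blast+
  have key: "?E B * D z = (?E (dx F) - z * ?E (dx B)) * D u + (?E (pderiv F) - z * ?E (pderiv B)) * D v"
    if D: "derivation D" and z: "?E B * z = ?E F" for D z F
  proof -
    have "D (?E B) * z + ?E B * D z = D (?E F)" using derivationD(2)[OF D] z by metis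
    then show ?thesis unfolding derivation_endo[OF D] by (simp add: algebra_simps)
  qed
  define a b a' b' where "a = ?E (dx A) - X * ?E (dx B)" and "b = ?E (pderiv A) - X * ?E (pderiv B)"
    and "a' = ?E (dx C) - Y * ?E (dx B)" and "b' = ?E (pderiv C) - Y * ?E (pderiv B)"
  have e1: "?E B = a * dx u + b * dx v"
    using key[OF derivation_dx x] unfolding a_def b_def by (simp only: dx_X mult_1_right)
  have e2: "0 = a * pderiv u + b * pderiv v"
    using key[OF derivation_pderiv x] unfolding a_def b_def by (simp only: pderiv_X mult_zero_right)
  have e3: "?E B = a' * pderiv u + b' * pderiv v"
    using key[OF derivation_pderiv y] unfolding a'_def b'_def by (simp only: pderiv_Y mult_1_right)
  have "?E B * pderiv v = 0" "?E B * pderiv u = 0"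
    using e1 e2 J unfolding jac_def by algebra+
  with B have "pderiv v = 0" "pderiv u = 0" by auto
  with e3 B show False by simp
qed

definition inverse_pair where
  "inverse_pair u v f g \<longleftrightarrow> endo u v f = X \<and> endo u v g = Y \<and> endo f g u = X \<and> endo f g v = Y"

lemma inverse_pair_bij: assumes "inverse_pair u v f g" shows "bij (endo u v)"
proof (rule o_bij)
  show "endo f g \<circ> endo u v = id" "endo u v \<circ> endo f g = id"
    using assms unfolding inverse_pair_def by (simp_all only: endo_comp endo_X_Y)
qed

lemma surj_inj_inverse_pair:
  assumes "endo u v f = X" "endo u v g = Y" "inj (endo u v)" shows "inverse_pair u v f g"
proof -
  have "endo u v (endo f g p) = p" for p unfolding endo_endo assms(1,2) by simp
  then have "endo u v (endo f g u) = endo u v X" "endo u v (endo f g v) = endo u v Y"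
    by (simp_all only: endo_X endo_Y)
  with assms show ?thesis unfolding inverse_pair_def by (simp only: inj_eq)
qed

lemma inverse_pair_ex: assumes "bij (endo u v)" shows "\<exists>f g. inverse_pair u v f g"
  using surj_inj_inverse_pair assms by (metis bij_def surjD)

lemma inverse_pair_sym: "inverse_pair u v f g \<Longrightarrow> inverse_pair f g u v"
  unfolding inverse_pair_def by blast

lemma jac_nonzero_inj:
  fixes u v :: "'k::field_char_0 poly poly"
  assumes "jac u v \<noteq> 0" shows "inj (endo u v)"
proof (rule injI)
  fix p q assume "endo u v p = endo u v q"
  then have "endo u v (p - q) = 0" by (simp add: endo_hom)
  then show "p = q" using jac_nonzero_injective[OF assms, of "p - q"] by simp
qed

lemma jac_nonzero_inverse_pair:
  fixes u v :: "'k::field_char_0 poly poly"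
  assumes "endo u v f = X" "endo u v g = Y" "jac u v \<noteq> 0" shows "inverse_pair u v f g"
  by (rule surj_inj_inverse_pair assms jac_nonzero_inj)+

text \<open>The Jacobians of two inverse mappings multiply to 1, so both are units.\<close>

lemma inverse_pair_jac:
  assumes "inverse_pair u v f g" obtains a where "a \<noteq> 0" "jac u v = const2 a"
proof -
  have "endo f g (jac u v) * jac f g = 1"
    using assms unfolding inverse_pair_def by (metis jac_endo jac_X_Y)
  then obtain a where a: "a \<noteq> 0" "endo f g (jac u v) = const2 a" by (rule dvd_one_const2)
  have "jac u v = endo u v (endo f g (jac u v))"
    using assms unfolding inverse_pair_def by (simp add: endo_endo)
  then have "jac u v = const2 a" by (simp only: a endo_hom)
  with a that show ?thesis by blast
qed


section \<open>Divisors of a polynomial through the Kronecker substitution\<close>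

text \<open>Under the substitution \<open>x = t\<^sup>N, y = t\<close> the monomial \<open>x\<^sup>i y\<^sup>j\<close> with \<open>j < N\<close> becomes the power of \<open>t\<close> with
  exponent \<open>N i + j\<close>.  Division with remainder by \<open>N\<close> recovers \<open>i\<close> and \<open>j\<close>, so nothing is lost if the
  degree in \<open>y\<close> is less than \<open>N\<close>.  This is the degree of a polynomial over \<open>K[x]\<close>, and divisors do not
  exceed it.\<close>

definition kron_const :: "nat \<Rightarrow> 'k::field poly \<Rightarrow> 'k poly" where
  "kron_const N q = poly (map_poly (\<lambda>a. [:a:]) q) (monom 1 N)"

definition kron :: "nat \<Rightarrow> 'k::field poly poly \<Rightarrow> 'k poly" where
  "kron N p = poly (map_poly (kron_const N) p) [:0, 1:]"

lemma kron_const_hom: "kron_const N 0 = 0" "kron_const N (p + q) = kron_const N p + kron_const N q"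
  "kron_const N (p * q) = kron_const N p * kron_const N q"
  unfolding kron_const_def by (simp, (rule poly_map_poly_hom; simp)+)

lemma kron_hom: "kron N (p + q) = kron N p + kron N q" "kron N (p * q) = kron N p * kron N q"
  unfolding kron_def by (rule poly_map_poly_hom kron_const_hom)+

lemma kron_const2: "kron N (const2 a) = [:a:]"
  by (simp add: kron_def kron_const_def map_poly_pCons kron_const_hom)

lemma coeff_kron_const:
  assumes "N > 0" shows "coeff (kron_const N q) m = (if N dvd m then coeff q (m div N) else 0)"
proof (induction q arbitrary: m)
  case 0
  then show ?case by (simp add: kron_const_hom)
next
  case (pCons a q)
  have eq: "kron_const N (pCons a q) = [:a:] + monom 1 N * kron_const N q"
    by (simp add: kron_const_def map_poly_pCons)
  show ?case
  proof (cases "m < N")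
    case True
    then show ?thesis unfolding eq using assms
      by (cases m) (auto simp: coeff_monom_mult dvd_imp_le)
  next
    case False
    then have "N dvd m \<longleftrightarrow> N dvd m - N" "m div N = Suc ((m - N) div N)"
      using assms by (simp_all add: dvd_minus_self le_div_geq)
    moreover from False assms obtain k where "m = Suc k" by (cases m) auto
    ultimately show ?thesis unfolding eq using False pCons.IH[of "m - N"]
      by (auto simp: coeff_monom_mult coeff_pCons split: nat.split)
  qed
qed

lemma coeff_kron:
  assumes "degree p < N" shows "coeff (kron N p) m = coeff (coeff p (m mod N)) (m div N)"
proof -
  have N: "N > 0" using assms by simp
  have "kron N p = (\<Sum>j\<le>degree (map_poly (kron_const N) p). kron_const N (coeff p j) * [:0, 1:] ^ j)"
    unfolding kron_def poly_altdef by (simp add: coeff_map_poly kron_const_hom)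
  also have "\<dots> = (\<Sum>j<N. kron_const N (coeff p j) * [:0, 1:] ^ j)"
  proof (rule sum.mono_neutral_left)
    show "{..degree (map_poly (kron_const N) p)} \<subseteq> {..<N}"
      using assms map_poly_degree_leq[of "kron_const N" p] by (auto simp: kron_const_hom)
    show "\<forall>j\<in>{..<N} - {..degree (map_poly (kron_const N) p)}. kron_const N (coeff p j) * [:0, 1:] ^ j = 0"
    proof
      fix j assume "j \<in> {..<N} - {..degree (map_poly (kron_const N) p)}"
      then have "coeff (map_poly (kron_const N) p) j = 0" by (intro coeff_eq_0) auto
      then show "kron_const N (coeff p j) * [:0, 1:] ^ j = 0" by (simp add: coeff_map_poly kron_const_hom)
    qed
  qed simp
  finally have "coeff (kron N p) m = (\<Sum>j<N. coeff (monom 1 j * kron_const N (coeff p j)) m)"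
    by (simp add: coeff_sum monom_altdef mult.commute)
  also have "\<dots> = (\<Sum>j<N. if j = m mod N then coeff (coeff p (m mod N)) (m div N) else 0)"
  proof (rule sum.cong)
    fix j assume j: "j \<in> {..<N}"
    show "coeff (monom 1 j * kron_const N (coeff p j)) m =
        (if j = m mod N then coeff (coeff p (m mod N)) (m div N) else 0)"
    proof (cases "j = m mod N")
      case True
      then have "j \<le> m" "N dvd m - j" "(m - j) div N = m div N"
        by (simp_all add: minus_mod_eq_mult_div N)
      moreover have "\<not> m < m mod N" by (simp add: not_less)
      ultimately show ?thesis using N True by (simp add: coeff_monom_mult coeff_kron_const)
    next
      case False
      have "\<not> (j \<le> m \<and> N dvd m - j)"
      proof
        assume *: "j \<le> m \<and> N dvd m - j"
        then have "m mod N = j mod N" by (metis mod_eq_dvd_iff_nat)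
        with False j show False by simp
      qed
      with False N show ?thesis by (auto simp: coeff_monom_mult coeff_kron_const)
    qed
  qed simp
  also have "\<dots> = coeff (coeff p (m mod N)) (m div N)" using N by simp
  finally show ?thesis .
qed

lemma kron_inj:
  assumes "degree p < N" "degree q < N" "kron N p = kron N q" shows "p = q"
proof (rule poly_eqI, rule poly_eqI)
  fix j i
  have N: "N > 0" using assms by simp
  show "coeff (coeff p j) i = coeff (coeff q j) i"
  proof (cases "j < N")
    case True
    then have "(N * i + j) mod N = j" "(N * i + j) div N = i" by simp_all
    with coeff_kron[OF assms(1), of "N * i + j"] coeff_kron[OF assms(2), of "N * i + j"] assms(3)
    show ?thesis by simp
  next
    case False
    with assms show ?thesis by (simp add: coeff_eq_0)
  qed
qed

lemma kron_surj:
  assumes "N > 0" shows "\<exists>p. degree p < N \<and> kron N p = g"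
proof -
  define p where "p = Poly (map (\<lambda>j. Poly (map (\<lambda>i. coeff g (N * i + j)) [0..<Suc (degree g)])) [0..<N])"
  have "degree p < N"
  proof -
    have "coeff p j = 0" if "j \<ge> N" for j using that by (simp add: p_def nth_default_def)
    then have "degree p \<le> N - 1" using assms by (intro degree_le) auto
    with assms show ?thesis by simp
  qed
  moreover have "kron N p = g"
  proof (rule poly_eqI)
    fix m
    have "coeff (kron N p) m = coeff (coeff p (m mod N)) (m div N)" by (rule coeff_kron) fact
    also have "\<dots> = (if m div N \<le> degree g then coeff g m else 0)"
      using assms by (simp add: p_def nth_default_def less_Suc_eq_le del: upt_Suc)
    also have "\<dots> = coeff g m"
    proof (cases "m div N \<le> degree g")
      case False
      then have "degree g < m" using div_le_dividend[of m N] by linarith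
      with False show ?thesis by (simp add: coeff_eq_0)
    qed simp
    finally show "coeff (kron N p) m = coeff g m" .
  qed
  ultimately show ?thesis by blast
qed

abbreviation linprod :: "'k::field list \<Rightarrow> 'k poly" where "linprod rs \<equiv> (\<Prod>r\<leftarrow>rs. [:- r, 1:])"

text \<open>Linear factors are prime: each of them divides either \<open>d\<close> or the cofactor of \<open>d\<close>.\<close>

lemma dvd_prod_linear:
  assumes "d dvd linprod rs"
  shows "\<exists>S\<in>set (subseqs rs). \<exists>a::'k::field. d = smult a (linprod S)"
  using assms
proof (induction rs arbitrary: d)
  case Nil
  then have "is_unit d" by simp
  then obtain a where "d = [:a:]" by (metis is_unit_polyE)
  then show ?case by simp
next
  case (Cons r rs)
  let ?l = "[:- r, 1:]" and ?R = "linprod rs"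
  from Cons.prems obtain e where e: "?l * ?R = d * e" by (auto elim: dvdE)
  show ?case
  proof (cases "?l dvd d")
    case True
    then obtain d' where d: "d = ?l * d'" ..
    with e have "?l * ?R = ?l * (d' * e)" by (simp only: mult.assoc)
    moreover have "?l \<noteq> 0" by simp
    ultimately have "?R = d' * e" by (metis mult_left_cancel)
    then obtain S a where "S \<in> set (subseqs rs)" "d' = smult a (linprod S)"
      using Cons.IH by (metis dvd_triv_left)
    then show ?thesis using d
      by (intro bexI[of _ "r # S"] exI[of _ a]) (simp_all add: Let_def mult.commute del: mult_pCons_left)
  next
    case False
    have "prime_elem ?l" by (rule prime_elem_linear_field_poly) simp
    moreover have "?l dvd d * e" using e by (metis dvd_triv_left)
    ultimately have "?l dvd e" using False by (metis prime_elem_dvd_mult_iff)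
    then obtain e' where e': "e = ?l * e'" ..
    with e have "?l * ?R = ?l * (d * e')" by (simp only: mult.left_commute)
    moreover have "?l \<noteq> 0" by simp
    ultimately have "?R = d * e'" by (metis mult_left_cancel)
    then obtain S a where "S \<in> set (subseqs rs)" "d = smult a (linprod S)"
      using Cons.IH by (metis dvd_triv_left)
    then show ?thesis by (intro bexI[of _ S]) (auto simp: Let_def)
  qed
qed

text \<open>The image of a divisor of \<open>B\<close> divides the image of \<open>B\<close>, so it is a product of some of the linear factors
  up to a constant; injectivity of the substitution then determines the divisor itself.\<close>

lemma divisor_candidate:
  assumes B: "B \<noteq> 0" and roots: "kron (Suc (degree B)) B = smult b (linprod rs)" and p: "p dvd B"
  obtains S a where "S \<in> set (subseqs rs)" "a \<noteq> 0"
    "\<And>p'. degree p' < Suc (degree B) \<Longrightarrow> kron (Suc (degree B)) p' = linprod S \<Longrightarrow> p = const2 a * p'"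
proof -
  let ?N = "Suc (degree B)"
  have deg: "degree p < ?N" using dvd_imp_degree_le[OF p B] by simp
  have nz: "kron ?N q \<noteq> 0" if "q \<noteq> 0" "degree q < ?N" for q
    using kron_inj[of q ?N 0] that by (auto simp: kron_def)
  have "b \<noteq> 0" using nz[OF B] roots by auto
  from p obtain q where q: "B = p * q" ..
  have "kron ?N p dvd kron ?N B" unfolding q kron_hom by simp
  then have "kron ?N p dvd linprod rs"
    unfolding roots using \<open>b \<noteq> 0\<close> by (simp add: dvd_smult_iff)
  then obtain S a where S: "S \<in> set (subseqs rs)" "kron ?N p = smult a (linprod S)"
    using dvd_prod_linear by blast
  have "p \<noteq> 0" using q B by auto
  then have "a \<noteq> 0" using nz[OF _ deg] S(2) by auto
  show ?thesis
  proof (rule that[OF S(1) \<open>a \<noteq> 0\<close>])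
    fix p' assume p': "degree p' < ?N" "kron ?N p' = linprod S"
    have "degree (const2 a * p') < ?N" using p'(1) degree_smult_le[of "[:a:]" p'] by simp
    moreover have "kron ?N p = kron ?N (const2 a * p')" unfolding kron_hom kron_const2 by (simp add: S p')
    ultimately show "p = const2 a * p'" using kron_inj[OF deg] by blast
  qed
qed


section \<open>Certificates of unsolvability for linear equations\<close>

definition linear_endo :: "('k::field poly poly \<Rightarrow> 'k poly poly) \<Rightarrow> bool" where
  "linear_endo L \<longleftrightarrow> (\<forall>p q. L (p + q) = L p + L q) \<and> (\<forall>a p. L (const2 a * p) = const2 a * L p)"

lemma linear_endo_sum:
  assumes "linear_endo L" shows "L (\<Sum>i\<in>I. h i) = (\<Sum>i\<in>I. L (h i))"
proof -
  have "L 0 = 0" using assms unfolding linear_endo_def by (metis add_cancel_right_right)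
  with assms show ?thesis
    by (induction I rule: infinite_finite_induct) (simp_all add: linear_endo_def)
qed

text \<open>The coefficients of \<open>\<Lambda>\<close> are the values of a linear functional at the monomials, which vanishes at all
  monomials of large degree.\<close>

definition ip :: "'k::field poly poly \<Rightarrow> 'k poly poly \<Rightarrow> 'k" where
  "ip \<Lambda> p = (\<Sum>j<Suc (degree \<Lambda>). \<Sum>i<Suc (degree (coeff \<Lambda> j)). coeff (coeff \<Lambda> j) i * coeff (coeff p j) i)"

lemma ip_add: "ip \<Lambda> (p + q) = ip \<Lambda> p + ip \<Lambda> q"
  by (simp add: ip_def distrib_left sum.distrib)

lemma ip_const2_mult: "ip \<Lambda> (const2 a * p) = a * ip \<Lambda> p"
  by (simp add: ip_def sum_distrib_left mult.left_commute del: sum.lessThan_Suc)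

lemma ip_0 [simp]: "ip \<Lambda> 0 = 0"
  by (simp add: ip_def)

lemma ip_sum: "ip \<Lambda> (\<Sum>i\<in>I. h i) = (\<Sum>i\<in>I. ip \<Lambda> (h i))"
  by (induction I rule: infinite_finite_induct) (simp_all add: ip_add)

lemma ip_box:
  assumes "degree \<Lambda> < M" "degx \<Lambda> < M"
  shows "ip \<Lambda> p = (\<Sum>j<M. \<Sum>i<M. coeff (coeff \<Lambda> j) i * coeff (coeff p j) i)"
proof -
  have "(\<Sum>i<Suc (degree (coeff \<Lambda> j)). coeff (coeff \<Lambda> j) i * coeff (coeff p j) i) =
      (\<Sum>i<M. coeff (coeff \<Lambda> j) i * coeff (coeff p j) i)" for j
    using degree_coeff_le_degx[of \<Lambda> j] assms(2)
    by (intro sum.mono_neutral_left) (auto simp: coeff_eq_0)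
  then show ?thesis
    unfolding ip_def using assms(1)
    by (simp del: sum.lessThan_Suc) (intro sum.mono_neutral_left, auto simp: coeff_eq_0)
qed

text \<open>A linear functional certifies that a vector does not lie in the span of finitely many others;
  only finitely many coordinates matter, so a polynomial can record it.\<close>

lemma functional_certificate_span:
  fixes t :: "'k::field poly poly"
  assumes G: "finite G" and t: "\<And>f. t \<noteq> (\<Sum>g\<in>G. const2 (f g) * g)"
  shows "\<exists>\<Lambda>. (\<forall>g\<in>G. ip \<Lambda> g = 0) \<and> ip \<Lambda> t \<noteq> 0"
proof -
  let ?s = "\<lambda>(a::'k) p. const2 a * p"
  interpret V: vector_space ?s
  proof
    fix a b :: 'k and p q :: "'k poly poly"
    have "const2 (a + b) = const2 a + const2 b" by simp
    then show "const2 (a + b) * p = const2 a * p + const2 b * p" by (simp only: distrib_right)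
    show "const2 1 * p = p" by (simp only: one_pCons[symmetric] mult_1_left)
    show "const2 a * (p + q) = const2 a * p + const2 a * q" by (rule distrib_left)
    show "const2 a * (const2 b * p) = const2 (a * b) * p" by simp
  qed
  interpret K: vector_space "(*) :: 'k \<Rightarrow> 'k \<Rightarrow> 'k"
    by unfold_locales (simp_all add: algebra_simps)
  interpret VK: vector_space_pair ?s "(*) :: 'k \<Rightarrow> 'k \<Rightarrow> 'k" ..
  have "t \<notin> V.span G" unfolding V.span_finite[OF G] using t by blast
  obtain B where B: "B \<subseteq> G" "V.independent B" "G \<subseteq> V.span B"
    using V.maximal_independent_subset[of G] by blast
  have "t \<notin> V.span B" using \<open>t \<notin> V.span G\<close> V.span_mono[OF B(1)] by blast
  then have "V.independent (insert t B)" using B(2) by (rule V.independent_insertI)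
  then obtain h where h: "Vector_Spaces.linear ?s (*) h" "\<forall>x\<in>insert t B. h x = (if x = t then 1 else 0)"
    using VK.linear_independent_extend[of "insert t B" "\<lambda>x. if x = t then 1 else 0"] by blast
  interpret h: Vector_Spaces.linear ?s "(*)" h by (rule h(1))
  have "t \<notin> B" using \<open>t \<notin> V.span B\<close> V.span_base by blast
  then have hB: "h x = 0" if "x \<in> B" for x using h(2) that by auto
  have hG: "h g = 0" if "g \<in> G" for g
    using VK.linear_eq_0_on_span[OF h(1), of B g] hB B(3) that by blast
  obtain M where M: "\<forall>g\<in>insert t G. degree g < M \<and> degx g < M"
  proof -
    have "finite ((\<lambda>g. degree g + degx g) ` insert t G)" using G by simp
    then obtain M where "\<forall>n\<in>(\<lambda>g. degree g + degx g) ` insert t G. n \<le> M"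
      using finite_nat_set_iff_bounded_le by blast
    then show ?thesis using that[of "Suc M"] by force
  qed
  define \<Lambda> where "\<Lambda> = Poly (map (\<lambda>j. Poly (map (\<lambda>i. h (X ^ i * Y ^ j)) [0..<M])) [0..<M])"
  have "M > 0" using M by auto
  have c\<Lambda>: "coeff (coeff \<Lambda> j) i = (if j < M \<and> i < M then h (X ^ i * Y ^ j) else 0)" for i j
    by (simp add: \<Lambda>_def nth_default_def)
  have "degree \<Lambda> \<le> M - 1"
  proof (intro degree_le allI impI)
    fix j assume "M - 1 < j"
    then have "\<not> j < M" by linarith
    then show "coeff \<Lambda> j = 0" by (intro poly_eqI) (simp add: c\<Lambda>)
  qed
  moreover have "degx \<Lambda> \<le> M - 1"
    unfolding degx_le_iff
  proof (intro allI degree_le impI)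
    fix j i assume "M - 1 < i"
    then have "\<not> i < M" by linarith
    then show "coeff (coeff \<Lambda> j) i = 0" by (simp add: c\<Lambda>)
  qed
  ultimately have box: "degree \<Lambda> < M" "degx \<Lambda> < M" using \<open>M > 0\<close> by simp_all
  have ip: "ip \<Lambda> p = h p" if "degree p < M" "degx p < M" for p
  proof -
    have "h p = h (\<Sum>j<M. \<Sum>i<M. const2 (coeff (coeff p j) i) * (X ^ i * Y ^ j))"
      using poly2_as_sum[OF that] by (rule arg_cong)
    also have "\<dots> = (\<Sum>j<M. \<Sum>i<M. coeff (coeff p j) i * h (X ^ i * Y ^ j))"
      by (simp only: h.sum h.scale)
    also have "\<dots> = ip \<Lambda> p" unfolding ip_box[OF box]
      by (intro sum.cong refl) (simp only: c\<Lambda> lessThan_iff mult.commute, simp)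
    finally show ?thesis ..
  qed
  have "ip \<Lambda> g = 0" if "g \<in> G" for g using ip M hG that by simp
  moreover have "ip \<Lambda> t \<noteq> 0" using ip M h(2) by simp
  ultimately show ?thesis by blast
qed

text \<open>The vector \<open>z\<close> admits an additional unknown scalar: with \<open>z = 1\<close> the equation is solved up to a
  constant, with \<open>z = 0\<close> exactly.\<close>

lemma functional_certificate_complete:
  assumes L: "linear_endo L" and none: "\<And>q a. t \<noteq> L q + const2 a * z"
  shows "\<exists>\<Lambda>. (\<forall>i<N. \<forall>j<N. ip \<Lambda> (L (X ^ i * Y ^ j)) = 0) \<and> ip \<Lambda> z = 0 \<and> ip \<Lambda> t \<noteq> 0"
proof -
  let ?G = "(\<lambda>ij. L (X ^ fst ij * Y ^ snd ij)) ` ({..<N} \<times> {..<N})"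
  have "t \<noteq> (\<Sum>g\<in>insert z ?G. const2 (f g) * g)" for f
  proof
    assume t: "t = (\<Sum>g\<in>insert z ?G. const2 (f g) * g)"
    have "\<exists>q. const2 (f g) * g = L q" if "g \<in> ?G" for g
    proof -
      from that obtain i j where "g = L (X ^ i * Y ^ j)" by blast
      then have "const2 (f g) * g = L (const2 (f g) * (X ^ i * Y ^ j))"
        using L unfolding linear_endo_def by metis
      then show ?thesis by blast
    qed
    then have "\<forall>g\<in>?G. \<exists>q. const2 (f g) * g = L q" by blast
    from bchoice[OF this] obtain q where q: "\<forall>g\<in>?G. const2 (f g) * g = L (q g)" ..
    have "(\<Sum>g\<in>?G - {z}. const2 (f g) * g) = L (\<Sum>g\<in>?G - {z}. q g)"
      unfolding linear_endo_sum[OF L] using q by (intro sum.cong refl) blast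
    moreover have "finite ?G" by (intro finite_imageI finite_cartesian_product finite_lessThan)
    from sum.insert_remove[OF this, of "\<lambda>g. const2 (f g) * g" z]
    have "t = const2 (f z) * z + (\<Sum>g\<in>?G - {z}. const2 (f g) * g)" by (simp only: t)
    ultimately have "t = L (\<Sum>g\<in>?G - {z}. q g) + const2 (f z) * z" by (simp only: add.commute)
    with none show False by blast
  qed
  then obtain \<Lambda> where "\<forall>g\<in>insert z ?G. ip \<Lambda> g = 0" "ip \<Lambda> t \<noteq> 0"
    using functional_certificate_span[of "insert z ?G" t] by blast
  moreover have "L (X ^ i * Y ^ j) \<in> ?G" if "i < N" "j < N" for i j
    using that by (intro image_eqI[of _ _ "(i, j)"]) simp_all
  ultimately show ?thesis by (intro exI[of _ \<Lambda>]) blast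
qed

lemma functional_certificate_sound:
  assumes L: "linear_endo L" and \<Lambda>: "\<forall>i<N. \<forall>j<N. ip \<Lambda> (L (X ^ i * Y ^ j)) = 0"
    and q: "degree q < N" "degx q < N"
  shows "ip \<Lambda> (L q) = 0"
proof -
  have "ip \<Lambda> (L q) = ip \<Lambda> (L (\<Sum>j<N. \<Sum>i<N. const2 (coeff (coeff q j) i) * (X ^ i * Y ^ j)))"
    using poly2_as_sum[OF q] by (rule arg_cong)
  also have "\<dots> = (\<Sum>j<N. \<Sum>i<N. ip \<Lambda> (L (const2 (coeff (coeff q j) i) * (X ^ i * Y ^ j))))"
    by (simp only: linear_endo_sum[OF L] ip_sum)
  also have "\<dots> = (\<Sum>j<N. \<Sum>i<N. coeff (coeff q j) i * ip \<Lambda> (L (X ^ i * Y ^ j)))"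
    using L unfolding linear_endo_def by (simp only: ip_const2_mult)
  also have "\<dots> = 0" using \<Lambda> by simp
  finally show ?thesis .
qed

lemma linear_endo_endo: "linear_endo (endo u v)"
  by (simp only: linear_endo_def endo_hom, blast)

lemma linear_endo_jac: "linear_endo (jac p)"
  unfolding linear_endo_def using derivationD[OF derivation_jac] by blast

lemma linear_endo_mult: "linear_endo ((*) w)"
  unfolding linear_endo_def by (simp add: algebra_simps)


section \<open>Coordinates of the affine plane\<close>

subsection \<open>Degrees of the inverse of an automorphism\<close>

definition ev :: "'k::field poly poly \<Rightarrow> 'k \<Rightarrow> 'k \<Rightarrow> 'k" where
  "ev F a b = poly (poly F [:b:]) a"

lemma ev_endo: "ev (endo u v F) a b = ev F (ev u a b) (ev v a b)"
proof (induction F rule: poly2_induct)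
  case (const a)
  show ?case by (simp only: endo_hom) (simp add: ev_def)
next
  case X
  show ?case unfolding endo_X by (simp add: ev_def)
next
  case Y
  show ?case unfolding endo_Y by (simp add: ev_def)
qed (simp_all add: endo_hom ev_def)

lemma ev_X: "ev X a b = a" and ev_Y: "ev Y a b = b"
  by (simp_all add: ev_def)

lemma poly_map_poly_ev: "poly (map_poly (\<lambda>q. poly q a) F) b = ev F a b"
  by (induction F) (simp_all add: ev_def map_poly_pCons)

text \<open>Splitting off one linear factor removes exactly one root, because the root is simple.\<close>

lemma card_simple_roots:
  fixes h :: "'k::alg_closed_field poly"
  assumes "h \<noteq> 0" "\<And>t. poly h t = 0 \<Longrightarrow> poly (pderiv h) t \<noteq> 0"
  shows "card {t. poly h t = 0} = degree h"
  using assms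
proof (induction "degree h" arbitrary: h)
  case 0
  then obtain a where "h = [:a:]" "a \<noteq> 0" by (metis degree_eq_zeroE pCons_eq_0_iff)
  then show ?case by simp
next
  case (Suc n)
  then obtain r where r: "poly h r = 0" using alg_closed_imp_poly_has_root[of h] by auto
  then obtain g where h: "h = [:- r, 1:] * g" by (metis dvdE poly_eq_0_iff_dvd)
  have "g \<noteq> 0" using h Suc.prems by auto
  have d: "pderiv h = g + [:- r, 1:] * pderiv g"
    unfolding h pderiv_mult by (simp add: pderiv_pCons)
  have deg: "degree h = Suc (degree g)" unfolding h using \<open>g \<noteq> 0\<close> by (subst degree_mult_eq) auto
  have "poly g r \<noteq> 0" using Suc.prems(2)[OF r] by (simp add: d)
  have "card {t. poly g t = 0} = degree g"
  proof (rule Suc.hyps(1))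
    show "n = degree g" using deg Suc.hyps(2) by simp
    fix t assume t: "poly g t = 0"
    then have "poly h t = 0" by (simp add: h)
    from Suc.prems(2)[OF this] t show "poly (pderiv g) t \<noteq> 0" by (auto simp: d)
  qed fact
  moreover have "{t. poly h t = 0} = insert r {t. poly g t = 0}" by (auto simp: h)
  moreover have "finite {t. poly g t = 0}" using \<open>g \<noteq> 0\<close> by (rule poly_roots_finite)
  ultimately show ?case using \<open>poly g r \<noteq> 0\<close> deg by simp
qed

text \<open>Let \<open>m\<close> be the degree in \<open>y\<close> of the first component \<open>f\<close> of the inverse of \<open>(p, q)\<close>.  For generic
  constants the lines \<open>x = c\<^sub>0\<close> and \<open>x = x\<^sub>0\<close> are such that the first one has exactly \<open>m\<close> points which
  the inverse maps to the second one.  The images are distinct zeros of \<open>p(x\<^sub>0, y) - c\<^sub>0\<close>.\<close>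

lemma inverse_pair_degree_le:
  fixes p q f g :: "'k::{alg_closed_field, field_char_0} poly poly"
  assumes inv: "inverse_pair p q f g" shows "degree f \<le> degree p"
proof (cases "degree f = 0")
  case False
  have fgp: "endo f g p = X" and fgq: "endo f g q = Y"
    using inv unfolding inverse_pair_def by blast+
  have "lead_coeff f \<noteq> 0" using False by auto
  then obtain c0 where c0: "poly (lead_coeff f) c0 \<noteq> 0"
    using poly_all_0_iff_0 by blast
  define h where "h = map_poly (\<lambda>q. poly q c0) f"
  have ch: "coeff h i = poly (coeff f i) c0" for i by (simp add: h_def coeff_map_poly)
  have dh: "degree h = degree f"
  proof (rule antisym)
    show "degree h \<le> degree f" by (rule degree_le) (simp add: ch coeff_eq_0)
    show "degree f \<le> degree h" by (rule le_degree) (simp add: ch c0)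
  qed
  have "pderiv h \<noteq> 0" using dh False by (simp add: pderiv_eq_0_iff)
  define r where "r = p - const2 c0"
  have "r \<noteq> 0"
  proof
    assume "r = 0"
    then have "p = const2 c0" by (simp add: r_def)
    then have "X = const2 c0" using fgp endo_hom(3) by metis
    then show False by simp
  qed
  then obtain k where k: "coeff r k \<noteq> 0" by (metis leading_coeff_0_iff)
  \<comment> \<open>Avoid the critical values of \<open>h\<close>, so that all points of the fibre are simple, and the values for
    which \<open>p(x\<^sub>0, y) - c\<^sub>0\<close> vanishes identically.\<close>
  have "finite (poly h ` {t. poly (pderiv h) t = 0} \<union> {x. poly (coeff r k) x = 0})"
    using poly_roots_finite[OF \<open>pderiv h \<noteq> 0\<close>] poly_roots_finite[OF k] by simp
  then obtain x0 where x0: "x0 \<notin> poly h ` {t. poly (pderiv h) t = 0} \<union> {x. poly (coeff r k) x = 0}"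
    using ex_new_if_finite[OF infinite_UNIV_char_0] by blast
  define H where "H = h - [:x0:]"
  have dH: "degree H = degree f"
  proof -
    have "degree (h + [:- x0:]) = degree h" by (rule degree_add_eq_left) (use dh False in simp)
    moreover have "H = h + [:- x0:]" by (simp add: H_def)
    ultimately show ?thesis using dh by simp
  qed
  have "card {t. poly H t = 0} = degree H"
  proof (rule card_simple_roots)
    show "H \<noteq> 0" using dH False by auto
    show "poly (pderiv H) t \<noteq> 0" if "poly H t = 0" for t
      using that x0 by (auto simp: H_def pderiv_diff pderiv_pCons)
  qed
  define \<psi> where "\<psi> = map_poly (\<lambda>q. poly q x0) r"
  have c\<psi>: "coeff \<psi> i = poly (coeff r i) x0" for i by (simp add: \<psi>_def coeff_map_poly)
  have "\<psi> \<noteq> 0" using x0 c\<psi>[of k] by auto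
  have root: "poly h t = ev f c0 t" for t by (simp add: h_def poly_map_poly_ev)
  have "inj_on (ev g c0) {t. poly H t = 0}"
  proof (rule inj_onI)
    fix s t assume *: "s \<in> {t. poly H t = 0}" "t \<in> {t. poly H t = 0}" "ev g c0 s = ev g c0 t"
    then have "ev q (ev f c0 s) (ev g c0 s) = ev q (ev f c0 t) (ev g c0 t)"
      by (simp add: H_def root)
    then show "s = t" unfolding ev_endo[symmetric] fgq ev_Y .
  qed
  moreover have "ev g c0 ` {t. poly H t = 0} \<subseteq> {y. poly \<psi> y = 0}"
  proof clarify
    fix t assume "poly H t = 0"
    then have "ev p x0 (ev g c0 t) = ev (endo f g p) c0 t" by (simp add: H_def root ev_endo)
    also have "\<dots> = c0" unfolding fgp by (rule ev_X)
    finally show "poly \<psi> (ev g c0 t) = 0"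
      unfolding \<psi>_def poly_map_poly_ev by (simp add: r_def ev_def)
  qed
  ultimately have "card {t. poly H t = 0} \<le> card {y. poly \<psi> y = 0}"
    using card_inj_on_le poly_roots_finite[OF \<open>\<psi> \<noteq> 0\<close>] by blast
  also have "\<dots> \<le> degree \<psi>" using \<open>\<psi> \<noteq> 0\<close> by (rule card_poly_roots_bound)
  also have "\<dots> \<le> degree r" by (rule degree_le) (simp add: c\<psi> coeff_eq_0)
  also have "\<dots> \<le> degree p" unfolding r_def by (rule degree_diff_le) simp_all
  finally show ?thesis using \<open>card {t. poly H t = 0} = degree H\<close> dH by simp
qed simp

text \<open>Exchanging the variables in the source or in the target turns the bound for one degree of the inverse
  into the bounds for the other three.\<close>

lemma inverse_pair_flip:
  assumes "inverse_pair p q f g"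
  shows "inverse_pair q p (swap f) (swap g)" "inverse_pair (swap p) (swap q) g f"
proof -
  have e: "endo q p (swap F) = endo p q F" "swap (endo p q F) = endo (swap p) (swap q) F"
      "endo (swap f) (swap g) F = swap (endo f g F)" "endo g f (swap F) = endo f g F" for F
    by (simp_all only: endo_endo endo_X endo_Y)
  show "inverse_pair q p (swap f) (swap g)"
    using assms unfolding inverse_pair_def e(1,3) by (simp only: endo_X endo_Y simp_thms)
  show "inverse_pair (swap p) (swap q) g f"
    using assms unfolding inverse_pair_def e(4) e(2)[symmetric] by (simp only: endo_X endo_Y simp_thms)
qed

lemma inverse_pair_degrees:
  fixes p q f g :: "'k::{alg_closed_field, field_char_0} poly poly"
  assumes inv: "inverse_pair p q f g"
  shows "degree f \<le> degree p" "degx f \<le> degree q" "degree g \<le> degx p" "degx g \<le> degx q"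
proof -
  note 1 = inverse_pair_flip(1)[OF inv] and 2 = inverse_pair_flip(2)[OF inv]
  show "degree f \<le> degree p" by (rule inverse_pair_degree_le[OF inv])
  show "degx f \<le> degree q" using inverse_pair_degree_le[OF 1] by simp
  show "degree g \<le> degx p" using inverse_pair_degree_le[OF 2] by simp
  show "degx g \<le> degx q" using inverse_pair_degree_le[OF inverse_pair_flip(1)[OF 2]] by simp
qed


subsection \<open>Slices\<close>

lemma inverse_pair_scale:
  assumes "inverse_pair p q f g" "a \<noteq> 0" "b \<noteq> 0"
  shows "\<exists>f' g'. inverse_pair (const2 a * p) (const2 b * q) f' g'"
proof -
  have "inverse_pair (const2 a * X) (const2 b * Y) (const2 (1 / a) * X) (const2 (1 / b) * Y)"
    unfolding inverse_pair_def endo_hom endo_X endo_Y using assms by simp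
  then have "bij (endo p q \<circ> endo (const2 a * X) (const2 b * Y))"
    using assms(1) by (intro bij_comp inverse_pair_bij)
  moreover have "endo p q \<circ> endo (const2 a * X) (const2 b * Y) = endo (const2 a * p) (const2 b * q)"
    unfolding endo_comp endo_hom endo_X endo_Y ..
  ultimately show ?thesis using inverse_pair_ex by metis
qed

lemma pderiv_const_imp:
  assumes "pderiv (F :: 'k::field_char_0 poly poly) = const2 a"
  obtains b where "F = const2 a * Y + [:b:]"
proof -
  have "pderiv (F - const2 a * Y) = 0"
    unfolding pderiv_diff pderiv_mult pderiv_Y assms by (simp add: pderiv_pCons)
  then have "degree (F - const2 a * Y) = 0" by (simp add: pderiv_eq_0_iff)
  then obtain b where "F - const2 a * Y = [:b:]" by (rule degree_eq_zeroE)
  then have "F = const2 a * Y + [:b:]" by (simp only: diff_eq_eq add.commute)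
  with that show ?thesis by blast
qed

text \<open>For a coordinate \<open>p\<close> with partner \<open>q\<close> the derivation \<open>jac p\<close> is a multiple of the partial
  derivative with respect to \<open>q\<close>; hence slices differ from multiples of \<open>q\<close> by elements of \<open>K[p]\<close>.\<close>

lemma slice_unique:
  fixes p q :: "'k::field_char_0 poly poly"
  assumes inv: "inverse_pair p q f g" and s: "jac p s = 1"
  obtains a b where "a \<noteq> 0" "s = const2 a * q + endo p q [:b:]"
proof -
  obtain k where k: "k \<noteq> 0" "jac p q = const2 k" using inverse_pair_jac[OF inv] by blast
  define F where "F = endo f g s"
  have sF: "s = endo p q F"
    using inv unfolding F_def inverse_pair_def by (simp add: endo_endo)
  have "endo p q (pderiv F) * const2 k = 1"
    using s jac_endo_right[of p q F] k(2) by (simp only: sF)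
  then have "endo p q (pderiv F * const2 k) = 1" by (simp only: endo_hom)
  then have "pderiv F * const2 k = 1"
    using inverse_pair_bij[OF inv] by (metis bij_def endo_hom(5) inj_eq)
  then have "const2 (1 / k) * (const2 k * pderiv F) = const2 (1 / k)" by (simp only: mult.commute mult_1_left)
  moreover have "const2 (1 / k) * (const2 k * pderiv F) = pderiv F" using k by (simp add: pCons_one)
  ultimately have "pderiv F = const2 (1 / k)" by simp
  then obtain b where "F = const2 (1 / k) * Y + [:b:]" by (rule pderiv_const_imp)
  then have "s = const2 (1 / k) * q + endo p q [:b:]" by (simp only: sF endo_hom endo_Y)
  moreover have "1 / k \<noteq> 0" using k by simp
  ultimately show ?thesis using that by blast
qed

lemma degree_endo_inner: "degree (endo p q [:a:]) = degree a * degree p"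
  and degx_endo_inner: "degx (endo p q [:a:]) = degree a * degx p"
proof -
  have eq: "endo p q [:a:] = pcompose (map_poly (\<lambda>k. [:k:]) a) p" for p q :: "'a poly poly"
  proof (induction a)
    case (pCons k a)
    then show ?case
      unfolding endo_const_pCons[of _ _ k a] by (simp add: map_poly_pCons pcompose_pCons)
  qed (simp add: endo_hom)
  then show D: "degree (endo p q [:a:]) = degree a * degree p" for p q :: "'a poly poly"
    by (simp add: degree_pcompose degree_map_poly)
  have "swap (endo p q [:a:]) = endo (swap p) (swap q) [:a:]" by (simp only: endo_endo)
  then show "degx (endo p q [:a:]) = degree a * degx p"
    unfolding degx_def using D[of "swap p" "swap q"] by simp
qed

text \<open>Since \<open>jac p\<close> acts on \<open>K[p, q]\<close> as the partial derivative with respect to \<open>q\<close>, applying it \<open>n\<close> times to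
  a polynomial of degree \<open>n + 1\<close> in \<open>q\<close> leaves degree one, and each time the degrees in \<open>x\<close> and \<open>y\<close>
  grow by at most \<open>d\<close>.\<close>

lemma descent_to_degree_one:
  fixes p q :: "'k::field_char_0 poly poly"
  assumes J: "jac p q = 1" and d: "degree p \<le> d" "degx p \<le> d"
  shows "degree F = Suc n \<Longrightarrow> degree (endo p q F) \<le> L \<Longrightarrow> degx (endo p q F) \<le> L \<Longrightarrow>
    \<exists>a b. a \<noteq> 0 \<and> degree (endo p q [:b, a:]) \<le> L + n * d \<and> degx (endo p q [:b, a:]) \<le> L + n * d"
proof (induction n arbitrary: F L)
  case 0
  obtain b F' where F': "F = pCons b F'" by (cases F)
  then have "degree F' = 0" "F' \<noteq> 0" using 0 by (auto split: if_splits)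
  then obtain a where "F' = [:a:]" "a \<noteq> 0" by (auto elim: degree_eq_zeroE)
  with 0 F' show ?case by auto
next
  case (Suc n)
  have eq: "endo p q (pderiv F) = jac p (endo p q F)" by (simp add: jac_endo_right J)
  have "degree (pderiv F) = Suc n" using Suc.prems by (simp add: degree_pderiv)
  moreover have "degree (endo p q (pderiv F)) \<le> L + d" "degx (endo p q (pderiv F)) \<le> L + d"
    unfolding eq using degree_jac_le[of p "endo p q F"] degx_jac_le[of p "endo p q F"] Suc.prems d by linarith+
  ultimately obtain a b where "a \<noteq> 0" "degree (endo p q [:b, a:]) \<le> L + d + n * d"
      "degx (endo p q [:b, a:]) \<le> L + d + n * d" using Suc.IH by blast
  then show ?case by (intro exI[of _ a] exI[of _ b]) simp
qed

text \<open>The factor \<open>d\<^sup>2 + 1\<close> bounds the degree of a polynomial in \<open>p\<close> of which the value has degrees up to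
  \<open>d\<^sup>2 + 1\<close>; the factor \<open>d\<close> arises from inserting \<open>p\<close>.\<close>

definition slice_bound :: "'k::field poly poly \<Rightarrow> nat" where
  "slice_bound p = (let d = degree p + degx p in (d * d + 1) * d)"

text \<open>The descent produces an element \<open>z = a(p) q + b(p)\<close> of bounded degree with \<open>a \<noteq> 0\<close>.  Its derivative
  \<open>a(p)\<close> bounds the degree of \<open>a\<close>; replacing \<open>q\<close> by \<open>q + s(p)\<close>, where \<open>b = a s + r\<close> with remainder \<open>r\<close>,
  bounds the remaining term \<open>r(p)\<close> as well, and hence the degree of the new \<open>q\<close>.\<close>

lemma bounded_slice_exists:
  fixes p q f g :: "'k::{alg_closed_field, field_char_0} poly poly"
  assumes inv: "inverse_pair p q f g"
  shows "\<exists>s. jac p s = 1 \<and> degree s \<le> slice_bound p \<and> degx s \<le> slice_bound p"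
proof -
  obtain k where k: "k \<noteq> 0" "jac p q = const2 k" using inverse_pair_jac[OF inv] by blast
  \<comment> \<open>Normalise the Jacobian to 1, so that \<open>jac p\<close> is the partial derivative itself.\<close>
  define q' where "q' = const2 (1 / k) * q"
  have J: "jac p q' = 1"
    unfolding q'_def derivationD(6)[OF derivation_jac] k(2) using k(1) by (simp add: one_pCons)
  obtain f' g' where inv': "inverse_pair (const2 1 * p) q' f' g'"
    using inverse_pair_scale[OF inv, of 1 "1 / k"] k(1) unfolding q'_def by auto
  then have inv': "inverse_pair p q' f' g'" by (simp add: pCons_one)
  let ?E = "endo p q'"
  define d where "d = degree p + degx p"
  have dp: "degree p \<le> d" "degx p \<le> d" by (simp_all add: d_def)
  have EX: "?E f' = X" and EY: "?E g' = Y" using inv' unfolding inverse_pair_def by blast+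
  have dz: "degree (?E f') \<le> 1" "degx (?E f') \<le> 1" "degree (?E g') \<le> 1" "degx (?E g') \<le> 1"
    unfolding EX EY by simp_all
  have "degree f' \<noteq> 0 \<or> degree g' \<noteq> 0"
  proof (rule ccontr)
    assume "\<not> (degree f' \<noteq> 0 \<or> degree g' \<noteq> 0)"
    then have "pderiv f' = 0" "pderiv g' = 0" by (simp_all add: pderiv_eq_0_iff)
    then have "jac p X = 0" "jac p Y = 0" using jac_endo_right[of p q' f'] jac_endo_right[of p q' g'] EX EY
      by (simp_all add: endo_hom)
    then have "p = const2 0 \<or> dx p = 0 \<and> pderiv p = 0" unfolding jac_def by simp
    with J show False by (auto simp: jac_def dx_def endo_hom)
  qed
  then obtain F n where F: "degree F = Suc n" "Suc n \<le> d" "degree (?E F) \<le> 1" "degx (?E F) \<le> 1"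
    using dz inverse_pair_degrees[OF inv'] dp by (metis le_trans not0_implies_Suc)
  obtain a b where a: "a \<noteq> 0" and z: "degree (?E [:b, a:]) \<le> 1 + n * d" "degx (?E [:b, a:]) \<le> 1 + n * d"
    using descent_to_degree_one[OF J dp F(1,3,4)] by blast
  have "d \<ge> 1" using F(2) by simp
  have nd: "n * d + d \<le> d * d" using F(2) by (metis Suc_le_eq add.commute mult_Suc mult_le_mono1 F(2))
  have za: "?E [:a:] = jac p (?E [:b, a:])"
    unfolding jac_endo_right J by (simp add: pderiv_pCons)
  have "degree (?E [:a:]) \<le> 1 + d * d" "degx (?E [:a:]) \<le> 1 + d * d"
    unfolding za using degree_jac_le[of p "?E [:b, a:]"] degx_jac_le[of p "?E [:b, a:]"] z dp nd by linarith+
  then have "degree a * degree p \<le> 1 + d * d" "degree a * degx p \<le> 1 + d * d"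
    unfolding degree_endo_inner degx_endo_inner .
  moreover have "degree p \<ge> 1 \<or> degx p \<ge> 1" using \<open>d \<ge> 1\<close> unfolding d_def by linarith
  ultimately have da: "degree a \<le> 1 + d * d"
    by (metis le_trans mult.right_neutral mult_le_mono2)
  define s where "s = q' + ?E [:b div a:]"
  have "jac p s = 1"
    unfolding s_def derivationD(1)[OF derivation_jac] jac_endo_right J by (simp add: endo_hom)
  define B where "B = (d * d + 1) * d"
  have "[:b, a:] = [:a:] * (Y + [:b div a:]) + [:b mod a:]" by (simp add: mult.commute)
  then have split: "?E [:b, a:] = ?E [:a:] * s + ?E [:b mod a:]"
    unfolding s_def by (simp only: endo_hom endo_Y)
  have dr: "degree (b mod a) \<le> 1 + d * d"
    using degree_mod_less'[of a b] a da by (cases "b mod a = 0") auto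
  have r: "degree (?E [:b mod a:]) \<le> B" "degx (?E [:b mod a:]) \<le> B"
    unfolding degree_endo_inner degx_endo_inner B_def by (rule mult_le_mono; use dr dp in simp)+
  have "d * d + 1 \<le> B" unfolding B_def using \<open>d \<ge> 1\<close> by (metis mult.right_neutral mult_le_mono2)
  then have z': "degree (?E [:b, a:]) \<le> B" "degx (?E [:b, a:]) \<le> B" using z nd by linarith+
  have "?E [:a:] * s = ?E [:b, a:] - ?E [:b mod a:]" using split by simp
  then have as: "degree (?E [:a:] * s) \<le> B" "degx (?E [:a:] * s) \<le> B"
    using r z' by (simp_all add: degree_diff_le degx_diff_le)
  have "s \<noteq> 0" using \<open>jac p s = 1\<close> derivationD(4)[OF derivation_jac, of p] by auto
  moreover have "?E [:a:] \<noteq> 0"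
    using a inverse_pair_bij[OF inv'] by (metis bij_def endo_hom(4) inj_eq pCons_eq_0_iff)
  ultimately have "degree s \<le> B" "degx s \<le> B"
    using as degree_mult_eq[of "?E [:a:]" s] degx_mult[of "?E [:a:]" s] by simp_all
  with \<open>jac p s = 1\<close> show ?thesis unfolding slice_bound_def B_def d_def Let_def by blast
qed


section \<open>Factorisations with a given number of contractions\<close>

abbreviation tau :: "'k::field poly poly \<Rightarrow> 'k poly poly" where "tau \<equiv> endo X (X * Y)"

text \<open>Endomorphisms compose in the order opposite to mappings, so \<open>\<alpha>\<close> in the rule \<open>step\<close> is the coordinate
  change in the target.  Neighbouring automorphisms are merged; the index counts the contractions.\<close>

inductive prodn :: "nat \<Rightarrow> ('k::field poly poly \<Rightarrow> 'k poly poly) \<Rightarrow> bool" where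
  auto: "alg_endo \<Phi> \<Longrightarrow> bij \<Phi> \<Longrightarrow> prodn 0 \<Phi>"
| step: "prodn n \<Psi> \<Longrightarrow> alg_endo \<alpha> \<Longrightarrow> bij \<alpha> \<Longrightarrow> prodn (Suc n) (\<Psi> \<circ> tau \<circ> \<alpha>)"

lemma prodn_comp_auto: "prodn n \<Psi> \<Longrightarrow> alg_endo \<gamma> \<Longrightarrow> bij \<gamma> \<Longrightarrow> prodn n (\<Psi> \<circ> \<gamma>)"
proof (induction rule: prodn.induct)
  case (auto \<Phi>)
  then show ?case by (intro prodn.auto alg_endo_comp bij_comp)
next
  case (step n \<Psi> \<alpha>)
  then have "prodn (Suc n) (\<Psi> \<circ> tau \<circ> (\<alpha> \<circ> \<gamma>))" by (intro prodn.step alg_endo_comp bij_comp)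
  then show ?case by (simp only: comp_assoc)
qed

lemma prodn_alg_endo: "prodn n \<Psi> \<Longrightarrow> alg_endo \<Psi>"
  by (induction rule: prodn.induct) (intro alg_endo_comp alg_endo_endo | assumption)+

lemma jac_tau: "jac X (X * Y) = X"
  unfolding derivationD(2)[OF derivation_jac] jac_self jac_X_Y by (simp only: mult_zero_left add_0_left mult_1_right)

lemma inj_tau: "inj (tau :: 'k::field_char_0 poly poly \<Rightarrow> _)"
proof (rule jac_nonzero_inj)
  show "jac X (X * Y) \<noteq> (0 :: 'k poly poly)" unfolding jac_tau by simp
qed

lemma prodn_inj: "prodn n (\<Psi> :: 'k::field_char_0 poly poly \<Rightarrow> _) \<Longrightarrow> inj \<Psi>"
proof (induction rule: prodn.induct)
  case (step n \<Psi> \<alpha>)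
  then show ?case by (intro inj_compose inj_tau) (auto intro: bij_is_inj)
qed (rule bij_is_inj)

lemma foldr_comp: "foldr (\<circ>) fs g = foldr (\<circ>) fs id \<circ> g"
  by (induction fs) (simp_all add: comp_assoc)

lemma simple_contraction_tau: "simple_contraction tau"
  by (simp add: simple_contraction_def)

lemma product_iff_prodn:
  "product_of_simple_contractions \<Phi> \<longleftrightarrow> (\<exists>n. prodn n \<Phi>)"
proof
  assume "product_of_simple_contractions \<Phi>"
  then obtain fs where "\<forall>f\<in>set fs. simple_contraction f" "\<Phi> = foldr (\<circ>) fs id"
    unfolding product_of_simple_contractions_def by blast
  then show "\<exists>n. prodn n \<Phi>"
  proof (induction fs arbitrary: \<Phi> rule: rev_induct)
    case Nil
    then have "\<Phi> = id" by (simp add: fun_eq_iff)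
    then show ?case using prodn.auto[OF alg_endo_id bij_id] by blast
  next
    case (snoc f fs)
    have "\<exists>n. prodn n (foldr (\<circ>) fs id)" by (rule snoc.IH[OF _ refl]) (use snoc.prems(1) in simp)
    then obtain n where n: "prodn n (foldr (\<circ>) fs id)" ..
    have "foldr (\<circ>) [f] id = f" by (simp add: fun_eq_iff)
    then have \<Phi>: "\<Phi> = foldr (\<circ>) fs id \<circ> f"
      using snoc.prems(2) foldr_comp[of fs f] by (simp only: foldr_append)
    consider "alg_endo f" "bij f" | "f = tau"
      using snoc.prems(1) unfolding simple_contraction_def by auto
    then show ?case
    proof cases
      case 1
      then show ?thesis unfolding \<Phi> using prodn_comp_auto[OF n] by blast
    next
      case 2
      have "prodn (Suc n) (foldr (\<circ>) fs id \<circ> tau \<circ> id)"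
        by (rule prodn.step[OF n alg_endo_id bij_id])
      then show ?thesis unfolding \<Phi> 2 by (metis comp_id)
    qed
  qed
next
  assume "\<exists>n. prodn n \<Phi>"
  then obtain n where "prodn n \<Phi>" ..
  then show "product_of_simple_contractions \<Phi>"
  proof (induction rule: prodn.induct)
    case (auto \<Phi>)
    then show ?case unfolding product_of_simple_contractions_def
      by (intro exI[of _ "[\<Phi>]"]) (simp add: simple_contraction_def)
  next
    case (step n \<Psi> \<alpha>)
    then obtain fs where fs: "\<forall>f\<in>set fs. simple_contraction f" "\<Psi> = foldr (\<circ>) fs id"
      unfolding product_of_simple_contractions_def by blast
    have "\<Psi> \<circ> tau \<circ> \<alpha> = foldr (\<circ>) (fs @ [tau, \<alpha>]) id"
      using foldr_comp[of fs "tau \<circ> \<alpha>"] by (simp add: fs(2) comp_assoc)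
    moreover have "\<forall>f\<in>set (fs @ [tau, \<alpha>]). simple_contraction f"
      using fs(1) step simple_contraction_tau by (auto simp: simple_contraction_def)
    ultimately show ?case unfolding product_of_simple_contractions_def by blast
  qed
qed


section \<open>Splitting off a contraction\<close>

text \<open>The mapping \<open>(u, v)\<close> contracts a curve onto a point of the line \<open>p = 0\<close>, where \<open>(p, q)\<close> is a
  coordinate system whose origin is that point, and \<open>\<Psi>\<close> belongs to the remaining mapping.\<close>

definition splits where
  "splits \<Psi> p q u v \<longleftrightarrow> (\<exists>f g. inverse_pair p q f g) \<and> endo u v p = \<Psi> X \<and> endo u v q = \<Psi> X * \<Psi> Y"

lemma splits_iff_comp:
  assumes "alg_endo \<Psi>" "inverse_pair p q f g"
  shows "splits \<Psi> p q u v \<longleftrightarrow> endo u v = \<Psi> \<circ> tau \<circ> endo f g"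
proof
  have \<Psi>: "\<Psi> = endo (\<Psi> X) (\<Psi> Y)" by (rule endo_unique) fact
  note inv = assms(2)[unfolded inverse_pair_def]
  {
    assume "splits \<Psi> p q u v"
    then have "endo u v p = \<Psi> X" "endo u v q = \<Psi> X * \<Psi> Y" unfolding splits_def by blast+
    then have "endo u v \<circ> endo p q = endo (\<Psi> X) (\<Psi> X * \<Psi> Y)" unfolding endo_comp by simp
    also have "\<dots> = \<Psi> \<circ> tau"
    proof -
      have "endo (\<Psi> X) (\<Psi> X * \<Psi> Y) = endo (\<Psi> X) (\<Psi> Y) \<circ> tau"
        unfolding endo_comp endo_hom endo_X endo_Y ..
      then show ?thesis using \<Psi> by simp
    qed
    finally have "endo u v \<circ> (endo p q \<circ> endo f g) = \<Psi> \<circ> tau \<circ> endo f g" by (metis comp_assoc)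
    then show "endo u v = \<Psi> \<circ> tau \<circ> endo f g"
      using inv by (simp only: endo_comp endo_X_Y comp_id)
  }
  {
    assume *: "endo u v = \<Psi> \<circ> tau \<circ> endo f g"
    have "endo u v p = \<Psi> (tau X)" "endo u v q = \<Psi> (tau Y)"
      unfolding * comp_apply using inv by simp_all
    then show "splits \<Psi> p q u v"
      unfolding splits_def endo_X endo_Y alg_endoD(2)[OF assms(1)] using assms(2) by blast
  }
qed

lemma splits_scale:
  assumes \<Psi>: "alg_endo \<Psi>" and s: "splits \<Psi> p q u v" and p: "p = const2 a * p'" and a: "a \<noteq> 0"
  shows "splits (\<Psi> \<circ> endo (const2 (1 / a) * X) (const2 a * Y)) p' q u v"
proof -
  have p': "p' = const2 (1 / a) * p" using a by (simp add: p pCons_one)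
  obtain f g where "inverse_pair p q f g" using s unfolding splits_def by blast
  from inverse_pair_scale[OF this, of "1 / a" 1] a
  have "\<exists>f g. inverse_pair p' q f g" unfolding p' by (simp add: pCons_one)
  moreover have "endo u v p' = const2 (1 / a) * \<Psi> X"
    using s unfolding splits_def p' endo_hom by simp
  moreover have "endo u v q = (const2 (1 / a) * \<Psi> X) * (const2 a * \<Psi> Y)"
    using s a unfolding splits_def by (simp add: pCons_one)
  ultimately show ?thesis
    unfolding splits_def comp_apply endo_X endo_Y alg_endoD[OF \<Psi>] by blast
qed

lemma prime_elem_X: "prime_elem (X :: 'k::field poly poly)"
  by (intro lift_prime_elem_poly prime_elem_linear_field_poly) simp

lemma X_not_dvd_Y: "\<not> X dvd (Y :: 'k::field poly poly)"
proof
  assume "X dvd (Y :: 'k poly poly)"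
  then obtain c :: "'k poly poly" where "Y = X * c" ..
  then have "coeff (Y :: 'k poly poly) 1 = coeff (X * c) 1" by simp
  then have "1 = [:0, 1:] * coeff c 1" by simp
  then have "coeff (1 :: 'k poly) 0 = coeff ([:0, 1:] * coeff c 1) 0" by simp
  then show False by simp
qed

text \<open>Every polynomial in \<open>x = A / B\<close> and \<open>y = C / B\<close> becomes a polynomial in \<open>u\<close> and \<open>v\<close> after multiplication
  with a power of the denominator.\<close>

lemma clear_denominators:
  assumes "birational_with u v A B C"
  shows "\<exists>k H. endo u v H = endo u v B ^ k * G"
proof (induction G rule: poly2_induct)
  case (const a)
  show ?case by (rule exI[of _ 0], rule exI[of _ "const2 a"]) (simp only: endo_hom power_0 mult_1_left)
next
  case X
  have "endo u v A = endo u v B ^ 1 * X" using assms unfolding birational_with_def by simp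
  then show ?case by blast
next
  case Y
  have "endo u v C = endo u v B ^ 1 * Y" using assms unfolding birational_with_def by simp
  then show ?case by blast
next
  case (add G G')
  then obtain k H k' H' where H: "endo u v H = endo u v B ^ k * G" "endo u v H' = endo u v B ^ k' * G'" by blast
  have "endo u v (B ^ k' * H + B ^ k * H') = endo u v B ^ (k + k') * (G + G')"
    unfolding endo_hom H by (simp add: power_add algebra_simps)
  then show ?case by blast
next
  case (mult G G')
  then obtain k H k' H' where H: "endo u v H = endo u v B ^ k * G" "endo u v H' = endo u v B ^ k' * G'" by blast
  have "endo u v (H * H') = endo u v B ^ (k + k') * (G * G')"
    unfolding endo_hom H by (simp add: power_add algebra_simps)
  then show ?case by blast
qed

text \<open>The inverse of \<open>(u, v)\<close> is not defined generically on the line \<open>p = 0\<close>, because the preimage of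
  this line is contracted to a point; hence the equation of the line divides the denominator.\<close>

lemma splits_dvd_denominator:
  fixes u v :: "'k::field_char_0 poly poly"
  assumes s: "splits \<Psi> p q u v" and bir: "birational_with u v A B C"
  shows "p dvd B"
proof -
  obtain f g where inv: "inverse_pair p q f g" using s unfolding splits_def by blast
  obtain k H where H: "endo u v H = endo u v B ^ k * \<Psi> Y" using clear_denominators[OF bir] by blast
  have "endo u v (p * H) = endo u v (B ^ k * q)"
    using s unfolding splits_def endo_hom H by (simp add: mult_ac)
  then have "p * H = B ^ k * q"
    using jac_nonzero_inj[OF birational_with_jac[OF bir]] by (metis injD)
  then have "endo f g p * endo f g H = endo f g B ^ k * endo f g q"
    by (metis endo_hom(2) endo_hom(8))
  then have "X * endo f g H = endo f g B ^ k * Y" using inv unfolding inverse_pair_def by metis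
  then have "X dvd endo f g B ^ k * Y" by (metis dvd_triv_left)
  then have "X dvd endo f g B ^ k" using prime_elem_X X_not_dvd_Y by (metis prime_elem_dvd_mult_iff)
  then have "X dvd endo f g B" using prime_elem_X by (metis prime_elem_dvd_power)
  then obtain G where "endo f g B = X * G" ..
  then have "endo p q (endo f g B) = p * endo p q G" by (simp only: endo_hom endo_X)
  moreover have "endo p q (endo f g B) = B" using inv unfolding inverse_pair_def by (simp add: endo_endo)
  ultimately show ?thesis by (metis dvd_triv_left)
qed

lemma endo_inner_cong: "endo a b [:r:] = endo a c [:r:]"
proof (induction r)
  case (pCons x r)
  then show ?case unfolding endo_const_pCons[of _ _ x r] by simp
qed (simp add: endo_hom)

lemma bij_shear:
  fixes b :: "'k::field"
  assumes "b \<noteq> 0" shows "bij (endo X (const2 b * Y + [:r:]))"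
proof (rule inverse_pair_bij)
  have r: "endo X c [:r:] = [:r:]" for c
    using endo_inner_cong[of X c r Y] by simp
  have "const2 (1 / b) * (const2 b * Y) = Y" "const2 b * (const2 (1 / b) * z) = z" for z :: "'k poly poly"
    using assms by (simp_all add: pCons_one)
  then show "inverse_pair X (const2 b * Y + [:r:]) X (const2 (1 / b) * (Y - [:r:]))"
    unfolding inverse_pair_def endo_hom endo_X endo_Y r by (simp only: add_diff_cancel_right' diff_add_cancel simp_thms)
qed

text \<open>The cofactor is determined by the line and the point up to an automorphism.  The partner \<open>q\<close> of the
  coordinate \<open>p\<close> may be replaced by any slice, since this changes it by a polynomial in \<open>p\<close> only, and then
  the constant \<open>e\<close> is determined by \<open>p\<close> and the slice.\<close>

lemma splits_cofactor:
  fixes u v :: "'k::field_char_0 poly poly"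
  assumes \<Psi>: "alg_endo \<Psi>" "inj \<Psi>" and s: "splits \<Psi> p q u v" and q': "jac p q' = 1"
  obtains \<gamma> h0 e0 where "alg_endo \<gamma>" "bij \<gamma>"
    "endo u v q' = endo u v p * h0 + const2 e0"
    "\<And>h e. endo u v q' = endo u v p * h + const2 e \<Longrightarrow> endo (endo u v p) h = \<Psi> \<circ> \<gamma>"
proof -
  obtain f g where "inverse_pair p q f g" using s unfolding splits_def by blast
  then obtain b r where b: "b \<noteq> 0" and q'_eq: "q' = const2 b * q + endo p q [:r:]"
    using q' by (rule slice_unique)
  obtain r0 r1 where r: "r = pCons r0 r1" by (cases r)
  have up: "endo u v p = \<Psi> X" and uq: "endo u v q = \<Psi> X * \<Psi> Y"
    using s unfolding splits_def by blast+
  have \<Psi>eq: "\<Psi> = endo (\<Psi> X) (\<Psi> Y)" by (rule endo_unique) (rule \<Psi>)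
  let ?\<gamma> = "endo X (const2 b * Y + [:r1:])"
  define h0 where "h0 = \<Psi> (const2 b * Y + [:r1:])"
  have "\<Psi> [:r1:] = endo (\<Psi> X) (\<Psi> X * \<Psi> Y) [:r1:]"
    using \<Psi>eq endo_inner_cong by metis
  then have h0: "h0 = const2 b * \<Psi> Y + endo (\<Psi> X) (\<Psi> X * \<Psi> Y) [:r1:]"
    unfolding h0_def alg_endoD[OF \<Psi>(1)] by simp
  have "endo u v q' = const2 b * (\<Psi> X * \<Psi> Y) + (const2 r0 + \<Psi> X * endo (\<Psi> X) (\<Psi> X * \<Psi> Y) [:r1:])"
    unfolding q'_eq endo_hom endo_endo up uq r endo_const_pCons[of _ _ r0 r1] ..
  also have "\<dots> = \<Psi> X * h0 + const2 r0" unfolding h0 by (simp only: distrib_left mult_ac add_ac)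
  finally have uq': "endo u v q' = endo u v p * h0 + const2 r0" unfolding up .
  show ?thesis
  proof (rule that[OF alg_endo_endo bij_shear[OF b] uq'])
    fix h e assume "endo u v q' = endo u v p * h + const2 e"
    with uq' have "\<Psi> X * h + const2 e = \<Psi> X * h0 + const2 r0" unfolding up by simp
    then have "\<Psi> X * (h0 - h) = const2 e - const2 r0" by algebra
    then have eq: "\<Psi> X * (h0 - h) = const2 (e - r0)" by simp
    have "h = h0"
    proof (cases "e = r0")
      case True
      have "\<Psi> X \<noteq> \<Psi> 0" using \<Psi>(2) by (simp add: inj_eq)
      with eq True show ?thesis by (simp add: alg_endo_simps[OF \<Psi>(1)])
    next
      case False
      then have "const2 (e - r0) * const2 (1 / (e - r0)) = 1" by (simp add: pCons_one)
      then have "\<Psi> X * ((h0 - h) * const2 (1 / (e - r0))) = 1" using eq by (metis mult.assoc)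
      then obtain a where "\<Psi> X = const2 a" by (rule dvd_one_const2)
      then have "\<Psi> X = \<Psi> (const2 a)" by (simp only: alg_endoD(3)[OF \<Psi>(1)])
      then have "X = const2 a" using \<Psi>(2) by (simp only: inj_eq)
      then show ?thesis by simp
    qed
    have "\<Psi> \<circ> ?\<gamma> = endo (\<Psi> X) h0"
    proof -
      have "endo (\<Psi> X) (\<Psi> Y) \<circ> ?\<gamma> = endo (\<Psi> X) (endo (\<Psi> X) (\<Psi> Y) (const2 b * Y + [:r1:]))"
        unfolding endo_comp endo_X ..
      then show ?thesis unfolding h0_def using \<Psi>eq by simp
    qed
    then show "endo (endo u v p) h = \<Psi> \<circ> ?\<gamma>" unfolding up \<open>h = h0\<close> ..
  qed
qed


section \<open>Certificates\<close>

text \<open>If \<open>L\<close> is linear, these finitely many equations say that the functional \<open>\<Lambda>\<close> vanishes on \<open>L q\<close> for all \<open>q\<close>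
  with both degrees less than \<open>N\<close>.\<close>

definition annihilates where
  "annihilates \<Lambda> L N \<longleftrightarrow> (\<forall>i<N. \<forall>j<N. ip \<Lambda> (L (X ^ i * Y ^ j)) = 0)"

text \<open>For \<open>t = x\<close> or \<open>t = y\<close> this shows that \<open>(u, v)\<close> is not an automorphism: the inverse of an automorphism
  would contain a solution \<open>f\<close> of \<open>f(u, v) = t\<close> within the bound.\<close>

definition no_preimage where
  "no_preimage \<Lambda> u v t \<longleftrightarrow> annihilates \<Lambda> (endo u v) (Suc (degree u + degree v + degx u + degx v)) \<and> ip \<Lambda> t \<noteq> 0"

text \<open>This shows that \<open>p\<close> is not a coordinate, since a coordinate has a slice within the bound.\<close>

definition no_slice where
  "no_slice \<Lambda> p \<longleftrightarrow> annihilates \<Lambda> (jac p) (Suc (slice_bound p)) \<and> ip \<Lambda> 1 \<noteq> 0"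

text \<open>The condition at 1 makes the functional insensitive to constants, so that it excludes \<open>z = w h + e\<close> for
  every constant \<open>e\<close>.\<close>

definition no_quotient where
  "no_quotient \<Lambda> w z \<longleftrightarrow> annihilates \<Lambda> ((*) w) (Suc (degree z + degx z)) \<and> ip \<Lambda> 1 = 0 \<and> ip \<Lambda> z \<noteq> 0"

lemma no_preimage_sound:
  fixes u v :: "'k::{alg_closed_field, field_char_0} poly poly"
  assumes "inverse_pair u v f g" shows "\<not> no_preimage \<Lambda> u v X" "\<not> no_preimage \<Lambda> u v Y"
proof -
  note d = inverse_pair_degrees[OF assms]
  let ?N = "Suc (degree u + degree v + degx u + degx v)"
  have "ip \<Lambda> (endo u v f) = 0" "ip \<Lambda> (endo u v g) = 0" if "annihilates \<Lambda> (endo u v) ?N"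
    using functional_certificate_sound[OF linear_endo_endo that[unfolded annihilates_def]] d by simp_all
  then show "\<not> no_preimage \<Lambda> u v X" "\<not> no_preimage \<Lambda> u v Y"
    using assms unfolding no_preimage_def inverse_pair_def by auto
qed

lemma no_preimage_complete:
  assumes "\<And>f. endo u v f \<noteq> t" shows "\<exists>\<Lambda>. no_preimage \<Lambda> u v t"
  using functional_certificate_complete[OF linear_endo_endo, of t u v 0] assms
  unfolding no_preimage_def annihilates_def by (metis add.right_neutral mult_zero_right)

lemma no_slice_sound:
  fixes p :: "'k::{alg_closed_field, field_char_0} poly poly"
  assumes "inverse_pair p q f g" shows "\<not> no_slice \<Lambda> p"
proof
  assume ns: "no_slice \<Lambda> p"
  obtain s where "jac p s = 1" "degree s \<le> slice_bound p" "degx s \<le> slice_bound p"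
    using bounded_slice_exists[OF assms] by blast
  with functional_certificate_sound[OF linear_endo_jac, of "Suc (slice_bound p)" \<Lambda> p s] ns
  show False unfolding no_slice_def annihilates_def by simp
qed

lemma no_slice_complete:
  assumes "\<And>q. jac p q \<noteq> 1" shows "\<exists>\<Lambda>. no_slice \<Lambda> p"
  using functional_certificate_complete[OF linear_endo_jac, of 1 p 0] assms
  unfolding no_slice_def annihilates_def by (metis add.right_neutral mult_zero_right)

lemma no_quotient_sound:
  assumes z: "z = w * h + const2 e" and w: "w \<noteq> 0" shows "\<not> no_quotient \<Lambda> w z"
proof
  assume nq: "no_quotient \<Lambda> w z"
  have wh: "w * h = z - const2 e" using z by simp
  have "degree (w * h) \<le> degree z" "degx (w * h) \<le> degx z"
    unfolding wh by (rule degree_diff_le degx_diff_le; simp)+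
  then have "degree h \<le> degree z" "degx h \<le> degx z"
    using w degree_mult_eq[of w h] degx_mult[of w h] by (cases "h = 0"; simp)+
  then have "ip \<Lambda> (w * h) = 0"
    using functional_certificate_sound[OF linear_endo_mult, of "Suc (degree z + degx z)" \<Lambda> w h] nq
    unfolding no_quotient_def annihilates_def by simp
  moreover have "ip \<Lambda> (const2 e * 1) = e * ip \<Lambda> 1" by (rule ip_const2_mult)
  ultimately have "ip \<Lambda> z = 0" unfolding z ip_add using nq unfolding no_quotient_def by simp
  with nq show False unfolding no_quotient_def by blast
qed

lemma no_quotient_complete:
  assumes "\<And>h e. z \<noteq> w * h + const2 e" shows "\<exists>\<Lambda>. no_quotient \<Lambda> w z"
  using functional_certificate_complete[OF linear_endo_mult, of z w 1] assms
  unfolding no_quotient_def annihilates_def by (metis mult_1_right)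

text \<open>A possible divisor \<open>p\<close> of the denominator is dismissed for one of four reasons: it has no slice; it has a slice
  \<open>q\<close>, but \<open>(p, q)\<close> is not an automorphism, so no other slice is a partner either; the preimage of the
  line \<open>p = 0\<close> is not contracted to a point; or the remaining mapping \<open>(p(u, v), h)\<close> is not a product.
  The latter is expressed by \<open>Q\<close>, which will be membership in the list that forms the certificate.\<close>

type_synonym 'k candidate = "'k poly poly \<times> 'k poly poly \<times> 'k poly poly \<times> 'k \<times> 'k poly poly"

definition candidate_ok where
  "candidate_ok Q u v = (\<lambda>(p, q, h, e, \<Lambda>). no_slice \<Lambda> p \<or>
     jac p q = 1 \<and> (no_preimage \<Lambda> p q X \<or> no_preimage \<Lambda> p q Y \<or>
       no_quotient \<Lambda> (endo u v p) (endo u v q) \<or>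
       endo u v q = endo u v p * h + const2 e \<and> Q (endo u v p) h))"

text \<open>The first two conditions show that \<open>(u, v)\<close> is birational, but not an automorphism.  The roots \<open>rs\<close> describe the
  denominator \<open>B\<close>; each selection \<open>S\<close> of roots belongs to one possible divisor of \<open>B\<close>, which has to be
  dismissed.\<close>

type_synonym 'k node = "'k poly poly \<times> 'k poly poly \<times> 'k poly poly \<times> 'k poly poly \<times> 'k poly poly \<times>
  'k poly poly \<times> 'k \<times> 'k list \<times> 'k candidate list"

definition node_ok :: "('k::field poly poly \<Rightarrow> 'k poly poly \<Rightarrow> bool) \<Rightarrow> 'k node \<Rightarrow> bool" where
  "node_ok Q = (\<lambda>(u, v, A, B, C, \<Lambda>, b, rs, cands).
     birational_with u v A B C \<and> (no_preimage \<Lambda> u v X \<or> no_preimage \<Lambda> u v Y) \<and>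
     kron (Suc (degree B)) B = [:b:] * linprod rs \<and>
     (\<forall>S\<in>set (subseqs rs). \<exists>k\<in>set cands. degree (fst k) < Suc (degree B) \<and>
        kron (Suc (degree B)) (fst k) = linprod S \<and> candidate_ok Q u v k))"

definition listed :: "'k::field node list \<Rightarrow> 'k poly poly \<Rightarrow> 'k poly poly \<Rightarrow> bool" where
  "listed L u v \<longleftrightarrow> (\<exists>n\<in>set L. fst n = u \<and> fst (snd n) = v)"

definition neg_ok :: "'k::field node list \<Rightarrow> bool" where
  "neg_ok L \<longleftrightarrow> (\<forall>n\<in>set L. node_ok (listed L) n)"

lemma listed_node_ok:
  assumes "neg_ok L" "listed L u v"
  obtains A B C \<Lambda> b rs cands where "node_ok (listed L) (u, v, A, B, C, \<Lambda>, b, rs, cands)"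
proof -
  from assms obtain n where n: "node_ok (listed L) n" "fst n = u" "fst (snd n) = v"
    unfolding neg_ok_def listed_def by blast
  obtain A B C \<Lambda> b rs cands where "snd (snd n) = (A, B, C, \<Lambda>, b, rs, cands)"
    by (cases "snd (snd n)" rule: prod_cases7)
  then have "n = (u, v, A, B, C, \<Lambda>, b, rs, cands)" using n(2,3) by (simp add: prod_eq_iff)
  with n(1) that show ?thesis by blast
qed

lemma candidate_ok_mono:
  "candidate_ok Q u v k \<Longrightarrow> (\<And>u v. Q u v \<Longrightarrow> Q' u v) \<Longrightarrow> candidate_ok Q' u v k"
  unfolding candidate_ok_def split_def by blast

lemma node_ok_mono:
  assumes "node_ok Q n" "\<And>u v. Q u v \<Longrightarrow> Q' u v" shows "node_ok Q' n"
proof -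
  have m: "candidate_ok Q u v k \<Longrightarrow> candidate_ok Q' u v k" for u v k
    using candidate_ok_mono[where Q = Q and Q' = Q'] assms(2) by blast
  from assms(1) show ?thesis unfolding node_ok_def split_def by (blast intro: m)
qed

text \<open>A product with the least number of contractions in the list is not an automorphism; splitting off a
  contraction leads to the divisor of \<open>B\<close> given by some selection of roots.  The only reason for which it
  can be dismissed is that the remaining mapping is in the list, and that one has a contraction less.\<close>

lemma neg_ok_sound:
  fixes L :: "'k::{alg_closed_field, field_char_0} node list"
  assumes "neg_ok L" "prodn m (endo u v)" "listed L u v" shows False
  using assms(2,3)
proof (induction m arbitrary: u v)
  case 0
  obtain A B C \<Lambda> b rs cands where ok: "node_ok (listed L) (u, v, A, B, C, \<Lambda>, b, rs, cands)"
    using listed_node_ok[OF assms(1) 0(2)] .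
  from 0(1) have "bij (endo u v)" by cases
  with ok show False unfolding node_ok_def prod.case using inverse_pair_ex no_preimage_sound by blast
next
  case (Suc m)
  obtain A B C \<Lambda> b rs cands where ok: "node_ok (listed L) (u, v, A, B, C, \<Lambda>, b, rs, cands)"
    using listed_node_ok[OF assms(1) Suc.prems(2)] .
  have bir: "birational_with u v A B C" using ok unfolding node_ok_def prod.case by blast
  have inj: "inj (endo u v)" by (rule jac_nonzero_inj[OF birational_with_jac[OF bir]])
  from Suc.prems(1) obtain \<Psi> \<alpha> where \<Psi>: "prodn m \<Psi>" and \<alpha>: "alg_endo \<alpha>" "bij \<alpha>"
    and eq: "endo u v = \<Psi> \<circ> tau \<circ> \<alpha>" by cases auto
  have \<alpha>eq: "\<alpha> = endo (\<alpha> X) (\<alpha> Y)" by (rule endo_unique) (rule \<alpha>)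
  then obtain p q where inv: "inverse_pair p q (\<alpha> X) (\<alpha> Y)"
    using inverse_pair_ex[of "\<alpha> X" "\<alpha> Y"] \<alpha>(2) inverse_pair_sym by metis
  have s: "splits \<Psi> p q u v"
    unfolding splits_iff_comp[OF prodn_alg_endo[OF \<Psi>] inv] eq using \<alpha>eq by simp
  have "p dvd B" by (rule splits_dvd_denominator[OF s bir])
  moreover have "B \<noteq> 0" using bir unfolding birational_with_def by (auto simp: endo_hom)
  moreover have "kron (Suc (degree B)) B = smult b (linprod rs)"
    using ok unfolding node_ok_def by simp
  ultimately obtain S a where S: "S \<in> set (subseqs rs)" and a: "a \<noteq> 0"
    and unique: "\<And>p'. degree p' < Suc (degree B) \<Longrightarrow>
      kron (Suc (degree B)) p' = linprod S \<Longrightarrow> p = const2 a * p'"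
    using divisor_candidate by metis
  from ok S obtain k where "degree (fst k) < Suc (degree B)"
      "kron (Suc (degree B)) (fst k) = linprod S" "candidate_ok (listed L) u v k"
    unfolding node_ok_def prod.case by blast
  then obtain p' q' h e \<Lambda>' where p': "degree p' < Suc (degree B)"
      "kron (Suc (degree B)) p' = linprod S"
    and cand: "candidate_ok (listed L) u v (p', q', h, e, \<Lambda>')"
    by (cases k rule: prod_cases5) simp
  let ?\<beta> = "endo (const2 (1 / a) * X) (const2 a * Y)"
  \<comment> \<open>The candidate is a multiple of \<open>p\<close>; a dilation adapts the coordinates.\<close>
  define \<Psi>' where "\<Psi>' = \<Psi> \<circ> ?\<beta>"
  have \<beta>: "inverse_pair (const2 (1 / a) * X) (const2 a * Y) (const2 a * X) (const2 (1 / a) * Y)"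
    unfolding inverse_pair_def endo_hom endo_X endo_Y using a by (simp add: pCons_one)
  have \<Psi>': "prodn m \<Psi>'"
    unfolding \<Psi>'_def by (rule prodn_comp_auto[OF \<Psi> alg_endo_endo inverse_pair_bij[OF \<beta>]])
  have s': "splits \<Psi>' p' q u v"
    unfolding \<Psi>'_def by (rule splits_scale[OF prodn_alg_endo[OF \<Psi>] s unique[OF p'] a])
  then obtain f g where inv': "inverse_pair p' q f g" unfolding splits_def by blast
  then have slice: "jac p' q' = 1"
    using cand no_slice_sound unfolding candidate_ok_def prod.case by blast
  obtain \<gamma> h0 e0 where \<gamma>: "alg_endo \<gamma>" "bij \<gamma>" and ex: "endo u v q' = endo u v p' * h0 + const2 e0"
    and cof: "\<And>h e. endo u v q' = endo u v p' * h + const2 e \<Longrightarrow> endo (endo u v p') h = \<Psi>' \<circ> \<gamma>"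
    using splits_cofactor[OF prodn_alg_endo[OF \<Psi>'] prodn_inj[OF \<Psi>'] s' slice] by metis
  have p'0: "endo u v p' \<noteq> 0"
  proof
    assume "endo u v p' = 0"
    then have "endo u v p' = endo u v 0" by (simp add: endo_hom)
    then have "p' = 0" using inj by (simp only: inj_eq)
    with slice show False by (simp add: jac_def dx_def endo_hom)
  qed
  obtain a' r where a': "a' \<noteq> 0" and q': "q' = const2 a' * q + endo p' q [:r:]"
    using slice_unique[OF inv' slice] .
  have "\<exists>f g. inverse_pair p' q' f g"
  proof -
    have "endo p' q \<circ> endo X (const2 a' * Y + [:r:]) = endo p' q'"
      unfolding endo_comp endo_hom endo_X endo_Y q' ..
    moreover have "bij (endo p' q \<circ> endo X (const2 a' * Y + [:r:]))"
      by (intro bij_comp bij_shear inverse_pair_bij[OF inv'] a')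
    ultimately show ?thesis using inverse_pair_ex by metis
  qed
  then have "\<not> no_preimage \<Lambda>' p' q' X" "\<not> no_preimage \<Lambda>' p' q' Y" using no_preimage_sound by blast+
  moreover have "\<not> no_slice \<Lambda>' p'" by (rule no_slice_sound[OF inv'])
  moreover have "\<not> no_quotient \<Lambda>' (endo u v p') (endo u v q')" by (rule no_quotient_sound[OF ex p'0])
  ultimately have h: "endo u v q' = endo u v p' * h + const2 e" and in_L: "listed L (endo u v p') h"
    using cand unfolding candidate_ok_def prod.case by blast+
  have "prodn m (endo (endo u v p') h)" unfolding cof[OF h] by (rule prodn_comp_auto[OF \<Psi>' \<gamma>])
  from Suc.IH[OF this in_L] show False .
qed


subsection \<open>Existence of certificates\<close>

text \<open>The exponents of the leading monomial in the lexicographic order add up under multiplication, and only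
  constants have the sum 0.\<close>

definition deg_measure :: "'k::field poly poly \<Rightarrow> nat" where
  "deg_measure p = degree p + degree (lead_coeff p)"

lemma deg_measure_mult: "p \<noteq> 0 \<Longrightarrow> q \<noteq> 0 \<Longrightarrow> deg_measure (p * q) = deg_measure p + deg_measure q"
  unfolding deg_measure_def lead_coeff_mult by (simp add: degree_mult_eq)

lemma deg_measure_0_imp: assumes "deg_measure p = 0" obtains a where "p = const2 a"
proof -
  have d: "degree p = 0" "degree (coeff p (degree p)) = 0"
    using assms[unfolded deg_measure_def add_is_0] by blast+
  from d(1) obtain q where q: "p = [:q:]" by (rule degree_eq_zeroE)
  with d(2) have "degree q = 0" by simp
  then obtain a where "q = [:a:]" by (rule degree_eq_zeroE)
  with q that show ?thesis by blast
qed

text \<open>The chain rule for \<open>(u, v) = \<alpha>(w, w h)\<close> with an automorphism \<open>\<alpha>\<close> gives the Jacobian of \<open>(u, v)\<close> as a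
  constant times \<open>w\<close> times the Jacobian of \<open>(w, h)\<close>, and \<open>w\<close> is not constant.  This decrease is what makes
  certificates finite.\<close>

lemma split_off_contraction:
  fixes u v :: "'k::field_char_0 poly poly"
  assumes bir: "birational_with u v A B C" and inv: "inverse_pair p q f g"
    and h: "endo u v q = endo u v p * h + const2 e"
  shows "\<exists>A' B' C'. birational_with (endo u v p) h A' B' C'"
    and "deg_measure (jac (endo u v p) h) < deg_measure (jac u v)"
    and "prodn m (endo (endo u v p) h) \<Longrightarrow> prodn (Suc m) (endo u v)"
proof -
  define w where "w = endo u v p"
  have "inverse_pair X (Y - const2 e) X (Y + const2 e)"
    unfolding inverse_pair_def endo_hom endo_X endo_Y by simp
  then have "bij (endo p q \<circ> endo X (Y - const2 e))"
    by (intro bij_comp inverse_pair_bij[OF inv] inverse_pair_bij)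
  moreover have "endo p q \<circ> endo X (Y - const2 e) = endo p (q - const2 e)"
    unfolding endo_comp endo_hom endo_X endo_Y ..
  ultimately obtain f' g' where inv': "inverse_pair p (q - const2 e) f' g'"
    using inverse_pair_ex by metis
  have "splits (endo w h) p (q - const2 e) u v"
    unfolding splits_def endo_X endo_Y endo_hom h w_def using inv' by auto
  then have eq: "endo u v = endo w h \<circ> tau \<circ> endo f' g'"
    unfolding splits_iff_comp[OF alg_endo_endo inv'] .
  have "endo w h (tau (endo f' g' z)) = endo u v z" for z using fun_cong[OF eq, of z] by simp
  then have "birational_with w h (tau (endo f' g' A)) (tau (endo f' g' B)) (tau (endo f' g' C))"
    using bir unfolding birational_with_def by simp
  then show "\<exists>A' B' C'. birational_with (endo u v p) h A' B' C'" unfolding w_def by blast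
  show "prodn (Suc m) (endo u v)" if "prodn m (endo (endo u v p) h)"
    unfolding eq using that[folded w_def] by (rule prodn.step[OF _ alg_endo_endo inverse_pair_bij[OF inverse_pair_sym[OF inv']]])
  obtain k where k: "k \<noteq> 0" "jac f' g' = const2 k"
    using inverse_pair_jac[OF inverse_pair_sym[OF inv']] .
  have t: "endo w h \<circ> tau = endo w (w * h)" unfolding endo_comp endo_hom endo_X endo_Y ..
  have "u = endo w (w * h) f'" "v = endo w (w * h) g'"
    using fun_cong[OF eq[unfolded t], of X] fun_cong[OF eq[unfolded t], of Y]
    by (simp_all only: comp_apply endo_X endo_Y)
  then have "jac u v = const2 k * jac w (w * h)"
    using jac_endo[of w "w * h" f' g'] by (simp only: k endo_hom)
  also have "jac w (w * h) = w * jac w h"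
    unfolding derivationD(2)[OF derivation_jac] by simp
  finally have J: "jac u v = const2 k * (w * jac w h)" .
  have nz: "w \<noteq> 0" "jac w h \<noteq> 0" "const2 k \<noteq> 0"
    using J birational_with_jac[OF bir] by auto
  have "deg_measure (jac u v) = deg_measure (const2 k) + (deg_measure w + deg_measure (jac w h))"
    unfolding J using nz by (simp only: deg_measure_mult mult_eq_0_iff simp_thms)
  moreover have "deg_measure w \<noteq> 0"
  proof
    assume "deg_measure w = 0"
    then obtain a where "w = const2 a" by (rule deg_measure_0_imp)
    then have "endo u v p = endo u v (const2 a)" by (simp only: w_def endo_hom)
    then have "p = const2 a" using jac_nonzero_inj[OF birational_with_jac[OF bir]] by (simp only: inj_eq)
    then have "endo f g p = const2 a" by (simp only: endo_hom)
    then show False using inv unfolding inverse_pair_def by simp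
  qed
  ultimately show "deg_measure (jac (endo u v p) h) < deg_measure (jac u v)" by (simp only: w_def)
qed

text \<open>If the linear equations for \<open>q\<close>, for the inverse of \<open>(p, q)\<close> and for \<open>h\<close> are solvable, a contraction splits
  off, and the remaining mapping cannot be a product, as \<open>(u, v)\<close> would be one; otherwise a functional
  shows unsolvability.\<close>

lemma candidate_complete:
  fixes u v :: "'k::field_char_0 poly poly"
  assumes bir: "birational_with u v A B C" and not_prod: "\<not> (\<exists>m. prodn m (endo u v))"
    and IH: "\<And>(u' :: 'k poly poly) v' A' B' C'. deg_measure (jac u' v') < deg_measure (jac u v) \<Longrightarrow>
      birational_with u' v' A' B' C' \<Longrightarrow> \<not> (\<exists>m. prodn m (endo u' v')) \<Longrightarrow>
      \<exists>L. neg_ok L \<and> listed L u' v'"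
  shows "\<exists>q h e \<Lambda> L. neg_ok L \<and> candidate_ok (listed L) u v (p, q, h, e, \<Lambda>)"
proof -
  have nil: "neg_ok ([] :: 'k node list)" by (simp add: neg_ok_def)
  show ?thesis
  proof (cases "\<exists>q. jac p q = 1")
    case False
    then obtain \<Lambda> where "no_slice \<Lambda> p" using no_slice_complete by blast
    then show ?thesis using nil unfolding candidate_ok_def prod.case by blast
  next
    case True
    then obtain q where q: "jac p q = 1" ..
    show ?thesis
    proof (cases "(\<exists>f. endo p q f = X) \<and> (\<exists>g. endo p q g = Y)")
      case False
      then obtain \<Lambda> where "no_preimage \<Lambda> p q X \<or> no_preimage \<Lambda> p q Y" using no_preimage_complete by metis
      then show ?thesis using nil q unfolding candidate_ok_def prod.case by blast
    next
      case True
      then obtain f g where inv: "inverse_pair p q f g" using jac_nonzero_inverse_pair q by force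
      show ?thesis
      proof (cases "\<exists>h e. endo u v q = endo u v p * h + const2 e")
        case False
        then obtain \<Lambda> where "no_quotient \<Lambda> (endo u v p) (endo u v q)" using no_quotient_complete by metis
        then show ?thesis using nil q unfolding candidate_ok_def prod.case by blast
      next
        case True
        then obtain h e where h: "endo u v q = endo u v p * h + const2 e" by blast
        note so = split_off_contraction[OF bir inv h]
        have np: "\<not> (\<exists>m. prodn m (endo (endo u v p) h))" using so(3) not_prod by blast
        obtain A' B' C' where "birational_with (endo u v p) h A' B' C'" using so(1) by blast
        from IH[OF so(2) this np] obtain L where "neg_ok L" "listed L (endo u v p) h" by blast
        then show ?thesis using q h unfolding candidate_ok_def prod.case by blast
      qed
    qed
  qed
qed

text \<open>The certificates of the remaining mappings for all selections of roots are concatenated; their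
  entries remain justified in the longer list.\<close>

lemma neg_ok_complete:
  fixes u v :: "'k::{alg_closed_field, field_char_0} poly poly"
  assumes "birational_with u v A B C" "\<not> (\<exists>m. prodn m (endo u v))"
  shows "\<exists>L. neg_ok L \<and> listed L u v"
  using assms
proof (induction "deg_measure (jac u v)" arbitrary: u v A B C rule: less_induct)
  case less
  note bir = less.prems(1) and np = less.prems(2)
  have B: "B \<noteq> 0" using bir unfolding birational_with_def by (auto simp: endo_hom)
  let ?N = "Suc (degree B)"
  have "\<not> ((\<exists>f. endo u v f = X) \<and> (\<exists>g. endo u v g = Y))"
  proof
    assume "(\<exists>f. endo u v f = X) \<and> (\<exists>g. endo u v g = Y)"
    then obtain f g where "inverse_pair u v f g"
      using jac_nonzero_inverse_pair birational_with_jac[OF bir] by metis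
    then show False using np prodn.auto[OF alg_endo_endo inverse_pair_bij] by blast
  qed
  then obtain \<Lambda> where \<Lambda>: "no_preimage \<Lambda> u v X \<or> no_preimage \<Lambda> u v Y" using no_preimage_complete by metis
  have "kron ?N B \<noteq> 0" using kron_inj[of B ?N 0] B by (auto simp: kron_def)
  then obtain M where M: "kron ?N B = smult (lead_coeff (kron ?N B)) (\<Prod>x\<in>#M. [:- x, 1:])"
    using alg_closed_imp_factorization by blast
  obtain rs where rs: "mset rs = M" using ex_mset by blast
  define b where "b = lead_coeff (kron ?N B)"
  have "(\<Prod>x\<in>#M. [:- x, 1:]) = linprod rs"
    unfolding rs[symmetric] by (simp flip: prod_mset_prod_list)
  then have roots: "kron ?N B = [:b:] * linprod rs" using M unfolding b_def by simp
  have "\<forall>S. \<exists>k L. neg_ok L \<and> degree (fst k) < ?N \<and> kron ?N (fst k) = linprod S \<and>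
      candidate_ok (listed L) u v k"
  proof
    fix S :: "'k list"
    obtain p where p: "degree p < ?N" "kron ?N p = linprod S"
      using kron_surj[of ?N "linprod S"] by blast
    have "\<exists>q h e \<Lambda> L. neg_ok L \<and> candidate_ok (listed L) u v (p, q, h, e, \<Lambda>)"
      by (rule candidate_complete[OF bir np]) (rule less.hyps)
    then obtain q h e \<Lambda> L where "neg_ok L" "candidate_ok (listed L) u v (p, q, h, e, \<Lambda>)" by blast
    with p show "\<exists>k L. neg_ok L \<and> degree (fst k) < ?N \<and> kron ?N (fst k) = linprod S \<and>
      candidate_ok (listed L) u v k"
      by (intro exI[of _ "(p, q, h, e, \<Lambda>)"] exI[of _ L]) simp
  qed
  then obtain cand Ls where cl: "\<And>S. neg_ok (Ls S)" "\<And>S. degree (fst (cand S)) < ?N"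
      "\<And>S. kron ?N (fst (cand S)) = linprod S"
      "\<And>S. candidate_ok (listed (Ls S)) u v (cand S)"
    by metis
  define n where "n = (u, v, A, B, C, \<Lambda>, b, rs, map cand (subseqs rs))"
  define L where "L = n # concat (map Ls (subseqs rs))"
  have sub: "listed (Ls S) u' v' \<Longrightarrow> listed L u' v'" if "S \<in> set (subseqs rs)" for S u' v'
    using that by (auto simp: listed_def L_def)
  have "node_ok (listed L) n"
    unfolding node_ok_def n_def prod.case
  proof (intro conjI ballI)
    fix S assume S: "S \<in> set (subseqs rs)"
    show "\<exists>k\<in>set (map cand (subseqs rs)). degree (fst k) < ?N \<and>
        kron ?N (fst k) = linprod S \<and> candidate_ok (listed L) u v k"
      using S cl candidate_ok_mono[OF cl(4) sub[OF S]] by (intro bexI[of _ "cand S"]) auto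
  qed (fact bir \<Lambda> roots)+
  moreover have "node_ok (listed L) n'" if "S \<in> set (subseqs rs)" "n' \<in> set (Ls S)" for S n'
    using cl(1)[of S] that(2) node_ok_mono sub[OF that(1)] unfolding neg_ok_def by blast
  ultimately have "neg_ok L" unfolding neg_ok_def L_def[symmetric]
    by (subst (1) L_def) auto
  moreover have "listed L u v" by (simp add: listed_def L_def n_def)
  ultimately show ?case by blast
qed

text \<open>The components of a factor are followed by those of its inverse if it is an automorphism.\<close>

definition factor_data where
  "factor_data k \<longleftrightarrow> inverse_pair (fst k) (fst (snd k)) (fst (snd (snd k))) (snd (snd (snd k))) \<or>
     fst k = X \<and> fst (snd k) = X * Y"

definition compose_step where
  "compose_step s k = (endo (fst s) (snd s) (fst k), endo (fst s) (snd s) (fst (snd k)))"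

definition pos_ok :: "('k::field poly poly \<times> 'k poly poly \<times> 'k poly poly \<times> 'k poly poly) list \<Rightarrow>
    'k poly poly \<Rightarrow> 'k poly poly \<Rightarrow> bool" where
  "pos_ok fs u v \<longleftrightarrow>
    (\<forall>k\<in>set fs. factor_data k) \<and>
    foldl compose_step (X, Y) fs = (u, v)"

lemma foldl_endo:
  "foldl compose_step (s, t) fs = (u, v) \<Longrightarrow>
    endo u v = endo s t \<circ> foldr (\<circ>) (map (\<lambda>k. endo (fst k) (fst (snd k))) fs) id"
proof (induction fs arbitrary: s t)
  case (Cons k fs)
  then show ?case by (simp add: compose_step_def endo_comp[symmetric] comp_assoc)
qed simp

lemma pos_ok_sound: assumes "pos_ok fs u v" shows "product_of_simple_contractions (endo u v)"
proof -
  let ?E = "\<lambda>k::'a poly poly \<times> 'a poly poly \<times> 'a poly poly \<times> 'a poly poly. endo (fst k) (fst (snd k))"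
  have "endo u v = endo X Y \<circ> foldr (\<circ>) (map ?E fs) id"
    using assms unfolding pos_ok_def by (intro foldl_endo) blast
  then have "endo u v = foldr (\<circ>) (map ?E fs) id" unfolding endo_X_Y by simp
  moreover have "simple_contraction (?E k)" if k_in: "k \<in> set fs" for k
  proof -
    consider "inverse_pair (fst k) (fst (snd k)) (fst (snd (snd k))) (snd (snd (snd k)))"
      | "fst k = X" "fst (snd k) = X * Y" using assms k_in unfolding pos_ok_def factor_data_def by blast
    then show ?thesis
    proof cases
      case 1
      then show ?thesis using inverse_pair_bij alg_endo_endo unfolding simple_contraction_def by blast
    next
      case 2
      then show ?thesis by (simp only: simple_contraction_tau)
    qed
  qed
  ultimately show ?thesis unfolding product_of_simple_contractions_def
    by (intro exI[of _ "map ?E fs"]) auto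
qed

lemma pos_ok_complete:
  assumes "product_of_simple_contractions (endo u v)" shows "\<exists>fs. pos_ok fs u v"
proof -
  from assms obtain fs where fs: "\<forall>f\<in>set fs. simple_contraction f" "endo u v = foldr (\<circ>) fs id"
    unfolding product_of_simple_contractions_def by blast
  let ?E = "\<lambda>k::'a poly poly \<times> 'a poly poly \<times> 'a poly poly \<times> 'a poly poly. endo (fst k) (fst (snd k))"
  have "\<exists>k. factor_data k \<and> ?E k = f" if f_simple: "simple_contraction f" for f
  proof -
    consider "alg_endo f" "bij f" | "f = tau" using f_simple unfolding simple_contraction_def by blast
    then show ?thesis
    proof cases
      case 1
      then have f: "f = endo (f X) (f Y)" by (intro endo_unique)
      then obtain g h where "inverse_pair (f X) (f Y) g h" using inverse_pair_ex 1(2) by metis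
      with f show ?thesis by (intro exI[of _ "(f X, f Y, g, h)"]) (simp add: factor_data_def)
    next
      case 2
      then show ?thesis by (intro exI[of _ "(X, X * Y, 0, 0)"]) (simp add: factor_data_def)
    qed
  qed
  then obtain k where k: "\<And>f. simple_contraction f \<Longrightarrow> factor_data (k f) \<and> ?E (k f) = f" by metis
  let ?F = "foldl compose_step (X, Y) (map k fs)"
  have "endo (fst ?F) (snd ?F) = endo X Y \<circ> foldr (\<circ>) (map ?E (map k fs)) id"
    by (rule foldl_endo) simp
  also have "map ?E (map k fs) = fs" using fs(1) k by (simp add: map_idI)
  finally have eq: "endo (fst ?F) (snd ?F) = endo u v" by (simp only: endo_X_Y id_comp fs(2))
  have "fst ?F = u" "snd ?F = v"
    using fun_cong[OF eq, of X] fun_cong[OF eq, of Y] by (simp_all only: endo_X endo_Y)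
  then have "?F = (u, v)" by (simp add: prod_eq_iff)
  moreover have "\<forall>x\<in>set (map k fs). factor_data x" using fs(1) k by auto
  ultimately have "pos_ok (map k fs) u v" unfolding pos_ok_def by blast
  then show ?thesis by blast
qed


section \<open>Certificates can be checked by a program\<close>

lemma computable_prod_list:
  assumes "computable_ring S" "computable R (listR S) l"
  shows "computable R S (\<lambda>x. prod_list (l x))"
proof -
  have "computable R S (\<lambda>x. foldr (*) (l x) 1)"
    by (rule computable_foldr computable_times assms computable_fst computable_snd computable_id computable_1)+
  then show ?thesis by (simp add: prod_list.eq_foldr)
qed

lemma computable_uminus:
  assumes "computable_ring S" "computable R S f" shows "computable R S (\<lambda>x. - f x)"
proof -
  have "computable R S (\<lambda>x. 0 - f x)" by (rule computable_minus computable_0 assms)+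
  then show ?thesis by simp
qed

definition certifies where
  "certifies z w \<longleftrightarrow> (if fst w then pos_ok (fst (snd w)) (fst z) (snd z)
     else neg_ok (snd (snd w)) \<and> listed (snd (snd w)) (fst z) (snd z))"

context
  fixes K :: "'k::field repr"
  assumes K: "computable_ring K"
begin

abbreviation "KP \<equiv> polyR K"
abbreviation "KPP \<equiv> polyR KP"

lemma KP: "computable_ring KP" and KPP: "computable_ring KPP"
  by (rule computable_ring_polyR K)+

lemmas ring_rules = K KP KPP

lemmas basic_rules =
  computable_fst computable_snd computable_id ring_rules
  computable_conj computable_disj computable_not computable_list_all computable_list_ex computable_all_less
  computable_less computable_Suc computable_add_nat computable_mult_nat computable_nat
  computable_eq computable_pCons computable_0 computable_1
  computable_plus computable_minus computable_times computable_uminus computable_power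
  computable_degree computable_coeff computable_pderiv computable_sum_less

lemma computable_endo:
  assumes f: "computable R KPP f" and g: "computable R KPP g" and p: "computable R KPP p"
  shows "computable R KPP (\<lambda>x. endo (f x) (g x) (p x))"
  unfolding endo_def
proof (rule computable_horner[OF KP KPP _ _ p g])
  show "computable (prodR R KP) KPP (\<lambda>z. poly (map_poly const2 (snd z)) (f (fst z)))"
  proof (rule computable_horner[OF K KPP])
    show "computable (prodR (prodR R KP) K) KPP (\<lambda>z. const2 (snd z))" by (rule basic_rules)+
    show "computable (prodR R KP) KP snd" by (rule basic_rules)+
    show "computable (prodR R KP) KPP (\<lambda>x. f (fst x))" by (rule computable_comp[OF f] basic_rules)+
  qed simp
qed simp

lemma computable_degx: "computable R KPP f \<Longrightarrow> computable R natR (\<lambda>x. degx (f x))"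
  unfolding degx_def by (rule basic_rules computable_endo | assumption)+

lemma computable_jac:
  assumes "computable R KPP f" "computable R KPP g" shows "computable R KPP (\<lambda>x. jac (f x) (g x))"
  unfolding jac_def dx_def by (rule computable_endo basic_rules assms)+

lemma computable_ip:
  assumes f: "computable R KPP f" and g: "computable R KPP g" shows "computable R K (\<lambda>x. ip (f x) (g x))"
  unfolding ip_def by (rule basic_rules computable_comp[OF f] computable_comp[OF g] f g)+

lemma computable_kron:
  assumes k: "computable R natR k" and p: "computable R KPP p"
  shows "computable R KP (\<lambda>x. kron (k x) (p x))"
  unfolding kron_def
proof (rule computable_horner[OF KP KP _ _ p])
  show "computable (prodR R KP) KP (\<lambda>z. kron_const (k (fst z)) (snd z))"
    unfolding kron_const_def monom_altdef smult_1_left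
  proof (rule computable_horner[OF K KP])
    show "computable (prodR (prodR R KP) K) KP (\<lambda>z. [:snd z:])" by (rule basic_rules)+
    show "computable (prodR R KP) KP snd" by (rule basic_rules)+
    show "computable (prodR R KP) KP (\<lambda>x. [:0, 1:] ^ k (fst x))"
      by (rule computable_comp[OF k] basic_rules)+
  qed simp
  show "computable R KP (\<lambda>x. [:0, 1:])" by (rule basic_rules)+
qed (simp add: kron_const_hom)

lemmas poly_rules = computable_endo computable_degx computable_jac computable_ip computable_kron

lemma computable_no_preimage:
  assumes l: "computable R KPP l" and f: "computable R KPP f" and g: "computable R KPP g"
    and t: "computable R KPP t"
  shows "computable R boolR (\<lambda>x. no_preimage (l x) (f x) (g x) (t x))"
  unfolding no_preimage_def annihilates_def
  by (rule poly_rules basic_rules l f g t computable_comp[OF l] computable_comp[OF f] computable_comp[OF g])+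

lemma computable_no_slice:
  assumes l: "computable R KPP l" and f: "computable R KPP f"
  shows "computable R boolR (\<lambda>x. no_slice (l x) (f x))"
  unfolding no_slice_def annihilates_def slice_bound_def Let_def
  by (rule poly_rules basic_rules l f computable_comp[OF l] computable_comp[OF f])+

lemma computable_no_quotient:
  assumes l: "computable R KPP l" and f: "computable R KPP f" and g: "computable R KPP g"
  shows "computable R boolR (\<lambda>x. no_quotient (l x) (f x) (g x))"
  unfolding no_quotient_def annihilates_def
  by (rule poly_rules basic_rules l f g computable_comp[OF l] computable_comp[OF f] computable_comp[OF g])+

lemmas certificate_rules = computable_no_preimage computable_no_slice computable_no_quotient

abbreviation "candR \<equiv> prodR KPP (prodR KPP (prodR KPP (prodR K KPP)))"
abbreviation "nodeR \<equiv> prodR KPP (prodR KPP (prodR KPP (prodR KPP (prodR KPP (prodR KPP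
  (prodR K (prodR (listR K) (listR candR))))))))"

lemma computable_listed:
  assumes L: "computable R (listR nodeR) L" and f: "computable R KPP f" and g: "computable R KPP g"
  shows "computable R boolR (\<lambda>x. listed (L x) (f x) (g x))"
  unfolding listed_def
  by (rule L computable_comp[OF f] computable_comp[OF g] basic_rules)+

lemma computable_neg_ok:
  assumes L: "computable R (listR nodeR) L" shows "computable R boolR (\<lambda>x. neg_ok (L x))"
  unfolding neg_ok_def node_ok_def candidate_ok_def birational_with_def split_def
  by (rule L computable_comp[OF L] computable_listed certificate_rules computable_subseqs computable_prod_list
      computable_map poly_rules basic_rules)+

abbreviation "posR \<equiv> listR (prodR KPP (prodR KPP (prodR KPP KPP)))"

lemma computable_pos_ok:
  assumes L: "computable R posR L" and f: "computable R KPP f" and g: "computable R KPP g"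
  shows "computable R boolR (\<lambda>x. pos_ok (L x) (f x) (g x))"
  unfolding pos_ok_def compose_step_def factor_data_def inverse_pair_def prod_eq_iff fst_conv snd_conv
  by (rule L f g computable_foldl computable_Pair poly_rules basic_rules)+

abbreviation "certificateR \<equiv> prodR boolR (prodR posR (listR nodeR))"

lemma computable_certifies:
  "computable (prodR (prodR KPP KPP) certificateR) boolR (\<lambda>x. certifies (fst x) (snd x))"
  unfolding certifies_def
  by (rule computable_if computable_pos_ok computable_neg_ok computable_listed basic_rules)+

end

lemma certifies_sound:
  fixes u v :: "'k::{alg_closed_field, field_char_0} poly poly"
  assumes "certifies (u, v) w" shows "fst w \<longleftrightarrow> product_of_simple_contractions (endo u v)"
proof (cases "fst w")
  case True
  then show ?thesis using assms pos_ok_sound by (auto simp: certifies_def)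
next
  case False
  then show ?thesis using assms neg_ok_sound by (auto simp: certifies_def product_iff_prodn)
qed

lemma certifies_complete:
  fixes u v :: "'k::{alg_closed_field, field_char_0} poly poly"
  assumes "birational (endo u v)" shows "\<exists>w. certifies (u, v) w"
proof (cases "product_of_simple_contractions (endo u v)")
  case True
  then obtain fs where "pos_ok fs u v" using pos_ok_complete by blast
  then show ?thesis by (intro exI[of _ "(True, fs, [])"]) (simp add: certifies_def)
next
  case False
  obtain A B C where "birational_with u v A B C" using birational_imp_birational_with[OF assms] by blast
  then obtain L where "neg_ok L" "listed L u v" using neg_ok_complete False product_iff_prodn by metis
  then show ?thesis by (intro exI[of _ "(False, [], L)"]) (simp add: certifies_def)
qed

lemma poly_code_represents: "polyR (polyR (fieldR c)) (poly_code u) (poly_of c u)"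
proof -
  have "polyR (fieldR c) (list_encode (map aexp_code es)) (Poly (map (aval c) es))" for es
    unfolding polyR_def listR_def
    by (intro exI[of _ "map (aval c) es"]) (auto simp: list_all2_map1 list_all2_map2 fieldR_def intro: list.rel_refl)
  then show ?thesis
    unfolding polyR_def[of "polyR (fieldR c)"] listR_def poly_code_def poly_of_def
    by (intro exI[of _ "map (\<lambda>es. Poly (map (aval c) es)) u"])
      (auto simp: list_all2_map1 list_all2_map2 intro: list.rel_refl)
qed

theorem theorem1p1:
  fixes c :: "nat \<Rightarrow> 'k::{alg_closed_field, field_char_0}"
  assumes "effective_field c"
  shows "\<exists>A. \<forall>u v. birational (endo (poly_of c u) (poly_of c v)) \<longrightarrow>
    computes A [poly_code u, poly_code v]
      (if product_of_simple_contractions (endo (poly_of c u) (poly_of c v)) then 1 else 0)"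
proof -
  let ?K = "fieldR c"
  note K = computable_ring_fieldR[OF assms] and enum = enumerable_fieldR[OF assms]
  have "enumerable (certificateR ?K)"
    by (intro enumerable_prodR enumerable_boolR enumerable_listR enumerable_polyR enum)
  moreover have "computable (certificateR ?K) boolR fst" by (rule computable_fst computable_id)+
  ultimately obtain A where A: "\<And>n z. prodR (KPP ?K) (KPP ?K) n z \<Longrightarrow> \<exists>w. certifies z w \<Longrightarrow>
      \<exists>w. certifies z w \<and> computes A [n] (of_bool (fst w))"
    using decision_by_search[OF computable_certifies[OF K]] by blast
  obtain E where E: "\<And>a b. computes E [a, b] (prod_encode (a, b))" using ex_pair_program by blast
  show ?thesis
  proof (intro exI[of _ "Comp A [E]"] allI impI)
    fix u v assume bir: "birational (endo (poly_of c u) (poly_of c v))"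
    have "prodR (KPP ?K) (KPP ?K) (prod_encode (poly_code u, poly_code v)) (poly_of c u, poly_of c v)"
      by (simp add: poly_code_represents)
    from A[OF this certifies_complete[OF bir]] obtain w where w: "certifies (poly_of c u, poly_of c v) w"
      "computes A [prod_encode (poly_code u, poly_code v)] (of_bool (fst w))" by blast
    then have "computes (Comp A [E]) [poly_code u, poly_code v] (of_bool (fst w))"
      by (intro computes_Comp1[OF E])
    then show "computes (Comp A [E]) [poly_code u, poly_code v]
      (if product_of_simple_contractions (endo (poly_of c u) (poly_of c v)) then 1 else 0)"
      using certifies_sound[OF w(1)] by (simp add: of_bool_def)
  qed
qed

end
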